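(* Let $k=1$, let $D\subset\mathbb{R}$ be a non-degenerate interval with $\underline d:=\inf D$ and $\overline d:=\sup D$, and let $g\in B_b(S,D)$ be consistent. Assume that $f\in BC_\mu^{1-}([0,T]\times S\times D,\mathbb{R})$ and the following two conditions hold: (i) Whenever $\underline d>-\infty$ (resp. $\overline d<\infty$), then $f$ is both locally $\mu$-bounded and locally Lipschitz $\mu$-continuous at $\underline d$ (resp. $\overline d$) with $\lim_{w\downarrow\underline d}f(\cdot,x,w)\le0$ (resp. $\lim_{w\uparrow\overline d}f(\cdot,x,w)\ge0$) for all $x\in S$ $\mu$-a.s. (ii) If $\underline d=-\infty$ (resp. $\overline d=\infty$), then $f$ is affine $\mu$-bounded from above (resp. from below). Then there is a unique global bounded solution $\overline u_g$ to (M), and it agrees with $u_g$ (the unique non-extendible admissible solution to (M)) if $g$ is bounded away from $\{\underline d,\overline d\}\cap\mathbb{R}$. Moreover, if $\mathcal{X}$ is Feller (respectively right-hand Feller), $f(s,\cdot,\cdot)$ is continuous for $\mu$-a.e. $s\in[0,T]$, and $g$ is continuous, then $\overline u_g$ is continuous (respectively right-continuous).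
   Context: **Spaces.** $S$ is a separable metrizable topological space, $T>0$, $\mu$ is an atomless Borel measure on $[0,T]$. $[0,T]\times S$ carries a pseudometric $d_S$ whose topology is coarser than or equal to the product topology; $\mathcal{B}(I\times S)$, Borel measurability and continuity on $I\times S$ ($I\subset[0,T]$ an interval) refer to $d_S$. A map $u:I\times S\to\mathbb{R}$ is consistent if $u(r,x)=u(s,y)$ whenever $d_S((r,x),(s,y))=0$, and right-continuous if for all $(r,x)\in I\times S$ and $\varepsilon>0$ there is $\delta>0$ with $|u(s,y)-u(r,x)|<\varepsilon$ for all $(s,y)\in I\times S$ with $s\ge r$ and $d_S((s,y),(r,x))<\delta$. A map $g$ on $S$ is consistent if $g(x)=g(y)$ whenever $d_S((T,x),(T,y))=0$. $B(S,D)$, $B(I\times S,D)$ are the sets of $D$-valued Borel measurable maps; $B_b$ denotes the bounded ones. $g$ is bounded away from a set $A\subset\mathbb{R}$ if there is $\varepsilon>0$ with $|g(x)-z|\ge\varepsilon$ for all $x\in S$, $z\in A$ (vacuous if $A=\emptyset$). **Markov process.** $\mathcal{X}=(X,(\mathcal{F}_t)_{t\in[0,T]},\mathbb{P})$ is a fixed consistent progressive Markov process on a measurable space $(\Omega,\mathcal{F})$ with state space $S$ and Borel measurable transition probabilities: $X:[0,T]\times\Omega\to S$ is a process adapted to the filtration $(\mathcal{F}_t)$, $\mathbb{P}=\{P_{r,x}\mid(r,x)\in[0,T]\times S\}$ is a set of probability measures on $(\Omega,\mathcal{F})$ (expectations $E_{r,x}$), and: (1) for each $(s,y)$, $P_{s,y}$-a.s.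 $d_S((r,X_r),(r,y))=0$ for all $r\in[0,s]$; (2) $[0,t]\times S\to[0,1]$, $(s,x)\mapsto P_{s,x}(X_t\in B)$ is consistent and Borel measurable for all $t\in[0,T]$, $B\in\mathcal{B}(S)$; (3) $P_{r,x}(X_t\in B\mid\mathcal{F}_s)=P_{s,X_s}(X_t\in B)$ $P_{r,x}$-a.s. for all $r\le s\le t$, $x\in S$, $B\in\mathcal{B}(S)$; (4) $X$ is progressively measurable with respect to its natural filtration and its natural backward filtration. $\mathcal{X}$ is Feller (resp. right-hand Feller) if $[0,t]\times S\to\mathbb{R}$, $(r,x)\mapsto E_{r,x}[\varphi(X_t)]$ is continuous (resp. right-continuous) for all $t\in[0,T]$ and all bounded continuous $\varphi:S\to\mathbb{R}$. **Regularity with respect to $\mu$.** A property of $(s,y)$ holds "for all $y\in S$ $\mu$-a.s." if there is a $\mu$-null set outside of which in $s$ it holds for all $y\in S$. $a\in B([0,T]\times S,\mathbb{R}_+)$ is $\mu$-dominated if there is a $\mu$-integrable $\overline a\in B([0,T],\mathbb{R}_+)$ with $a(\cdot,y)\le\overline a$ for all $y\in S$ $\mu$-a.s. Let $f:[0,T]\times S\times D\to\mathbb{R}$ be $\mathcal{B}([0,T]\times S)\otimes\mathcal{B}(D)$-measurable. $f$ is locally $\mu$-bounded (resp. locally Lipschitz $\mu$-continuous) at $\hat w\in\overline D$ (the closure of $D$) if there are a neighborhood $W$ of $\hat w$ in $\overline D$ and a $\mu$-dominated $\lambda\in B([0,T]\times S,\mathbb{R}_+)$ with $|f(t,x,w)|\le\lambda(t,x)$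 (resp. $|f(t,x,w)-f(t,x,w')|\le\lambda(t,x)|w-w'|$) for all $(t,x)\in[0,T]\times S$ and $w,w'\in W\cap D$; it is locally $\mu$-bounded (resp. locally Lipschitz $\mu$-continuous) if it is so at each $\hat w\in D$. $BC_\mu^{1-}([0,T]\times S\times D,\mathbb{R})$ is the set of all such measurable $f$ that are locally $\mu$-bounded and locally Lipschitz $\mu$-continuous. $f$ is affine $\mu$-bounded from below if $f(t,x,w)\ge-a(t,x)-b(t,x)|w|$ for all $(t,x,w)$ and some $\mu$-dominated $a,b\in B([0,T]\times S,\mathbb{R}_+)$; it is affine $\mu$-bounded from above if $-f$ is affine $\mu$-bounded from below. **Problem (M).** An interval $I$ is admissible if $I=(t,T]$ or $I=[t,T]$ for some $t\in[0,T)$. A solution to (M) (with data $f,g$) on an admissible interval $I$ is a consistent $u\in B(I\times S,D)$ such that for all $r\le t$ in $I$ and $x\in S$, $|u(t,X_t)|$ and $\int_r^t|f(s,X_s,u(s,X_s))|\,\mu(ds)$ are finite and $P_{r,x}$-integrable, $E_{r,x}[u(t,X_t)]=u(r,x)+E_{r,x}[\int_r^tf(s,X_s,u(s,X_s))\,\mu(ds)]$, and $u(T,x)=g(x)$. It is global if $I=[0,T]$. A solution $u$ on $I$ is admissible if $u([r,T]\times S)$ is relatively compact in $D^\circ$ (its closure is a compact subset of $D^\circ$) for all $r\in I$. An admissible solution $u$ on $I$ is extendible if there is an admissible solution $\tilde u$ on an admissible interval $\tilde I\supsetneq I$ with $u=\tilde u$ on $I\times S$; otherwise it is non-extendible. If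 $f\in BC_\mu^{1-}$ and $g$ is bounded away from $\{\underline d,\overline d\}\cap\mathbb{R}$, there is a unique non-extendible admissible solution, denoted $u_g$.
   Formalization: Added assumption: the time coordinate (r,x) ↦ r is continuous for d_S on [0,T]×S; without it the claim fails (d_S = 0, μ Lebesgue, X constant, D = ℝ, f = 1, g = 0: consistency forces u = 0, which violates the equation). *)

theory Defs
  imports "HOL-Probability.Probability"
begin

section \<open>Pseudometrics on time-space\<close>

definition pseudometric_on :: "'a set \<Rightarrow> ('a \<Rightarrow> 'a \<Rightarrow> real) \<Rightarrow> bool" where
  "pseudometric_on A d \<longleftrightarrow>
     (\<forall>p\<in>A. \<forall>q\<in>A. 0 \<le> d p q \<and> d p q = d q p) \<and>
     (\<forall>p\<in>A. d p p = 0) \<and>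
     (\<forall>p\<in>A. \<forall>q\<in>A. \<forall>z\<in>A. d p z \<le> d p q + d q z)"

definition pm_topology :: "'a set \<Rightarrow> ('a \<Rightarrow> 'a \<Rightarrow> real) \<Rightarrow> 'a topology" where
  "pm_topology A d =
     topology (\<lambda>U. U \<subseteq> A \<and> (\<forall>p\<in>U. \<exists>r>0. {q\<in>A. d p q < r} \<subseteq> U))"

lemma openin_pm_topology:
  "openin (pm_topology A d) U \<longleftrightarrow> U \<subseteq> A \<and> (\<forall>p\<in>U. \<exists>r>0. {q\<in>A. d p q < r} \<subseteq> U)"
proof -
  have "istopology (\<lambda>U. U \<subseteq> A \<and> (\<forall>p\<in>U. \<exists>r>0. {q\<in>A. d p q < r} \<subseteq> U))"
    unfolding istopology_def
  proof (rule conjI; intro allI impI)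
    fix U V
    assume U: "U \<subseteq> A \<and> (\<forall>p\<in>U. \<exists>r>0. {q\<in>A. d p q < r} \<subseteq> U)"
      and V: "V \<subseteq> A \<and> (\<forall>p\<in>V. \<exists>r>0. {q\<in>A. d p q < r} \<subseteq> V)"
    have "\<exists>r>0. {q\<in>A. d p q < r} \<subseteq> U \<inter> V" if p: "p \<in> U \<inter> V" for p
    proof -
      obtain r s where "r > 0" "{q\<in>A. d p q < r} \<subseteq> U" "s > 0" "{q\<in>A. d p q < s} \<subseteq> V"
        using p U V by blast
      then show ?thesis by (intro exI[of _ "min r s"]) auto
    qed
    with U show "U \<inter> V \<subseteq> A \<and> (\<forall>p\<in>U \<inter> V. \<exists>r>0. {q\<in>A. d p q < r} \<subseteq> U \<inter> V)"
      by blast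
  next
    fix \<K>
    assume K: "\<forall>U\<in>\<K>. U \<subseteq> A \<and> (\<forall>p\<in>U. \<exists>r>0. {q\<in>A. d p q < r} \<subseteq> U)"
    have "\<exists>r>0. {q\<in>A. d p q < r} \<subseteq> \<Union>\<K>" if p: "p \<in> \<Union>\<K>" for p
    proof -
      obtain U where U: "U \<in> \<K>" "p \<in> U" using p by blast
      then obtain r where "r > 0" "{q\<in>A. d p q < r} \<subseteq> U" using K by blast
      with U show ?thesis by blast
    qed
    with K show "\<Union>\<K> \<subseteq> A \<and> (\<forall>p\<in>\<Union>\<K>. \<exists>r>0. {q\<in>A. d p q < r} \<subseteq> \<Union>\<K>)"
      by blast
  qed
  then show ?thesis
    by (simp add: pm_topology_def)
qed

definition pm_borel :: "'a set \<Rightarrow> ('a \<Rightarrow> 'a \<Rightarrow> real) \<Rightarrow> 'a measure" where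
  "pm_borel A d = sigma A {U. openin (pm_topology A d) U}"

definition pm_consistent :: "'a set \<Rightarrow> ('a \<Rightarrow> 'a \<Rightarrow> real) \<Rightarrow> ('a \<Rightarrow> 'b) \<Rightarrow> bool" where
  "pm_consistent A d u \<longleftrightarrow> (\<forall>p\<in>A. \<forall>q\<in>A. d p q = 0 \<longrightarrow> u p = u q)"

definition pm_continuous :: "'a set \<Rightarrow> ('a \<Rightarrow> 'a \<Rightarrow> real) \<Rightarrow> ('a \<Rightarrow> real) \<Rightarrow> bool" where
  "pm_continuous A d u \<longleftrightarrow> continuous_map (pm_topology A d) euclidean u"

type_synonym 's pm = "real \<times> 's \<Rightarrow> real \<times> 's \<Rightarrow> real"

definition pm_right_continuous ::
    "real set \<Rightarrow> 's pm \<Rightarrow> (real \<times> 's \<Rightarrow> real) \<Rightarrow> bool" where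
  "pm_right_continuous I d u \<longleftrightarrow>
     (\<forall>r\<in>I. \<forall>x. \<forall>\<epsilon>>0. \<exists>\<delta>>0. \<forall>s\<in>I. \<forall>y.
        r \<le> s \<and> d (s, y) (r, x) < \<delta> \<longrightarrow> \<bar>u (s, y) - u (r, x)\<bar> < \<epsilon>)"

text \<open>The separable metrizable space \<open>S\<close> is the type \<open>'s\<close>. The metric provided by the class
  \<^class>\<open>metric_space\<close> is never referred to; only the topology of \<open>'s\<close> is.\<close>

definition time_space_pseudometric ::
    "real \<Rightarrow> ('s::{metric_space, second_countable_topology}) pm \<Rightarrow> bool" where
  "time_space_pseudometric T d \<longleftrightarrow>
     pseudometric_on ({0..T} \<times> UNIV) d \<and>
     (\<forall>U. openin (pm_topology ({0..T} \<times> UNIV) d) U \<longrightarrow>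
          openin (top_of_set ({0..T} \<times> UNIV)) U)"


section \<open>Markov processes\<close>

text \<open>An atom is a set of positive measure that cannot be split into two non-null sets.\<close>

definition atomless :: "'a measure \<Rightarrow> bool" where
  "atomless M \<longleftrightarrow>
     \<not> (\<exists>A\<in>sets M. emeasure M A > 0 \<and>
          (\<forall>B\<in>sets M. B \<subseteq> A \<longrightarrow> emeasure M B = 0 \<or> emeasure M (A - B) = 0))"

definition generated_sigma ::
    "'o measure \<Rightarrow> (real \<Rightarrow> 'o \<Rightarrow> 's::topological_space) \<Rightarrow> real set \<Rightarrow> 'o measure" where
  "generated_sigma M X J =
     sigma (space M) {X s -` B \<inter> space M | s B. s \<in> J \<and> B \<in> sets borel}"

text \<open>\<open>M\<close> only carries the measurable space \<open>(\<Omega>, \<F>)\<close>; its measure is irrelevant. Likewise for the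
  members \<open>F t\<close> of the filtration.\<close>

definition consistent_progressive_markov ::
    "real \<Rightarrow> 's pm \<Rightarrow> 'o measure \<Rightarrow> (real \<Rightarrow> 'o measure)
     \<Rightarrow> (real \<Rightarrow> 'o \<Rightarrow> 's::{metric_space, second_countable_topology})
     \<Rightarrow> (real \<Rightarrow> 's \<Rightarrow> 'o measure) \<Rightarrow> bool" where
  "consistent_progressive_markov T d M F X P \<longleftrightarrow>
     (\<forall>t\<in>{0..T}. subalgebra M (F t)) \<and>
     (\<forall>s\<in>{0..T}. \<forall>t\<in>{0..T}. s \<le> t \<longrightarrow> sets (F s) \<subseteq> sets (F t)) \<and>
     (\<forall>t\<in>{0..T}. X t \<in> F t \<rightarrow>\<^sub>M borel) \<and>
     (\<forall>r\<in>{0..T}. \<forall>x. prob_space (P r x) \<and> sets (P r x) = sets M) \<and>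
     (\<forall>s\<in>{0..T}. \<forall>y. AE \<omega> in P s y. \<forall>r\<in>{0..s}. d (r, X r \<omega>) (r, y) = 0) \<and>
     (\<forall>t\<in>{0..T}. \<forall>B\<in>sets borel.
        pm_consistent ({0..t} \<times> UNIV) d (\<lambda>(s, x). measure (P s x) (X t -` B \<inter> space M)) \<and>
        (\<lambda>(s, x). measure (P s x) (X t -` B \<inter> space M))
          \<in> borel_measurable (pm_borel ({0..t} \<times> UNIV) d)) \<and>
     (\<forall>r\<in>{0..T}. \<forall>s\<in>{r..T}. \<forall>t\<in>{s..T}. \<forall>x. \<forall>B\<in>sets borel.
        AE \<omega> in P r x.
          real_cond_exp (P r x) (F s) (indicator (X t -` B \<inter> space M)) \<omega>
            = measure (P s (X s \<omega>)) (X t -` B \<inter> space M)) \<and>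
     (\<forall>t\<in>{0..T}.
        (\<lambda>(s, \<omega>). X s \<omega>)
          \<in> restrict_space borel {0..t} \<Otimes>\<^sub>M generated_sigma M X {0..t} \<rightarrow>\<^sub>M borel) \<and>
     (\<forall>t\<in>{0..T}.
        (\<lambda>(s, \<omega>). X s \<omega>)
          \<in> restrict_space borel {t..T} \<Otimes>\<^sub>M generated_sigma M X {t..T} \<rightarrow>\<^sub>M borel)"

definition feller ::
    "real \<Rightarrow> 's pm \<Rightarrow> (real \<Rightarrow> 'o \<Rightarrow> 's::topological_space)
     \<Rightarrow> (real \<Rightarrow> 's \<Rightarrow> 'o measure) \<Rightarrow> bool" where
  "feller T d X P \<longleftrightarrow>
     (\<forall>t\<in>{0..T}. \<forall>\<phi> :: 's \<Rightarrow> real. continuous_on UNIV \<phi> \<and> bounded (range \<phi>) \<longrightarrow>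
        pm_continuous ({0..t} \<times> UNIV) d (\<lambda>(r, x). \<integral>\<omega>. \<phi> (X t \<omega>) \<partial>P r x))"

definition right_hand_feller ::
    "real \<Rightarrow> 's pm \<Rightarrow> (real \<Rightarrow> 'o \<Rightarrow> 's::topological_space)
     \<Rightarrow> (real \<Rightarrow> 's \<Rightarrow> 'o measure) \<Rightarrow> bool" where
  "right_hand_feller T d X P \<longleftrightarrow>
     (\<forall>t\<in>{0..T}. \<forall>\<phi> :: 's \<Rightarrow> real. continuous_on UNIV \<phi> \<and> bounded (range \<phi>) \<longrightarrow>
        pm_right_continuous {0..t} d (\<lambda>(r, x). \<integral>\<omega>. \<phi> (X t \<omega>) \<partial>P r x))"


section \<open>Regularity with respect to the time measure\<close>

definition mu_dominated ::
    "real \<Rightarrow> real measure \<Rightarrow> 's pm \<Rightarrow> (real \<times> 's \<Rightarrow> real) \<Rightarrow> bool" where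
  "mu_dominated T \<mu> d a \<longleftrightarrow>
     a \<in> borel_measurable (pm_borel ({0..T} \<times> UNIV) d) \<and>
     (\<forall>t\<in>{0..T}. \<forall>x. 0 \<le> a (t, x)) \<and>
     (\<exists>abar. abar \<in> borel_measurable (restrict_space borel {0..T}) \<and>
        (\<forall>t\<in>{0..T}. 0 \<le> abar t) \<and> integrable \<mu> abar \<and>
        (AE s in \<mu>. \<forall>y. a (s, y) \<le> abar s))"

definition locally_mu_bounded_at ::
    "real \<Rightarrow> real measure \<Rightarrow> 's pm \<Rightarrow> real set \<Rightarrow> (real \<Rightarrow> 's \<Rightarrow> real \<Rightarrow> real) \<Rightarrow> real \<Rightarrow> bool" where
  "locally_mu_bounded_at T \<mu> d D f z \<longleftrightarrow>
     (\<exists>W a. openin (top_of_set (closure D)) W \<and> z \<in> W \<and> mu_dominated T \<mu> d a \<and>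
        (\<forall>t\<in>{0..T}. \<forall>x. \<forall>w\<in>W \<inter> D. \<bar>f t x w\<bar> \<le> a (t, x)))"

definition locally_lipschitz_mu_at ::
    "real \<Rightarrow> real measure \<Rightarrow> 's pm \<Rightarrow> real set \<Rightarrow> (real \<Rightarrow> 's \<Rightarrow> real \<Rightarrow> real) \<Rightarrow> real \<Rightarrow> bool" where
  "locally_lipschitz_mu_at T \<mu> d D f z \<longleftrightarrow>
     (\<exists>W a. openin (top_of_set (closure D)) W \<and> z \<in> W \<and> mu_dominated T \<mu> d a \<and>
        (\<forall>t\<in>{0..T}. \<forall>x. \<forall>w\<in>W \<inter> D. \<forall>w'\<in>W \<inter> D.
           \<bar>f t x w - f t x w'\<bar> \<le> a (t, x) * \<bar>w - w'\<bar>))"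

definition BC_mu ::
    "real \<Rightarrow> real measure \<Rightarrow> 's pm \<Rightarrow> real set \<Rightarrow> (real \<Rightarrow> 's \<Rightarrow> real \<Rightarrow> real) set" where
  "BC_mu T \<mu> d D =
     {f. (\<lambda>((t, x), w). f t x w)
           \<in> borel_measurable (pm_borel ({0..T} \<times> UNIV) d \<Otimes>\<^sub>M restrict_space borel D) \<and>
         (\<forall>z\<in>D. locally_mu_bounded_at T \<mu> d D f z \<and> locally_lipschitz_mu_at T \<mu> d D f z)}"

definition affine_mu_bounded_below ::
    "real \<Rightarrow> real measure \<Rightarrow> 's pm \<Rightarrow> real set \<Rightarrow> (real \<Rightarrow> 's \<Rightarrow> real \<Rightarrow> real) \<Rightarrow> bool" where
  "affine_mu_bounded_below T \<mu> d D f \<longleftrightarrow>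
     (\<exists>a b. mu_dominated T \<mu> d a \<and> mu_dominated T \<mu> d b \<and>
        (\<forall>t\<in>{0..T}. \<forall>x. \<forall>w\<in>D. f t x w \<ge> - a (t, x) - b (t, x) * \<bar>w\<bar>))"

definition affine_mu_bounded_above ::
    "real \<Rightarrow> real measure \<Rightarrow> 's pm \<Rightarrow> real set \<Rightarrow> (real \<Rightarrow> 's \<Rightarrow> real \<Rightarrow> real) \<Rightarrow> bool" where
  "affine_mu_bounded_above T \<mu> d D f \<longleftrightarrow>
     affine_mu_bounded_below T \<mu> d D (\<lambda>t x w. - f t x w)"


section \<open>The Markovian integral equation\<close>

definition lower_end :: "real set \<Rightarrow> ereal" where
  "lower_end D = (INF w\<in>D. ereal w)"

definition upper_end :: "real set \<Rightarrow> ereal" where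
  "upper_end D = (SUP w\<in>D. ereal w)"

definition bounded_away :: "('s \<Rightarrow> real) \<Rightarrow> real set \<Rightarrow> bool" where
  "bounded_away g A \<longleftrightarrow> (\<exists>\<epsilon>>0. \<forall>x. \<forall>z\<in>A. \<bar>g x - z\<bar> \<ge> \<epsilon>)"

definition admissible_interval :: "real \<Rightarrow> real set \<Rightarrow> bool" where
  "admissible_interval T I \<longleftrightarrow> (\<exists>t. 0 \<le> t \<and> t < T \<and> (I = {t<..T} \<or> I = {t..T}))"

text \<open>Maps on \<open>I \<times> S\<close> are represented by total functions of which only the values on \<open>I \<times> S\<close>
  matter; equality of such maps has to be read as equality on \<open>I \<times> S\<close>.\<close>

definition solution_M ::
    "real \<Rightarrow> real measure \<Rightarrow> 's pm \<Rightarrow> 'o measure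
     \<Rightarrow> (real \<Rightarrow> 'o \<Rightarrow> 's) \<Rightarrow> (real \<Rightarrow> 's \<Rightarrow> 'o measure)
     \<Rightarrow> real set \<Rightarrow> (real \<Rightarrow> 's \<Rightarrow> real \<Rightarrow> real) \<Rightarrow> ('s \<Rightarrow> real)
     \<Rightarrow> real set \<Rightarrow> (real \<times> 's \<Rightarrow> real) \<Rightarrow> bool" where
  "solution_M T \<mu> d M X P D f g I u \<longleftrightarrow>
     admissible_interval T I \<and>
     u \<in> borel_measurable (pm_borel (I \<times> UNIV) d) \<and> u ` (I \<times> UNIV) \<subseteq> D \<and>
     pm_consistent (I \<times> UNIV) d u \<and>
     (\<forall>r\<in>I. \<forall>t\<in>I. r \<le> t \<longrightarrow> (\<forall>x.
        integrable (P r x) (\<lambda>\<omega>. \<bar>u (t, X t \<omega>)\<bar>) \<and>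
        (\<forall>\<omega>\<in>space M. set_integrable \<mu> {r..t} (\<lambda>s. \<bar>f s (X s \<omega>) (u (s, X s \<omega>))\<bar>)) \<and>
        integrable (P r x) (\<lambda>\<omega>. LINT s:{r..t}|\<mu>. \<bar>f s (X s \<omega>) (u (s, X s \<omega>))\<bar>) \<and>
        (\<integral>\<omega>. u (t, X t \<omega>) \<partial>P r x)
          = u (r, x) + (\<integral>\<omega>. (LINT s:{r..t}|\<mu>. f s (X s \<omega>) (u (s, X s \<omega>))) \<partial>P r x))) \<and>
     (\<forall>x. u (T, x) = g x)"

definition admissible_solution_M ::
    "real \<Rightarrow> real measure \<Rightarrow> 's pm \<Rightarrow> 'o measure
     \<Rightarrow> (real \<Rightarrow> 'o \<Rightarrow> 's) \<Rightarrow> (real \<Rightarrow> 's \<Rightarrow> 'o measure)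
     \<Rightarrow> real set \<Rightarrow> (real \<Rightarrow> 's \<Rightarrow> real \<Rightarrow> real) \<Rightarrow> ('s \<Rightarrow> real)
     \<Rightarrow> real set \<Rightarrow> (real \<times> 's \<Rightarrow> real) \<Rightarrow> bool" where
  "admissible_solution_M T \<mu> d M X P D f g I u \<longleftrightarrow>
     solution_M T \<mu> d M X P D f g I u \<and>
     (\<forall>r\<in>I. compact (closure (u ` ({r..T} \<times> UNIV))) \<and>
             closure (u ` ({r..T} \<times> UNIV)) \<subseteq> interior D)"

definition extendible_M ::
    "real \<Rightarrow> real measure \<Rightarrow> 's pm \<Rightarrow> 'o measure
     \<Rightarrow> (real \<Rightarrow> 'o \<Rightarrow> 's) \<Rightarrow> (real \<Rightarrow> 's \<Rightarrow> 'o measure)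
     \<Rightarrow> real set \<Rightarrow> (real \<Rightarrow> 's \<Rightarrow> real \<Rightarrow> real) \<Rightarrow> ('s \<Rightarrow> real)
     \<Rightarrow> real set \<Rightarrow> (real \<times> 's \<Rightarrow> real) \<Rightarrow> bool" where
  "extendible_M T \<mu> d M X P D f g I u \<longleftrightarrow>
     (\<exists>J v. I \<subset> J \<and> admissible_solution_M T \<mu> d M X P D f g J v \<and>
        (\<forall>p\<in>I \<times> UNIV. u p = v p))"

definition non_extendible_solution_M ::
    "real \<Rightarrow> real measure \<Rightarrow> 's pm \<Rightarrow> 'o measure
     \<Rightarrow> (real \<Rightarrow> 'o \<Rightarrow> 's) \<Rightarrow> (real \<Rightarrow> 's \<Rightarrow> 'o measure)
     \<Rightarrow> real set \<Rightarrow> (real \<Rightarrow> 's \<Rightarrow> real \<Rightarrow> real) \<Rightarrow> ('s \<Rightarrow> real)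
     \<Rightarrow> real set \<Rightarrow> (real \<times> 's \<Rightarrow> real) \<Rightarrow> bool" where
  "non_extendible_solution_M T \<mu> d M X P D f g I u \<longleftrightarrow>
     admissible_solution_M T \<mu> d M X P D f g I u \<and>
     \<not> extendible_M T \<mu> d M X P D f g I u"

definition bounded_global_solution_M ::
    "real \<Rightarrow> real measure \<Rightarrow> 's pm \<Rightarrow> 'o measure
     \<Rightarrow> (real \<Rightarrow> 'o \<Rightarrow> 's) \<Rightarrow> (real \<Rightarrow> 's \<Rightarrow> 'o measure)
     \<Rightarrow> real set \<Rightarrow> (real \<Rightarrow> 's \<Rightarrow> real \<Rightarrow> real) \<Rightarrow> ('s \<Rightarrow> real)
     \<Rightarrow> (real \<times> 's \<Rightarrow> real) \<Rightarrow> bool" where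
  "bounded_global_solution_M T \<mu> d M X P D f g u \<longleftrightarrow>
     solution_M T \<mu> d M X P D f g {0..T} u \<and> bounded (u ` ({0..T} \<times> UNIV))"

end

theory Submission
  imports Defs
begin

text \<open>
  Fix a compact range \<open>[-R, R]\<close> and let \<open>l\<close> be the sum of the finitely many dominating functions
  needed there. Replacing \<open>\<mu>\<close> by the finite measure \<open>\<nu>\<close> with density \<open>l\<close> and \<open>f\<close> by \<open>h = f / l\<close>, the
  driver becomes bounded by 1 and 1-Lipschitz. With the clock \<open>A s = \<nu> [0, s]\<close>, the equation
  \<open>u = E g - E \<integral> h(u) d\<nu>\<close> is equivalent to
  \<open>u(r, x) = E[exp (A r - A T) g(X\<^sub>T)] + E \<integral>\<^sub>r\<^sup>T exp (A r - A s) (u - h(u))(s, X\<^sub>s) \<nu>(ds)\<close>.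
  As \<open>w - h(w)\<close> is nondecreasing and 2-Lipschitz, the right-hand side is monotone in \<open>u\<close> and a
  contraction for the weight \<open>exp (4 (A T - A s))\<close>. Monotonicity turns the boundary conditions on \<open>f\<close>
  into bands invariant under the iteration: the end of \<open>D\<close> itself where it is finite, and the
  solution of a linear equation where \<open>f\<close> is affinely bounded; the factor \<open>exp (A r - A T)\<close> keeps
  the solution inside \<open>D\<close>, away from the ends when \<open>g\<close> is. The iterates converge uniformly and
  inherit continuity from the Feller property.
\<close>

section \<open>Pseudometric topologies\<close>

text \<open>The equation is pathwise, but only means are accessible, so every path integral is
  turned into a time integral of \<open>mean H s (r, x)\<close>. Fubini then asks for joint
  measurability in start and target, whereas the hypotheses give it for one target time at a time.
  It is recovered only for \<open>s > r\<close>: a rational time between the two splits the problem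
  into a kernel for the law of the future, built from finite-dimensional distributions, and a path
  that is progressive for the backward filtration. Since \<open>\<nu>\<close> charges no point, the
  diagonal is lost without harm. Continuity of time for \<open>d\<close> makes time strips Borel and
  makes the discount factor, a function of time, consistent. The second obstacle is circular:
  \<open>R\<close> must bound the solution before \<open>l\<close> is chosen on
  \<open>[-R, R]\<close>, yet the clock of \<open>\<nu>\<close> depends on \<open>l\<close>. Hence
  growth is measured with the clock of a separate density \<open>\<kappa>\<close>, taken from the
  affine bounds alone and dominated by \<open>l\<close>.\<close>

lemma topspace_pm_topology [simp]: "topspace (pm_topology A d) = A"
proof -
  have "openin (pm_topology A d) A"
    unfolding openin_pm_topology by (auto intro: exI[of _ 1])
  then show ?thesis
    by (meson openin_pm_topology openin_subset openin_topspace subset_antisym)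
qed

lemma pseudometric_onD:
  assumes "pseudometric_on A d" "p \<in> A" "q \<in> A"
  shows "0 \<le> d p q" "d p q = d q p" "d p p = 0"
    and "z \<in> A \<Longrightarrow> d p z \<le> d p q + d q z"
  using assms unfolding pseudometric_on_def by auto

lemma pseudometric_on_subset:
  "pseudometric_on A d \<Longrightarrow> B \<subseteq> A \<Longrightarrow> pseudometric_on B d"
  unfolding pseudometric_on_def by (meson subsetD)

lemma pm_topology_ball:
  assumes pm: "pseudometric_on A d" and p: "p \<in> A"
  shows "openin (pm_topology A d) {q \<in> A. d p q < r}"
  unfolding openin_pm_topology
proof (intro conjI ballI)
  fix q assume q: "q \<in> {q \<in> A. d p q < r}"
  have "{z \<in> A. d q z < r - d p q} \<subseteq> {q \<in> A. d p q < r}"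
    using pseudometric_onD(4)[OF pm p] q by fastforce
  then show "\<exists>e>0. {z \<in> A. d q z < e} \<subseteq> {q \<in> A. d p q < r}"
    using q by (intro exI[of _ "r - d p q"]) auto
qed auto

text \<open>The trace of a ball of \<open>A\<close> is a ball of \<open>B\<close>, so the largest
  open set of \<open>A\<close> whose trace lies in \<open>U\<close> already covers
  \<open>U\<close>.\<close>

lemma openin_pm_topology_subset:
  assumes pm: "pseudometric_on A d" and B: "B \<subseteq> A"
  shows "openin (pm_topology B d) U \<longleftrightarrow> (\<exists>V. openin (pm_topology A d) V \<and> U = V \<inter> B)"
proof safe
  assume U: "openin (pm_topology B d) U"
  define V where "V = \<Union>{W. openin (pm_topology A d) W \<and> W \<inter> B \<subseteq> U}"
  have "openin (pm_topology A d) V"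
    unfolding V_def by blast
  moreover have "U \<subseteq> V \<inter> B"
  proof
    fix p assume p: "p \<in> U"
    with U obtain r where r: "r > 0" "{q\<in>B. d p q < r} \<subseteq> U" and pB: "p \<in> B"
      unfolding openin_pm_topology by blast
    have "openin (pm_topology A d) {q \<in> A. d p q < r}"
      using pm_topology_ball[OF pm] pB B by auto
    moreover have "{q \<in> A. d p q < r} \<inter> B \<subseteq> U" using r by auto
    moreover have "p \<in> {q \<in> A. d p q < r}"
      using r pB B pseudometric_onD(3)[OF pm] by auto
    ultimately show "p \<in> V \<inter> B" unfolding V_def using pB by blast
  qed
  moreover have "V \<inter> B \<subseteq> U" unfolding V_def by blast
  ultimately show "\<exists>V. openin (pm_topology A d) V \<and> U = V \<inter> B" by blast
next
  fix V assume "openin (pm_topology A d) V"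
  then have V: "\<exists>r>0. {q\<in>A. d p q < r} \<subseteq> V" if "p \<in> V" for p
    using that unfolding openin_pm_topology by blast
  have "\<exists>r>0. {q\<in>B. d p q < r} \<subseteq> V \<inter> B" if "p \<in> V" for p
    using V[OF that] B by blast
  then show "openin (pm_topology B d) (V \<inter> B)"
    unfolding openin_pm_topology by blast
qed

section \<open>Borel sigma-algebras of a pseudometric and of its restrictions\<close>

lemma space_pm_borel [simp]: "space (pm_borel A d) = A"
  unfolding pm_borel_def
  by (rule space_measure_of) (auto simp: openin_pm_topology)

lemma sets_pm_borel: "sets (pm_borel A d) = sigma_sets A {U. openin (pm_topology A d) U}"
  unfolding pm_borel_def
  by (rule sets_measure_of) (auto simp: openin_pm_topology)

lemma measurable_pm_borelI:
  assumes "f \<in> space N \<rightarrow> A"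
    and "\<And>U. openin (pm_topology A d) U \<Longrightarrow> f -` U \<inter> space N \<in> sets N"
  shows "f \<in> N \<rightarrow>\<^sub>M pm_borel A d"
proof -
  have "{U. openin (pm_topology A d) U} \<subseteq> Pow A" by (auto simp: openin_pm_topology)
  then show ?thesis
    unfolding pm_borel_def using assms by (intro measurable_measure_of) auto
qed

lemma pm_borel_inclusion_measurable:
  assumes pm: "pseudometric_on A d" and B: "B \<subseteq> A"
  shows "(\<lambda>p. p) \<in> pm_borel B d \<rightarrow>\<^sub>M pm_borel A d"
proof (rule measurable_pm_borelI)
  fix U assume "openin (pm_topology A d) U"
  then have "openin (pm_topology B d) (U \<inter> B)"
    using openin_pm_topology_subset[OF pm B] by blast
  then show "(\<lambda>p. p) -` U \<inter> space (pm_borel B d) \<in> sets (pm_borel B d)"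
    by (auto simp: sets_pm_borel)
qed (use B in auto)

text \<open>Local solutions are measurable for the Borel sets of their own time strip, kernels and
  means for those of a larger one. For a Borel subset both are traces of the same sigma-algebra, so
  maps can be restricted and glued.\<close>

lemma sets_pm_borel_subset:
  assumes pm: "pseudometric_on A d" and B: "B \<subseteq> A" "B \<in> sets (pm_borel A d)"
  shows "sets (pm_borel B d) = sets (restrict_space (pm_borel A d) B)"
proof -
  have eq: "{U. openin (pm_topology B d) U} = (\<inter>) B ` {U. openin (pm_topology A d) U}"
    using openin_pm_topology_subset[OF pm B(1)] by (auto simp: Int_commute)
  have "(\<inter>) B ` sigma_sets A {U. openin (pm_topology A d) U}
      = sigma_sets B ((\<inter>) B ` {U. openin (pm_topology A d) U})"
    using B by (intro sigma_sets_Int) (auto simp: sets_pm_borel)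
  then show ?thesis
    unfolding sets_restrict_space sets_pm_borel eq by simp
qed

section \<open>Continuity for a pseudometric\<close>

lemma pm_continuous_iff:
  assumes pm: "pseudometric_on A d"
  shows "pm_continuous A d u \<longleftrightarrow>
    (\<forall>p\<in>A. \<forall>\<epsilon>>0. \<exists>\<delta>>0. \<forall>q\<in>A. d q p < \<delta> \<longrightarrow> \<bar>u q - u p\<bar> < \<epsilon>)"
proof
  assume c: "pm_continuous A d u"
  show "\<forall>p\<in>A. \<forall>\<epsilon>>0. \<exists>\<delta>>0. \<forall>q\<in>A. d q p < \<delta> \<longrightarrow> \<bar>u q - u p\<bar> < \<epsilon>"
  proof safe
    fix p e assume p: "p \<in> A" "e > (0::real)"
    have "openin (pm_topology A d) {q \<in> A. u q \<in> ball (u p) e}"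
      using c unfolding pm_continuous_def continuous_map_def by auto
    moreover have "p \<in> {q \<in> A. u q \<in> ball (u p) e}" using p by simp
    ultimately obtain r where r: "r > 0" "{q\<in>A. d p q < r} \<subseteq> {q \<in> A. u q \<in> ball (u p) e}"
      unfolding openin_pm_topology by blast
    have "\<bar>u q - u p\<bar> < e" if q: "q \<in> A" "d q p < r" for q
    proof -
      have "d p q < r" using q pseudometric_onD(2)[OF pm p(1) q(1)] by simp
      then have "q \<in> {q \<in> A. u q \<in> ball (u p) e}" using q r(2) by blast
      then show ?thesis by (simp add: dist_real_def abs_minus_commute)
    qed
    then show "\<exists>\<delta>>0. \<forall>q\<in>A. d q p < \<delta> \<longrightarrow> \<bar>u q - u p\<bar> < e"
      using r(1) by blast
  qed
next
  assume e: "\<forall>p\<in>A. \<forall>\<epsilon>>0. \<exists>\<delta>>0. \<forall>q\<in>A. d q p < \<delta> \<longrightarrow> \<bar>u q - u p\<bar> < \<epsilon>"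
  show "pm_continuous A d u"
    unfolding pm_continuous_def continuous_map_def openin_pm_topology
  proof (intro conjI allI impI ballI)
    fix U p assume U: "openin euclidean U" and p: "p \<in> {x \<in> topspace (pm_topology A d). u x \<in> U}"
    then have "open U" "u p \<in> U" by auto
    then obtain \<epsilon> where \<epsilon>: "\<epsilon> > 0" "ball (u p) \<epsilon> \<subseteq> U"
      by (rule openE)
    obtain \<delta> where \<delta>: "\<delta> > 0" "\<forall>q\<in>A. d q p < \<delta> \<longrightarrow> \<bar>u q - u p\<bar> < \<epsilon>"
      using e p \<epsilon>(1) by (metis (no_types, lifting) mem_Collect_eq topspace_pm_topology)
    have "u q \<in> U" if "q \<in> A" "d p q < \<delta>" for q
    proof -
      have "d q p < \<delta>" using that p pseudometric_onD(2)[OF pm, of p q] by auto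
      then have "u q \<in> ball (u p) \<epsilon>" using \<delta> that by (auto simp: dist_real_def abs_minus_commute)
      with \<epsilon> show ?thesis by auto
    qed
    with \<delta> show "\<exists>r>0. {q \<in> A. d p q < r} \<subseteq> {x \<in> topspace (pm_topology A d). u x \<in> U}"
      by (intro exI[of _ \<delta>]) auto
  qed auto
qed

lemma pm_continuous_measurable:
  assumes "pm_continuous A d u"
  shows "u \<in> borel_measurable (pm_borel A d)"
proof (rule borel_measurableI)
  fix U :: "real set" assume "open U"
  then have "openin (pm_topology A d) {q \<in> A. u q \<in> U}"
    using assms unfolding pm_continuous_def continuous_map_def by auto
  moreover have "{q \<in> A. u q \<in> U} = u -` U \<inter> space (pm_borel A d)" by auto
  ultimately show "u -` U \<inter> space (pm_borel A d) \<in> sets (pm_borel A d)"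
    unfolding sets_pm_borel by (metis mem_Collect_eq sigma_sets.Basic)
qed

section \<open>Time-space with a continuous time coordinate\<close>

locale markov_time_space =
  fixes T :: real and d :: "('s::{metric_space, second_countable_topology}) pm"
    and M :: "'o measure" and F :: "real \<Rightarrow> 'o measure"
    and X :: "real \<Rightarrow> 'o \<Rightarrow> 's" and P :: "real \<Rightarrow> 's \<Rightarrow> 'o measure"
  assumes T_pos: "T > 0"
    and pseudometric: "time_space_pseudometric T d"
    and time_continuous: "pm_continuous ({0..T} \<times> UNIV) d fst"
    and markov: "consistent_progressive_markov T d M F X P"
begin

abbreviation TS :: "(real \<times> 's) set" where "TS \<equiv> {0..T} \<times> UNIV"
abbreviation BT :: "real measure" where "BT \<equiv> restrict_space borel {0..T}"
abbreviation BTS :: "(real \<times> 's) measure" where "BTS \<equiv> pm_borel TS d"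

lemma pm: "pseudometric_on TS d"
  using pseudometric by (simp add: time_space_pseudometric_def)

text \<open>A point at distance zero from \<open>q\<close> lies in every ball about
  \<open>q\<close>, so continuity of time at \<open>q\<close>, with the time difference as
  tolerance, rules out different times. Consistency of \<open>lin\<close> rests on this, because its
  discount factor and its domain of integration depend on the time.\<close>

lemma d_zero_time: assumes "p \<in> TS" "q \<in> TS" "d p q = 0" shows "fst p = fst q"
proof (rule ccontr)
  assume ne: "fst p \<noteq> fst q"
  then obtain \<delta> where "\<delta> > 0" "\<forall>z\<in>TS. d z q < \<delta> \<longrightarrow> \<bar>fst z - fst q\<bar> < \<bar>fst p - fst q\<bar>"
    using time_continuous[unfolded pm_continuous_iff[OF pm], rule_format, OF assms(2), of "\<bar>fst p - fst q\<bar>"]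
    by auto
  moreover have "d p q < \<delta>" using \<open>\<delta> > 0\<close> assms(3) by simp
  ultimately have "\<bar>fst p - fst q\<bar> < \<bar>fst p - fst q\<bar>" using assms(1) by blast
  then show False by simp
qed

lemma space_BT [simp]: "space BT = {0..T}"
  by (simp add: space_restrict_space)

lemma fst_measurable [measurable]: "fst \<in> BTS \<rightarrow>\<^sub>M BT"
  using pm_continuous_measurable[OF time_continuous]
  by (intro measurable_restrict_space2) auto

lemma slab_measurable: "J \<in> sets borel \<Longrightarrow> J \<subseteq> {0..T} \<Longrightarrow> J \<times> UNIV \<in> sets BTS"
proof -
  assume J: "J \<in> sets borel" "J \<subseteq> {0..T}"
  then have "fst -` J \<inter> space BTS \<in> sets BTS"
    by (intro measurable_sets[OF pm_continuous_measurable[OF time_continuous]]) auto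
  moreover have "fst -` J \<inter> space BTS = J \<times> UNIV" using J by auto
  ultimately show ?thesis by simp
qed

lemma sets_pm_borel_slab:
  "J \<in> sets borel \<Longrightarrow> J \<subseteq> {0..T} \<Longrightarrow> sets (pm_borel (J \<times> UNIV) d) = sets (restrict_space BTS (J \<times> UNIV))"
  using sets_pm_borel_subset[OF pm _ slab_measurable] by auto

text \<open>The topology of \<open>d\<close> is coarser than the product topology, so its open sets
  are Borel for the product. Maps into time-space need therefore only be measurable in each
  coordinate.\<close>

lemma id_measurable_BTS: "(\<lambda>p. p) \<in> restrict_space borel TS \<rightarrow>\<^sub>M BTS"
proof -
  have "(\<lambda>p. p) -` U \<inter> space (restrict_space borel TS) \<in> sets (restrict_space borel TS)"
    if U: "openin (pm_topology TS d) U" for U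
  proof -
    have "openin (top_of_set TS) U"
      using pseudometric U by (simp add: time_space_pseudometric_def)
    then obtain V where "open V" "U = TS \<inter> V" by (auto simp: openin_open)
    then have "(\<lambda>p. p) -` U \<inter> space (restrict_space borel TS) = TS \<inter> V" "V \<in> sets borel"
      by (auto simp: space_restrict_space)
    then show ?thesis
      by (simp add: sets_restrict_space)
  qed
  then show ?thesis
    by (intro measurable_pm_borelI) (auto simp: space_restrict_space)
qed

lemma pair_measurable_BTS:
  assumes [measurable]: "\<tau> \<in> N \<rightarrow>\<^sub>M borel" "\<xi> \<in> N \<rightarrow>\<^sub>M borel"
    and "\<And>z. z \<in> space N \<Longrightarrow> \<tau> z \<in> {0..T}"
  shows "(\<lambda>z. (\<tau> z, \<xi> z)) \<in> N \<rightarrow>\<^sub>M BTS"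
proof -
  have "(\<lambda>z. (\<tau> z, \<xi> z)) \<in> N \<rightarrow>\<^sub>M borel"
    \<comment> \<open>Second countability of the state space identifies the Borel sets of the
      product with the product sigma-algebra.\<close>
    unfolding borel_prod[symmetric] by measurable
  then have "(\<lambda>z. (\<tau> z, \<xi> z)) \<in> N \<rightarrow>\<^sub>M restrict_space borel TS"
    using assms(3) by (intro measurable_restrict_space2) auto
  then show ?thesis
    using measurable_comp[OF _ id_measurable_BTS] by (simp add: comp_def)
qed

end

section \<open>Transition laws and the law of the future\<close>

context markov_time_space begin

lemma filtration_subalgebra: "t \<in> {0..T} \<Longrightarrow> subalgebra M (F t)"
  and filtration_mono: "s \<in> {0..T} \<Longrightarrow> t \<in> {0..T} \<Longrightarrow> s \<le> t \<Longrightarrow> sets (F s) \<subseteq> sets (F t)"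
  and X_adapted: "t \<in> {0..T} \<Longrightarrow> X t \<in> F t \<rightarrow>\<^sub>M borel"
  and P_prob: "r \<in> {0..T} \<Longrightarrow> prob_space (P r x)"
  and sets_P: "r \<in> {0..T} \<Longrightarrow> sets (P r x) = sets M"
  using markov unfolding consistent_progressive_markov_def by blast+

lemma space_P: "r \<in> {0..T} \<Longrightarrow> space (P r x) = space M"
  by (rule sets_eq_imp_space_eq) (rule sets_P)

lemma P_start: "s \<in> {0..T} \<Longrightarrow> AE \<omega> in P s y. d (s, X s \<omega>) (s, y) = 0"
proof -
  assume s: "s \<in> {0..T}"
  then have "AE \<omega> in P s y. \<forall>r\<in>{0..s}. d (r, X r \<omega>) (r, y) = 0"
    using markov unfolding consistent_progressive_markov_def by blast
  then show ?thesis by eventually_elim (use s in auto)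
qed

lemma transition_consistent:
  "t \<in> {0..T} \<Longrightarrow> B \<in> sets borel \<Longrightarrow>
    pm_consistent ({0..t} \<times> UNIV) d (\<lambda>(s, x). measure (P s x) (X t -` B \<inter> space M))"
  and transition_measurable:
  "t \<in> {0..T} \<Longrightarrow> B \<in> sets borel \<Longrightarrow>
    (\<lambda>(s, x). measure (P s x) (X t -` B \<inter> space M)) \<in> borel_measurable (pm_borel ({0..t} \<times> UNIV) d)"
  using markov unfolding consistent_progressive_markov_def by blast+

lemma markov_property:
  "r \<in> {0..T} \<Longrightarrow> s \<in> {r..T} \<Longrightarrow> t \<in> {s..T} \<Longrightarrow> B \<in> sets borel \<Longrightarrow>
   AE \<omega> in P r x. real_cond_exp (P r x) (F s) (indicator (X t -` B \<inter> space M)) \<omega>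
     = measure (P s (X s \<omega>)) (X t -` B \<inter> space M)"
  using markov unfolding consistent_progressive_markov_def by blast

lemma X_backward_progressive:
  "t \<in> {0..T} \<Longrightarrow> (\<lambda>(s, \<omega>). X s \<omega>)
     \<in> restrict_space borel {t..T} \<Otimes>\<^sub>M generated_sigma M X {t..T} \<rightarrow>\<^sub>M borel"
  using markov unfolding consistent_progressive_markov_def by blast

lemma X_measurable: "t \<in> {0..T} \<Longrightarrow> X t \<in> M \<rightarrow>\<^sub>M borel"
  using measurable_from_subalg[OF filtration_subalgebra X_adapted] by blast

lemma X_measurable_P: "t \<in> {0..T} \<Longrightarrow> r \<in> {0..T} \<Longrightarrow> X t \<in> P r x \<rightarrow>\<^sub>M borel"
  using X_measurable measurable_cong_sets[OF sets_P refl] by blast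

section \<open>Transition laws as kernels\<close>

abbreviation (input) "slab t \<equiv> pm_borel ({0..t} \<times> UNIV) d"

lemma pm_slab: "t \<in> {0..T} \<Longrightarrow> pseudometric_on ({0..t} \<times> UNIV) d"
  by (rule pseudometric_on_subset[OF pm]) auto

lemma slab_inclusion: "s \<le> t \<Longrightarrow> t \<in> {0..T} \<Longrightarrow> (\<lambda>p. p) \<in> slab s \<rightarrow>\<^sub>M slab t"
  by (rule pm_borel_inclusion_measurable[OF pm_slab]) auto

lemma pair_measurable_slab:
  assumes [measurable]: "\<xi> \<in> N \<rightarrow>\<^sub>M borel" and s: "0 \<le> s" "s \<le> t" "t \<in> {0..T}"
  shows "(\<lambda>z. (s, \<xi> z)) \<in> N \<rightarrow>\<^sub>M slab t"
proof -
  have "(\<lambda>z. (s, \<xi> z)) \<in> N \<rightarrow>\<^sub>M BTS"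
    using s by (intro pair_measurable_BTS) auto
  then have "(\<lambda>z. (s, \<xi> z)) \<in> N \<rightarrow>\<^sub>M restrict_space BTS ({0..t} \<times> UNIV)"
    using s by (intro measurable_restrict_space2) auto
  then show ?thesis
    using sets_pm_borel_slab[of "{0..t}"] s measurable_cong_sets[OF refl, of "slab t"] by auto
qed

definition transition_law :: "real \<Rightarrow> real \<times> 's \<Rightarrow> 's measure" where
  "transition_law t p = distr (P (fst p) (snd p)) borel (X t)"

lemma emeasure_transition_law:
  assumes "t \<in> {0..T}" "r \<in> {0..T}" "B \<in> sets borel"
  shows "emeasure (transition_law t (r, x)) B = ennreal (measure (P r x) (X t -` B \<inter> space M))"
proof -
  interpret prob_space "P r x" by (rule P_prob) fact
  show ?thesis
    using assms by (simp add: transition_law_def emeasure_distr X_measurable_P space_P emeasure_eq_measure)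
qed

lemma transition_law_measurable:
  assumes t: "t \<in> {0..T}"
  shows "transition_law t \<in> slab t \<rightarrow>\<^sub>M subprob_algebra borel"
proof (rule measurable_subprob_algebra)
  fix p :: "real \<times> 's" assume "p \<in> space (slab t)"
  then have "fst p \<in> {0..T}" using t by auto
  then show "subprob_space (transition_law t p)"
    unfolding transition_law_def using t
    by (intro prob_space_imp_subprob_space prob_space.prob_space_distr P_prob X_measurable_P) auto
  show "sets (transition_law t p) = sets borel" by (simp add: transition_law_def)
next
  fix B :: "'s set" assume B: "B \<in> sets borel"
  have "(\<lambda>p. ennreal (case p of (s, x) \<Rightarrow> measure (P s x) (X t -` B \<inter> space M))) \<in> borel_measurable (slab t)"
    using transition_measurable[OF t B] by measurable
  then show "(\<lambda>p. emeasure (transition_law t p) B) \<in> borel_measurable (slab t)"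
    by (rule measurable_cong[THEN iffD1, rotated]) (use t B in \<open>auto simp: emeasure_transition_law\<close>)
qed

lemma transition_law_consistent:
  assumes t: "t \<in> {0..T}" and p: "p \<in> {0..t} \<times> UNIV" and q: "q \<in> {0..t} \<times> UNIV" and "d p q = 0"
  shows "transition_law t p = transition_law t q"
proof (rule measure_eqI)
  fix B assume "B \<in> sets (transition_law t p)"
  then have B: "B \<in> sets borel" by (simp add: transition_law_def)
  obtain r x r' x' where eq: "p = (r, x)" "q = (r', x')" by (cases p, cases q) auto
  show "emeasure (transition_law t p) B = emeasure (transition_law t q) B"
    using transition_consistent[OF t B] assms B unfolding eq pm_consistent_def
    by (subst (1 2) emeasure_transition_law) fastforce+
qed (simp add: transition_law_def)

lemma nn_integral_transition_law:
  assumes "t \<in> {0..T}" "r \<in> {0..T}" "\<phi> \<in> borel_measurable borel"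
  shows "(\<integral>\<^sup>+y. \<phi> y \<partial>transition_law t (r, x)) = (\<integral>\<^sup>+\<omega>. \<phi> (X t \<omega>) \<partial>P r x)"
  using assms by (simp add: transition_law_def nn_integral_distr X_measurable_P)

text \<open>The Markov property is given for indicators of events at a fixed time. Weighting
  \<open>P r x\<close> with the indicator of \<open>C\<close> yields two measures on the state
  space, the law of \<open>X t\<close> and the mixture of the transition laws started from
  \<open>X s\<close>. They agree on Borel sets by the conditional expectation, hence as measures,
  and nonnegative integrands come for free.\<close>

lemma markov_nn_integral:
  assumes r: "r \<in> {0..T}" and s: "s \<in> {r..T}" and t: "t \<in> {s..T}" and C: "C \<in> sets (F s)"
    and \<phi>: "\<phi> \<in> borel_measurable borel"
  shows "(\<integral>\<^sup>+\<omega>. indicator C \<omega> * \<phi> (X t \<omega>) \<partial>P r x)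
       = (\<integral>\<^sup>+\<omega>. indicator C \<omega> * (\<integral>\<^sup>+\<omega>'. \<phi> (X t \<omega>') \<partial>P s (X s \<omega>)) \<partial>P r x)"
proof -
  interpret prob_space "P r x" by (rule P_prob) fact
  have sT: "s \<in> {0..T}" and tT: "t \<in> {0..T}" using r s t by auto
  note [measurable] = X_measurable_P[OF sT r] X_measurable_P[OF tT r] \<phi>
  have sub: "subalgebra (P r x) (F s)"
    using filtration_subalgebra[OF sT] sets_P[OF r] space_P[OF r] by (simp add: subalgebra_def)
  interpret sub: finite_measure_subalgebra "P r x" "F s" by unfold_locales (rule sub)
  have C' [measurable]: "C \<in> sets (P r x)" using C sub by (auto simp: subalgebra_def)
  define Q where "Q = density (P r x) (indicator C)"
  have sQ [measurable_cong]: "sets Q = sets (P r x)" by (simp add: Q_def)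
  have ne: "space Q \<noteq> {}" using not_empty by (simp add: Q_def)
  have K [measurable]: "(\<lambda>\<omega>. transition_law t (s, X s \<omega>)) \<in> Q \<rightarrow>\<^sub>M subprob_algebra borel"
    using t sT tT by (intro measurable_compose[OF pair_measurable_slab transition_law_measurable]) auto
  have "distr Q borel (X t) = Q \<bind> (\<lambda>\<omega>. transition_law t (s, X s \<omega>))"
  proof (rule measure_eqI)
    show "sets (distr Q borel (X t)) = sets (Q \<bind> (\<lambda>\<omega>. transition_law t (s, X s \<omega>)))"
      using sets_bind_measurable[OF K ne] by simp
    fix B :: "'s set" assume "B \<in> sets (distr Q borel (X t))"
    then have B [measurable]: "B \<in> sets borel" by simp
    let ?A = "X t -` B \<inter> space M" and ?g = "\<lambda>\<omega>. measure (P s (X s \<omega>)) (X t -` B \<inter> space M)"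
    have A [measurable]: "?A \<in> sets (P r x)"
      using measurable_sets[OF X_measurable[OF tT] B] sets_P[OF r] by auto
    have g_meas [measurable]: "?g \<in> borel_measurable (P r x)"
      using measurable_compose[OF pair_measurable_slab[of "X s" "P r x" s t] transition_measurable[OF tT B]] t sT tT
      by (simp)
    have g_bd: "?g \<omega> \<le> 1" for \<omega>
      using prob_space.prob_le_1[OF P_prob[OF sT]] by auto
    have "emeasure (distr Q borel (X t)) B = (\<integral>\<^sup>+\<omega>. indicator C \<omega> * indicator ?A \<omega> \<partial>P r x)"
      using space_P[OF r] A unfolding Q_def
      by (subst emeasure_distr) (auto simp: emeasure_density intro!: nn_integral_cong)
    also have "\<dots> = ennreal (\<integral>\<omega>\<in>C. indicator ?A \<omega> \<partial>P r x)"
    proof -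
      have "integrable (P r x) (\<lambda>\<omega>. indicator C \<omega> *\<^sub>R (indicator ?A \<omega> :: real))"
        by (intro integrable_const_bound[where B=1]) (auto split: split_indicator)
      then show ?thesis
        unfolding set_lebesgue_integral_def
        by (subst nn_integral_eq_integral[symmetric]) (auto intro!: nn_integral_cong split: split_indicator)
    qed
    also have "(\<integral>\<omega>\<in>C. indicator ?A \<omega> \<partial>P r x) = (\<integral>\<omega>\<in>C. real_cond_exp (P r x) (F s) (indicator ?A) \<omega> \<partial>P r x)"
      using C by (intro sub.real_cond_exp_intA) (auto intro!: integrable_const_bound[where B=1])
    also have "\<dots> = (\<integral>\<omega>\<in>C. ?g \<omega> \<partial>P r x)"
      unfolding set_lebesgue_integral_def
      by (intro integral_cong_AE) (use markov_property[OF r s t B, of x] in auto)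
    also have "ennreal \<dots> = (\<integral>\<^sup>+\<omega>. indicator C \<omega> * ennreal (?g \<omega>) \<partial>P r x)"
      unfolding set_lebesgue_integral_def
      by (subst nn_integral_eq_integral[symmetric])
         (auto intro!: nn_integral_cong integrable_const_bound[where B=1] simp: indicator_def g_bd)
    also have "\<dots> = (\<integral>\<^sup>+\<omega>. indicator C \<omega> * emeasure (transition_law t (s, X s \<omega>)) B \<partial>P r x)"
      by (simp add: emeasure_transition_law[OF tT sT B])
    also have "\<dots> = (\<integral>\<^sup>+\<omega>. emeasure (transition_law t (s, X s \<omega>)) B \<partial>Q)"
      unfolding Q_def
      by (subst nn_integral_density) (use measurable_emeasure_kernel[OF K B] in \<open>auto simp: sQ Q_def\<close>)
    also have "\<dots> = emeasure (Q \<bind> (\<lambda>\<omega>. transition_law t (s, X s \<omega>))) B"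
      by (rule emeasure_bind[symmetric, OF ne K B])
    finally show "emeasure (distr Q borel (X t)) B = emeasure (Q \<bind> (\<lambda>\<omega>. transition_law t (s, X s \<omega>))) B" .
  qed
  then have "(\<integral>\<^sup>+y. \<phi> y \<partial>distr Q borel (X t)) = (\<integral>\<^sup>+\<omega>. \<integral>\<^sup>+y. \<phi> y \<partial>transition_law t (s, X s \<omega>) \<partial>Q)"
    by (simp add: nn_integral_bind[OF \<phi> K])
  also have "\<dots> = (\<integral>\<^sup>+\<omega>. indicator C \<omega> * (\<integral>\<^sup>+y. \<phi> y \<partial>transition_law t (s, X s \<omega>)) \<partial>P r x)"
    using measurable_compose[OF K nn_integral_measurable_subprob_algebra[OF \<phi>]] unfolding Q_def
    by (subst nn_integral_density) auto
  finally show ?thesis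
    using \<phi> unfolding Q_def
    by (simp add: nn_integral_distr nn_integral_density nn_integral_transition_law[OF tT sT \<phi>])
qed

section \<open>Cylinder sets and finite-dimensional distributions\<close>

definition cylinder :: "(real \<times> 's set) list \<Rightarrow> 'o set" where
  "cylinder l = {\<omega>\<in>space M. \<forall>(t, B)\<in>set l. X t \<omega> \<in> B}"

text \<open>Iterated integration against transition laws, the expected form of the
  finite-dimensional distributions; \<open>emeasure_cylinder\<close> confirms that it is the
  probability of the cylinder.\<close>

primrec cylinder_prob :: "(real \<times> 's set) list \<Rightarrow> real \<times> 's \<Rightarrow> ennreal" where
  "cylinder_prob [] p = 1"
| "cylinder_prob (c # l) p =
    (\<integral>\<^sup>+y. indicator (snd c) y * cylinder_prob l (fst c, y) \<partial>transition_law (fst c) p)"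

text \<open>Repeated times are allowed, so that two chains can be concatenated and sorted into a
  chain again, as \<open>Int_stable_cylinders\<close> requires.\<close>

definition chain_from :: "real \<Rightarrow> (real \<times> 's set) list \<Rightarrow> bool" where
  "chain_from s l \<longleftrightarrow> sorted (map fst l) \<and> (\<forall>(t, B)\<in>set l. t \<in> {s..T} \<and> B \<in> sets borel)"

lemma chain_from_Cons:
  "chain_from s ((t, B) # l) \<longleftrightarrow> t \<in> {s..T} \<and> B \<in> sets borel \<and> chain_from t l"
  by (fastforce simp: chain_from_def)

lemma cylinder_prob_measurable:
  assumes "chain_from s l" "s \<in> {0..T}"
  shows "cylinder_prob l \<in> borel_measurable (slab s)"
  using assms
proof (induction l arbitrary: s)
  case (Cons c l)
  obtain t B where c: "c = (t, B)" by (cases c)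
  have t: "t \<in> {s..T}" and [measurable]: "B \<in> sets borel" and l: "chain_from t l"
    using Cons.prems c chain_from_Cons by auto
  have tT: "t \<in> {0..T}" using t Cons.prems by auto
  have [measurable]: "cylinder_prob l \<in> borel_measurable (slab t)"
    by (rule Cons.IH[OF l tT])
  have [measurable]: "(\<lambda>y. cylinder_prob l (t, y)) \<in> borel_measurable borel"
    using tT by (intro measurable_compose[OF pair_measurable_slab[of "\<lambda>y. y" borel t t] Cons.IH[OF l tT]]) auto
  have "(\<lambda>p. \<integral>\<^sup>+y. indicator B y * cylinder_prob l (t, y) \<partial>transition_law t p) \<in> borel_measurable (slab t)"
    by (rule measurable_compose[OF transition_law_measurable[OF tT] nn_integral_measurable_subprob_algebra]) measurable
  then show ?case
    using measurable_compose[OF slab_inclusion[of s t]] t tT by (simp add: c)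
qed (subst measurable_cong[of _ _ "\<lambda>_. 1"], auto)

lemma cylinder_prob_measurable_state:
  assumes "chain_from s l" "s \<in> {0..T}"
  shows "(\<lambda>y. cylinder_prob l (s, y)) \<in> borel_measurable borel"
  using assms
  by (intro measurable_compose[OF pair_measurable_slab[of "\<lambda>y. y" borel s s] cylinder_prob_measurable]) auto

lemma cylinder_prob_consistent:
  assumes "chain_from s l" "s \<in> {0..T}" "p \<in> {0..s} \<times> UNIV" "q \<in> {0..s} \<times> UNIV" "d p q = 0"
  shows "cylinder_prob l p = cylinder_prob l q"
proof (cases l)
  case (Cons c l')
  obtain t B where c: "c = (t, B)" by (cases c)
  have "t \<in> {s..T}" using assms(1) unfolding Cons c chain_from_Cons by auto
  then have "transition_law t p = transition_law t q"
    using assms by (intro transition_law_consistent) auto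
  then show ?thesis by (simp add: Cons c)
qed simp

lemma markov_cylinder:
  assumes "r \<in> {0..T}" "s \<in> {r..T}" "chain_from s l" "C \<in> sets (F s)"
  shows "(\<integral>\<^sup>+\<omega>. indicator C \<omega> * indicator (cylinder l) \<omega> \<partial>P r x)
       = (\<integral>\<^sup>+\<omega>. indicator C \<omega> * cylinder_prob l (s, X s \<omega>) \<partial>P r x)"
  using assms
proof (induction l arbitrary: s C)
  case Nil
  then show ?case
    by (auto intro!: nn_integral_cong simp: cylinder_def space_P)
next
  case (Cons c l)
  obtain t B where c: "c = (t, B)" by (cases c)
  have t: "t \<in> {s..T}" and B [measurable]: "B \<in> sets borel" and l: "chain_from t l"
    using Cons.prems c chain_from_Cons by auto
  have r: "r \<in> {0..T}" and s: "s \<in> {r..T}" using Cons.prems by auto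
  have tT: "t \<in> {0..T}" and sT: "s \<in> {0..T}" using t r s by auto
  \<comment> \<open>The first constraint is an event known at time \<open>t\<close>. Moving it into
    the conditioning event leaves a shorter cylinder that starts at \<open>t\<close>, which is why
    the induction runs over all \<open>s\<close> and \<open>C\<close>.\<close>
  define C' where "C' = C \<inter> (X t -` B \<inter> space M)"
  have "C \<in> sets (F t)" using filtration_mono[OF sT tT] t Cons.prems(4) by auto
  moreover have "X t -` B \<inter> space M \<in> sets (F t)"
    using measurable_sets[OF X_adapted[OF tT] B] filtration_subalgebra[OF tT] by (simp add: subalgebra_def)
  ultimately have C': "C' \<in> sets (F t)" by (auto simp: C'_def)
  let ?\<phi> = "\<lambda>y. indicator B y * cylinder_prob l (t, y)"
  have [measurable]: "(\<lambda>y. cylinder_prob l (t, y)) \<in> borel_measurable borel"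
    by (rule cylinder_prob_measurable_state[OF l tT])
  have "(\<integral>\<^sup>+\<omega>. indicator C \<omega> * indicator (cylinder (c # l)) \<omega> \<partial>P r x)
      = (\<integral>\<^sup>+\<omega>. indicator C' \<omega> * indicator (cylinder l) \<omega> \<partial>P r x)"
    by (intro nn_integral_cong) (auto simp: c cylinder_def C'_def split: split_indicator)
  also have "\<dots> = (\<integral>\<^sup>+\<omega>. indicator C' \<omega> * cylinder_prob l (t, X t \<omega>) \<partial>P r x)"
    using t s by (intro Cons.IH r l C') auto
  also have "\<dots> = (\<integral>\<^sup>+\<omega>. indicator C \<omega> * ?\<phi> (X t \<omega>) \<partial>P r x)"
    by (intro nn_integral_cong) (auto simp: C'_def space_P[OF r] split: split_indicator)
  also have "\<dots> = (\<integral>\<^sup>+\<omega>. indicator C \<omega> * (\<integral>\<^sup>+\<omega>'. ?\<phi> (X t \<omega>') \<partial>P s (X s \<omega>)) \<partial>P r x)"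
    by (rule markov_nn_integral[OF r s t Cons.prems(4)]) measurable
  also have "\<dots> = (\<integral>\<^sup>+\<omega>. indicator C \<omega> * cylinder_prob (c # l) (s, X s \<omega>) \<partial>P r x)"
    by (simp add: c nn_integral_transition_law[OF tT sT])
  finally show ?case .
qed

text \<open>\<open>markov_cylinder\<close> at the starting time itself expresses the probability
  through the random point \<open>X r\<close>. That point is almost surely at distance zero from the
  prescribed start, though not necessarily equal to it, and consistency of
  \<open>cylinder_prob\<close> removes the difference.\<close>

lemma emeasure_cylinder:
  assumes r: "r \<in> {0..T}" and l: "chain_from r l" and m: "cylinder l \<in> sets M"
  shows "emeasure (P r x) (cylinder l) = cylinder_prob l (r, x)"
proof -
  interpret prob_space "P r x" by (rule P_prob) fact
  have C: "space M \<in> sets (F r)" using filtration_subalgebra[OF r] by (metis sets.top subalgebra_def)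
  have "emeasure (P r x) (cylinder l) = (\<integral>\<^sup>+\<omega>. indicator (cylinder l) \<omega> \<partial>P r x)"
    using m sets_P[OF r] by simp
  also have "\<dots> = (\<integral>\<^sup>+\<omega>. indicator (space M) \<omega> * indicator (cylinder l) \<omega> \<partial>P r x)"
    by (intro nn_integral_cong) (simp add: space_P[OF r])
  also have "\<dots> = (\<integral>\<^sup>+\<omega>. indicator (space M) \<omega> * cylinder_prob l (r, X r \<omega>) \<partial>P r x)"
    using r by (intro markov_cylinder l C) auto
  also have "\<dots> = (\<integral>\<^sup>+\<omega>. cylinder_prob l (r, x) \<partial>P r x)"
  proof (rule nn_integral_cong_AE, use P_start[OF r, of x] AE_space in eventually_elim)
    fix \<omega> assume "d (r, X r \<omega>) (r, x) = 0" and \<omega>: "\<omega> \<in> space (P r x)"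
    then have "cylinder_prob l (r, X r \<omega>) = cylinder_prob l (r, x)"
      using r by (intro cylinder_prob_consistent[OF l r]) auto
    then show "indicator (space M) \<omega> * cylinder_prob l (r, X r \<omega>) = cylinder_prob l (r, x)"
      using \<omega> space_P[OF r] by simp
  qed
  finally show ?thesis by (simp add: emeasure_space_1)
qed

section \<open>The sigma-algebra of the future and its law\<close>

abbreviation "future t \<equiv> generated_sigma M X {t..T}"

lemma space_future [simp]: "space (future t) = space M"
  unfolding generated_sigma_def by (rule space_measure_of) auto

lemma sets_future:
  "sets (future t) = sigma_sets (space M) {X s -` B \<inter> space M | s B. s \<in> {t..T} \<and> B \<in> sets borel}"
  unfolding generated_sigma_def by (rule sets_measure_of) auto

lemma future_subalgebra:
  assumes t: "t \<in> {0..T}"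
  shows "subalgebra M (future t)"
  unfolding subalgebra_def sets_future
  using t by (auto intro!: sets.sigma_sets_subset measurable_sets[OF X_measurable])

lemma future_subalgebra_P:
  assumes "r \<in> {0..T}" "t \<in> {0..T}"
  shows "subalgebra (P r x) (future t)"
  using future_subalgebra[OF assms(2)] sets_P[OF assms(1)] space_P[OF assms(1)] by (simp add: subalgebra_def)

lemma cylinder_in_future:
  assumes "chain_from t l" shows "cylinder l \<in> sets (future t)"
proof -
  have eq: "cylinder l = space M \<inter> (\<Inter>(s, B)\<in>set l. X s -` B \<inter> space M)"
    by (auto simp: cylinder_def)
  have "X s -` B \<inter> space M \<in> sets (future t)" if "(s, B) \<in> set l" for s B
    using assms that unfolding sets_future chain_from_def by blast
  moreover have "space M \<in> sets (future t)" using sets.top[of "future t"] by simp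
  moreover from calculation have "l \<noteq> [] \<Longrightarrow> (\<Inter>(s, B)\<in>set l. X s -` B \<inter> space M) \<in> sets (future t)"
    by (intro sets.finite_INT) (simp_all add: case_prod_beta)
  ultimately show ?thesis
    unfolding eq by (cases "l = []") (simp_all add: sets.Int)
qed

lemma sets_future_cylinders:
  "sets (future t) = sigma_sets (space M) (cylinder ` {l. chain_from t l})"
proof
  show "sets (future t) \<subseteq> sigma_sets (space M) (cylinder ` {l. chain_from t l})"
    unfolding sets_future
  proof (intro sigma_sets_mono' subsetI)
    fix A assume "A \<in> {X s -` B \<inter> space M | s B. s \<in> {t..T} \<and> B \<in> sets borel}"
    then obtain s B where "A = X s -` B \<inter> space M" "s \<in> {t..T}" "B \<in> sets borel" by blast
    then have "A = cylinder [(s, B)]" "chain_from t [(s, B)]"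
      by (auto simp: cylinder_def chain_from_def)
    then show "A \<in> cylinder ` {l. chain_from t l}" by blast
  qed
  show "sigma_sets (space M) (cylinder ` {l. chain_from t l}) \<subseteq> sets (future t)"
    using sets.sigma_sets_subset[of "cylinder ` {l. chain_from t l}" "future t"] cylinder_in_future by auto
qed

text \<open>Constraints may be listed in any order without changing the cylinder, so the joined list
  may be sorted by time.\<close>

lemma Int_stable_cylinders: "Int_stable (cylinder ` {l. chain_from t l})"
proof (rule Int_stableI_image)
  fix l l' assume "l \<in> {l. chain_from t l}" "l' \<in> {l. chain_from t l}"
  then have "chain_from t (sort_key fst (l @ l'))"
    by (auto simp: chain_from_def)
  moreover have "cylinder l \<inter> cylinder l' = cylinder (sort_key fst (l @ l'))"
    by (auto simp: cylinder_def)
  ultimately show "\<exists>k\<in>{l. chain_from t l}. cylinder l \<inter> cylinder l' = cylinder k"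
    by blast
qed

text \<open>Cylinders form an intersection-stable generator, so measurability need only be checked
  on them, where \<open>cylinder_prob\<close> supplies it. Starting times are limited to
  \<open>t\<close>: only then do all constraints lie after the start and is the formula for the
  probability valid.\<close>

lemma future_kernel_measurable:
  assumes t: "t \<in> {0..T}"
  shows "(\<lambda>p. restr_to_subalg (P (fst p) (snd p)) (future t)) \<in> slab t \<rightarrow>\<^sub>M subprob_algebra (future t)"
proof (rule measurable_prob_algebraD, rule measurable_prob_algebra_generated[OF sets_future_cylinders Int_stable_cylinders])
  show "cylinder ` {l. chain_from t l} \<subseteq> Pow (space M)" by (auto simp: cylinder_def)
next
  fix p :: "real \<times> 's" assume "p \<in> space (slab t)"
  then have p: "fst p \<in> {0..T}" using t by auto
  show "prob_space (restr_to_subalg (P (fst p) (snd p)) (future t))"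
    by (rule prob_space_restr_to_subalg[OF future_subalgebra_P[OF p t] P_prob[OF p]])
  show "sets (restr_to_subalg (P (fst p) (snd p)) (future t)) = sets (future t)"
    by (rule sets_restr_to_subalg[OF future_subalgebra_P[OF p t]])
next
  fix A assume "A \<in> cylinder ` {l. chain_from t l}"
  then obtain l where A: "A = cylinder l" and l: "chain_from t l" by blast
  show "(\<lambda>p. emeasure (restr_to_subalg (P (fst p) (snd p)) (future t)) A) \<in> borel_measurable (slab t)"
  proof (rule measurable_cong[THEN iffD1, OF _ cylinder_prob_measurable[OF l t]])
    fix p :: "real \<times> 's" assume "p \<in> space (slab t)"
    then have p: "fst p \<in> {0..T}" "fst p \<le> t" using t by auto
    have "chain_from (fst p) l" using l p unfolding chain_from_def by fastforce
    then have "emeasure (P (fst p) (snd p)) A = cylinder_prob l p"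
      using emeasure_cylinder[OF p(1), of l "snd p"] cylinder_in_future[OF l] future_subalgebra[OF t]
      by (auto simp: A subalgebra_def)
    then show "cylinder_prob l p = emeasure (restr_to_subalg (P (fst p) (snd p)) (future t)) A"
      using emeasure_restr_to_subalg[OF future_subalgebra_P[OF p(1) t]] cylinder_in_future[OF l]
      by (simp add: A)
  qed
qed

end

section \<open>Expectations along the process\<close>

context markov_time_space begin

lemma path_measurable_future:
  assumes t: "t \<in> {0..T}"
  shows "(\<lambda>z. (fst z, X (fst z) (snd z))) \<in> restrict_space borel {t..T} \<Otimes>\<^sub>M future t \<rightarrow>\<^sub>M BTS"
proof (rule pair_measurable_BTS)
  show "fst \<in> borel_measurable (restrict_space borel {t..T} \<Otimes>\<^sub>M future t)"
    by (rule measurable_compose[OF measurable_fst]) (simp add: measurable_restrict_space1)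
  show "(\<lambda>z. X (fst z) (snd z)) \<in> restrict_space borel {t..T} \<Otimes>\<^sub>M future t \<rightarrow>\<^sub>M borel"
    using X_backward_progressive[OF t] by (simp add: case_prod_beta)
qed (use t in \<open>auto simp: space_pair_measure space_restrict_space\<close>)

lemma path_measurable: "(\<lambda>z. (fst z, X (fst z) (snd z))) \<in> BT \<Otimes>\<^sub>M M \<rightarrow>\<^sub>M BTS"
proof -
  have 0: "0 \<in> {0..T}" using T_pos by auto
  have "(\<lambda>\<omega>. \<omega>) \<in> M \<rightarrow>\<^sub>M future 0"
    using future_subalgebra[OF 0] by (rule measurable_from_subalg) auto
  then have "(\<lambda>z. (fst z, snd z)) \<in> BT \<Otimes>\<^sub>M M \<rightarrow>\<^sub>M BT \<Otimes>\<^sub>M future 0"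
    by (intro measurable_Pair measurable_fst measurable_compose[OF measurable_snd])
  then show ?thesis
    using measurable_comp[OF _ path_measurable_future[OF 0]] by (simp add: comp_def)
qed

section \<open>Means of bounded functions at a fixed time\<close>

definition bounded_measurable :: "real \<Rightarrow> (real \<times> 's \<Rightarrow> real) \<Rightarrow> bool" where
  "bounded_measurable K H \<longleftrightarrow> H \<in> borel_measurable BTS \<and> (\<forall>p\<in>TS. \<bar>H p\<bar> \<le> K)"

definition mean :: "(real \<times> 's \<Rightarrow> real) \<Rightarrow> real \<Rightarrow> real \<times> 's \<Rightarrow> real" where
  "mean H s p = (\<integral>\<omega>. H (s, X s \<omega>) \<partial>P (fst p) (snd p))"

text \<open>Measurability is asked slice by slice. The terminal value
  \<open>\<lambda>p. g (snd p)\<close>, viewed as a function on time-space, has it, although it may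
  fail to be Borel for \<open>d\<close>, whose topology can be coarser than the product
  topology.\<close>

definition bounded_slices :: "real \<Rightarrow> (real \<times> 's \<Rightarrow> real) \<Rightarrow> bool" where
  "bounded_slices K H \<longleftrightarrow>
     (\<forall>s\<in>{0..T}. (\<lambda>y. H (s, y)) \<in> borel_measurable borel) \<and> (\<forall>p\<in>TS. \<bar>H p\<bar> \<le> K)"

lemma bounded_slicesD:
  assumes "bounded_slices K H"
  shows "t \<in> {0..T} \<Longrightarrow> \<bar>H (t, x)\<bar> \<le> K" "0 \<le> K"
    "t \<in> {0..T} \<Longrightarrow> (\<lambda>y. H (t, y)) \<in> borel_measurable borel"
proof -
  show H: "t \<in> {0..T} \<Longrightarrow> \<bar>H (t, x)\<bar> \<le> K" for t x
    using assms by (auto simp: bounded_slices_def)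
  show "0 \<le> K" using H[of 0 undefined] T_pos by auto
qed (use assms in \<open>auto simp: bounded_slices_def\<close>)

lemma slice_measurable:
  assumes "H \<in> borel_measurable BTS" "s \<in> {0..T}"
  shows "(\<lambda>y. H (s, y)) \<in> borel_measurable borel"
  by (rule measurable_compose[OF pair_measurable_BTS[of "\<lambda>_. s" borel "\<lambda>y. y"] assms(1)]) (use assms(2) in auto)

lemma bounded_measurable_slices: "bounded_measurable K H \<Longrightarrow> bounded_slices K H"
  by (simp add: bounded_measurable_def bounded_slices_def slice_measurable)

context
  fixes K H assumes bs: "bounded_slices K H"
begin

lemma mean_integrand_measurable:
  "s \<in> {0..T} \<Longrightarrow> r \<in> {0..T} \<Longrightarrow> (\<lambda>\<omega>. H (s, X s \<omega>)) \<in> borel_measurable (P r x)"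
  using measurable_compose[OF X_measurable_P bounded_slicesD(3)[OF bs]] by simp

lemma mean_integrable:
  assumes "s \<in> {0..T}" "r \<in> {0..T}"
  shows "integrable (P r x) (\<lambda>\<omega>. H (s, X s \<omega>))"
proof -
  interpret prob_space "P r x" by (rule P_prob) fact
  show ?thesis
    by (intro integrable_const_bound[where B=K] mean_integrand_measurable assms)
       (use bounded_slicesD(1)[OF bs] assms in auto)
qed

lemma mean_bound:
  assumes "s \<in> {0..T}" "fst p \<in> {0..T}"
  shows "\<bar>mean H s p\<bar> \<le> K"
proof -
  interpret prob_space "P (fst p) (snd p)" by (rule P_prob) fact
  have "\<bar>mean H s p\<bar> \<le> (\<integral>\<omega>. \<bar>H (s, X s \<omega>)\<bar> \<partial>P (fst p) (snd p))"
    unfolding mean_def by (rule integral_abs_bound)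
  also have "\<dots> \<le> K"
    by (intro integral_le_const integrable_abs mean_integrable assms AE_I2 bounded_slicesD(1)[OF bs])
  finally show ?thesis .
qed

text \<open>Shifting by the bound \<open>K\<close> makes the integrand nonnegative, so that facts
  about nonnegative integrals carry over to bounded signed functions.\<close>

lemma mean_nn_integral:
  assumes "s \<in> {0..T}" "r \<in> {0..T}"
  shows "ennreal (mean H s (r, x) + K) = (\<integral>\<^sup>+\<omega>. ennreal (H (s, X s \<omega>) + K) \<partial>P r x)"
proof -
  interpret prob_space "P r x" by (rule P_prob) fact
  have i: "integrable (P r x) (\<lambda>\<omega>. H (s, X s \<omega>) + K)"
    using mean_integrable[OF assms] by auto
  have "0 \<le> H (s, X s \<omega>) + K" for \<omega>
    using bounded_slicesD(1)[OF bs assms(1), of "X s \<omega>"] by (auto simp: abs_le_iff)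
  then have "(\<integral>\<^sup>+\<omega>. ennreal (H (s, X s \<omega>) + K) \<partial>P r x) = ennreal (\<integral>\<omega>. H (s, X s \<omega>) + K \<partial>P r x)"
    by (intro nn_integral_eq_integral i) auto
  also have "(\<integral>\<omega>. H (s, X s \<omega>) + K \<partial>P r x) = mean H s (r, x) + K"
    using mean_integrable[OF assms] by (simp add: mean_def prob_space)
  finally show ?thesis ..
qed

lemma mean_enn2real:
  assumes "s \<in> {0..T}" "fst p \<in> {0..T}"
  shows "mean H s p = enn2real (\<integral>\<^sup>+\<omega>. ennreal (H (s, X s \<omega>) + K) \<partial>P (fst p) (snd p)) - K"
proof -
  have "0 \<le> mean H s p + K" using mean_bound[OF assms] by (auto simp: abs_le_iff)
  then show ?thesis
    using arg_cong[where f=enn2real, OF mean_nn_integral[OF assms, of "snd p"]] by simp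
qed

lemma mean_transition_law:
  assumes "s \<in> {0..T}" "fst p \<in> {0..T}"
  shows "mean H s p = (\<integral>y. H (s, y) \<partial>transition_law s p)"
  unfolding transition_law_def mean_def
  using assms bounded_slicesD(3)[OF bs] by (simp add: integral_distr X_measurable_P)

lemma mean_measurable_slab:
  assumes s: "s \<in> {0..T}"
  shows "mean H s \<in> borel_measurable (slab s)"
proof -
  have "(\<lambda>p. \<integral>y. H (s, y) \<partial>transition_law s p) \<in> borel_measurable (slab s)"
    by (rule measurable_compose[OF transition_law_measurable[OF s] integral_measurable_subprob_algebra])
       (rule bounded_slicesD(3)[OF bs s])
  then show ?thesis
    by (rule measurable_cong[THEN iffD1, rotated]) (use mean_transition_law s in auto)
qed

lemma mean_consistent:
  assumes "s \<in> {0..T}" "p \<in> {0..s} \<times> UNIV" "q \<in> {0..s} \<times> UNIV" "d p q = 0"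
  shows "mean H s p = mean H s q"
proof -
  have "fst p \<in> {0..T}" "fst q \<in> {0..T}" using assms by auto
  then show ?thesis
    using transition_law_consistent[OF assms] by (simp add: mean_transition_law[OF assms(1)])
qed

lemma mean_measurable_state:
  assumes "s \<in> {0..T}" "t \<in> {0..s}"
  shows "(\<lambda>y. mean H s (t, y)) \<in> borel_measurable borel"
  by (rule measurable_compose[OF pair_measurable_slab[of "\<lambda>y. y" borel t s] mean_measurable_slab]) (use assms in auto)

text \<open>The Chapman-Kolmogorov relation: \<open>markov_nn_integral\<close> with the whole space
  as conditioning event, applied to the shifted function.\<close>

lemma mean_markov:
  assumes r: "r \<in> {0..T}" and t: "t \<in> {r..T}" and s: "s \<in> {t..T}"
  shows "(\<integral>\<omega>. mean H s (t, X t \<omega>) \<partial>P r x) = mean H s (r, x)"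
proof -
  interpret prob_space "P r x" by (rule P_prob) fact
  have sT: "s \<in> {0..T}" and tT: "t \<in> {0..T}" using r s t by auto
  have m [measurable]: "(\<lambda>\<omega>. mean H s (t, X t \<omega>)) \<in> borel_measurable (P r x)"
    using measurable_compose[OF X_measurable_P[OF tT r] mean_measurable_state[OF sT]] s tT by auto
  have nn: "0 \<le> mean H s (t, X t \<omega>) + K" for \<omega>
    using mean_bound[OF sT, of "(t, X t \<omega>)"] tT by (auto simp: abs_le_iff)
  have i: "integrable (P r x) (\<lambda>\<omega>. mean H s (t, X t \<omega>))"
    by (intro integrable_const_bound[where B=K] m) (use mean_bound[OF sT] tT in auto)
  have C: "space M \<in> sets (F t)" using filtration_subalgebra[OF tT] by (metis sets.top subalgebra_def)
  have [measurable]: "(\<lambda>y. H (s, y)) \<in> borel_measurable borel" by (rule bounded_slicesD(3)[OF bs sT])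
  have "(\<integral>\<^sup>+\<omega>. indicator (space M) \<omega> * ennreal (H (s, X s \<omega>) + K) \<partial>P r x)
      = (\<integral>\<^sup>+\<omega>. indicator (space M) \<omega> * (\<integral>\<^sup>+\<omega>'. ennreal (H (s, X s \<omega>') + K) \<partial>P t (X t \<omega>)) \<partial>P r x)"
    by (rule markov_nn_integral[OF r t s C]) measurable
  moreover have "(\<integral>\<^sup>+\<omega>. indicator (space M) \<omega> * \<phi> \<omega> \<partial>P r x) = (\<integral>\<^sup>+\<omega>. \<phi> \<omega> \<partial>P r x)" for \<phi>
    by (intro nn_integral_cong) (simp add: space_P[OF r])
  ultimately have "(\<integral>\<^sup>+\<omega>. ennreal (H (s, X s \<omega>) + K) \<partial>P r x)
      = (\<integral>\<^sup>+\<omega>. (\<integral>\<^sup>+\<omega>'. ennreal (H (s, X s \<omega>') + K) \<partial>P t (X t \<omega>)) \<partial>P r x)"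
    by simp
  then have "ennreal (mean H s (r, x) + K) = (\<integral>\<^sup>+\<omega>. ennreal (mean H s (t, X t \<omega>) + K) \<partial>P r x)"
    by (simp add: mean_nn_integral[OF sT r] mean_nn_integral[OF sT tT])
  also have "\<dots> = ennreal (\<integral>\<omega>. mean H s (t, X t \<omega>) + K \<partial>P r x)"
    using i nn by (intro nn_integral_eq_integral) auto
  also have "(\<integral>\<omega>. mean H s (t, X t \<omega>) + K \<partial>P r x) = (\<integral>\<omega>. mean H s (t, X t \<omega>) \<partial>P r x) + K"
    using i by (simp add: prob_space)
  finally have "mean H s (r, x) + K = (\<integral>\<omega>. mean H s (t, X t \<omega>) \<partial>P r x) + K"
  proof (rule ennreal_inj[THEN iffD1, rotated 2])
    show "0 \<le> mean H s (r, x) + K" using mean_bound[OF sT, of "(r, x)"] r by (auto simp: abs_le_iff)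
    have "- K \<le> mean H s (t, X t \<omega>)" for \<omega> using nn[of \<omega>] by simp
    then have "- K \<le> (\<integral>\<omega>. mean H s (t, X t \<omega>) \<partial>P r x)"
      by (intro integral_ge_const i) simp
    then show "0 \<le> (\<integral>\<omega>. mean H s (t, X t \<omega>) \<partial>P r x) + K" by simp
  qed
  then show ?thesis by simp
qed

end

section \<open>Joint measurability of means in start and target\<close>

context
  fixes K H assumes bm: "bounded_measurable K H"
begin

text \<open>The time \<open>q\<close> separates start from target. For starts up to \<open>q\<close>
  the law of the future after \<open>q\<close> is a kernel, and for targets from \<open>q\<close> on
  the path is jointly measurable with respect to that future; integrating the second against the
  first gives the claim.\<close>

lemma mean_measurable_rectangle:
  assumes q: "q \<in> {0..T}"
  shows "(\<lambda>z. mean H (snd z) (fst z)) \<in> borel_measurable (slab q \<Otimes>\<^sub>M restrict_space borel {q..T})"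
proof -
  let ?N = "slab q \<Otimes>\<^sub>M restrict_space borel {q..T}"
  define L where "L z = restr_to_subalg (P (fst (fst z)) (snd (fst z))) (future q)" for z :: "(real \<times> 's) \<times> real"
  have [measurable]: "H \<in> borel_measurable BTS" using bm by (simp add: bounded_measurable_def)
  have L: "L \<in> ?N \<rightarrow>\<^sub>M subprob_algebra (future q)"
    unfolding L_def by (rule measurable_compose[OF measurable_fst future_kernel_measurable[OF q]])
  have path: "(\<lambda>z. (snd (fst z), X (snd (fst z)) (snd z))) \<in> ?N \<Otimes>\<^sub>M future q \<rightarrow>\<^sub>M BTS"
    using measurable_compose[OF _ path_measurable_future[OF q],
        of "\<lambda>z. (snd (fst z), snd z)" "?N \<Otimes>\<^sub>M future q"] by simp
  have "(\<lambda>z. \<integral>\<^sup>+\<omega>. ennreal (H (snd z, X (snd z) \<omega>) + K) \<partial>L z) \<in> borel_measurable ?N"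
    by (rule nn_integral_measurable_subprob_algebra2[OF _ L])
       (use measurable_compose[OF path, of H borel] in \<open>simp add: case_prod_beta\<close>)
  then have "(\<lambda>z. enn2real (\<integral>\<^sup>+\<omega>. ennreal (H (snd z, X (snd z) \<omega>) + K) \<partial>L z) - K) \<in> borel_measurable ?N"
    by measurable
  then show ?thesis
  proof (rule measurable_cong[THEN iffD1, rotated])
    fix z assume "z \<in> space ?N"
    then have z: "fst (fst z) \<in> {0..T}" "snd z \<in> {0..T}" "snd z \<in> {q..T}"
      using q by (auto simp: space_pair_measure space_restrict_space)
    have "(\<lambda>\<omega>. (snd z, X (snd z) \<omega>)) \<in> future q \<rightarrow>\<^sub>M BTS"
      using measurable_compose[OF _ path_measurable_future[OF q], of "\<lambda>\<omega>. (snd z, \<omega>)"] z(3)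
      by (simp add: space_restrict_space measurable_Pair1')
    then have m: "(\<lambda>\<omega>. ennreal (H (snd z, X (snd z) \<omega>) + K)) \<in> borel_measurable (future q)"
      by measurable
    show "enn2real (\<integral>\<^sup>+\<omega>. ennreal (H (snd z, X (snd z) \<omega>) + K) \<partial>L z) - K = mean H (snd z) (fst z)"
      unfolding L_def nn_integral_subalgebra2[OF future_subalgebra_P[OF z(1) q] m]
      by (simp add: mean_enn2real[OF bounded_measurable_slices[OF bm] z(2,1)])
  qed
qed

text \<open>Strict inequality leaves room for a rational time between start and target. Countably
  many rectangles therefore cover the region where the mean is kept, and on the remaining measurable
  set the function vanishes.\<close>

lemma mean_jointly_measurable:
  "(\<lambda>z. if fst (fst z) < snd z then mean H (snd z) (fst z) else 0) \<in> borel_measurable (BTS \<Otimes>\<^sub>M BT)"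
    (is "?f \<in> _")
proof (rule measurable_piecewise_restrict)
  let ?R = "\<lambda>q. ({0..q} \<times> UNIV) \<times> {q..T} :: ((real \<times> 's) \<times> real) set"
  let ?C = "insert {z\<in>space (BTS \<Otimes>\<^sub>M BT). snd z \<le> fst (fst z)} (?R ` (\<rat> \<inter> {0..T}))"
  show "countable ?C" using countable_rat by auto
  have R: "?R q \<in> sets (BTS \<Otimes>\<^sub>M BT)" if "q \<in> {0..T}" for q
    using that by (intro pair_measureI slab_measurable) (auto simp: sets_restrict_space_iff)
  have fst': "(\<lambda>z. fst (fst z)) \<in> borel_measurable (BTS \<Otimes>\<^sub>M BT)"
    by (rule measurable_compose[OF measurable_fst pm_continuous_measurable[OF time_continuous]])
  have snd': "snd \<in> borel_measurable (BTS \<Otimes>\<^sub>M BT)"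
    by (rule measurable_compose[OF measurable_snd]) (simp add: measurable_restrict_space1)
  show "space (BTS \<Otimes>\<^sub>M BT) \<subseteq> \<Union>?C"
  proof
    fix z :: "(real \<times> 's) \<times> real" assume z: "z \<in> space (BTS \<Otimes>\<^sub>M BT)"
    show "z \<in> \<Union>?C"
    proof (cases "fst (fst z) < snd z")
      case True
      then obtain q where "q \<in> \<rat>" "fst (fst z) < q" "q < snd z" using Rats_dense_in_real by blast
      with z have "z \<in> ?R q" "q \<in> \<rat> \<inter> {0..T}" by (auto simp: space_pair_measure)
      then show ?thesis by blast
    qed (use z in auto)
  qed
  fix \<Omega> assume \<Omega>: "\<Omega> \<in> ?C"
  then show "\<Omega> \<inter> space (BTS \<Otimes>\<^sub>M BT) \<in> sets (BTS \<Otimes>\<^sub>M BT)"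
  proof
    have "{z\<in>space (BTS \<Otimes>\<^sub>M BT). snd z \<le> fst (fst z)} \<in> sets (BTS \<Otimes>\<^sub>M BT)"
      using borel_measurable_le[OF snd' fst'] by simp
    then show "\<Omega> = {z\<in>space (BTS \<Otimes>\<^sub>M BT). snd z \<le> fst (fst z)} \<Longrightarrow> ?thesis" by auto
  qed (use R in auto)
  from \<Omega> show "?f \<in> borel_measurable (restrict_space (BTS \<Otimes>\<^sub>M BT) \<Omega>)"
  proof
    assume \<Omega>: "\<Omega> = {z\<in>space (BTS \<Otimes>\<^sub>M BT). snd z \<le> fst (fst z)}"
    show ?thesis
      by (subst measurable_cong[of _ _ "\<lambda>_. 0"]) (auto simp: \<Omega> space_restrict_space)
  next
    assume "\<Omega> \<in> ?R ` (\<rat> \<inter> {0..T})"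
    then obtain q where \<Omega>: "\<Omega> = ?R q" and q: "q \<in> {0..T}" by auto
    let ?N = "restrict_space (BTS \<Otimes>\<^sub>M BT) \<Omega>"
    have "fst \<in> ?N \<rightarrow>\<^sub>M restrict_space BTS ({0..q} \<times> UNIV)"
      by (intro measurable_restrict_space2 measurable_restrict_space1) (auto simp: space_restrict_space \<Omega>)
    then have 1: "fst \<in> ?N \<rightarrow>\<^sub>M slab q"
      using sets_pm_borel_slab[of "{0..q}"] q measurable_cong_sets[OF refl, of "slab q"] by auto
    have 2: "snd \<in> ?N \<rightarrow>\<^sub>M restrict_space borel {q..T}"
      using snd' by (intro measurable_restrict_space2 measurable_restrict_space1) (auto simp: space_restrict_space \<Omega>)
    have "(\<lambda>z. mean H (snd z) (fst z)) \<in> borel_measurable ?N"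
      using measurable_compose[OF measurable_Pair[OF 1 2] mean_measurable_rectangle[OF q]] by simp
    moreover have "{z \<in> space ?N. fst (fst z) < snd z} \<in> sets ?N"
      using borel_measurable_less[OF measurable_restrict_space1[OF fst'] measurable_restrict_space1[OF snd']] .
    ultimately show ?thesis
      by (intro measurable_If) auto
  qed
qed

end

end

section \<open>Atomless time measures\<close>

locale time_measure =
  fixes T :: real and \<nu> :: "real measure"
  assumes T_nonneg: "0 \<le> T"
    and sets_nu: "sets \<nu> = sets (restrict_space borel {0..T})"
    and finite_nu: "finite_measure \<nu>"
    and null_singleton: "t \<in> {0..T} \<Longrightarrow> emeasure \<nu> {t} = 0"
begin

sublocale finite_measure \<nu> by (rule finite_nu)

lemma space_nu: "space \<nu> = {0..T}"
  using sets_eq_imp_space_eq[OF sets_nu] by (simp add: space_restrict_space)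

lemma id_nu [measurable]: "(\<lambda>s. s) \<in> borel_measurable \<nu>"
  by (subst measurable_cong_sets[OF sets_nu refl]) (simp add: measurable_restrict_space1)

lemma Ioc_nu [measurable]: "0 \<le> r \<Longrightarrow> t \<le> T \<Longrightarrow> {r<..t} \<in> sets \<nu>"
  by (auto simp: sets_nu sets_restrict_space_iff)

section \<open>The clock and the image of the measure under it\<close>

definition clock :: "real \<Rightarrow> real" where "clock t = measure \<nu> ({..t} \<inter> {0..T})"

lemma clock_cdf: "clock = cdf (distr \<nu> borel (\<lambda>s. s))"
  by (auto simp: clock_def cdf_def measure_distr space_nu fun_eq_iff)

text \<open>A distribution function can jump only at a point of positive mass.\<close>

lemma continuous_clock: "continuous_on UNIV clock"
proof -
  interpret D: finite_borel_measure "distr \<nu> borel (\<lambda>s. s)"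
    by (auto intro!: finite_borel_measure.intro finite_measure_distr simp: finite_borel_measure_axioms_def)
  have "emeasure (distr \<nu> borel (\<lambda>s. s)) {t} = emeasure \<nu> ({t} \<inter> {0..T})" for t
    by (simp add: emeasure_distr space_nu)
  moreover have "emeasure \<nu> ({t} \<inter> {0..T}) = 0" for t
    using null_singleton[of t] by (cases "t \<in> {0..T}") simp_all
  ultimately have "measure (distr \<nu> borel (\<lambda>s. s)) {t} = 0" for t
    by (simp add: measure_def)
  then have "isCont clock t" for t
    unfolding clock_cdf by (simp add: D.isCont_cdf)
  then show ?thesis by (simp add: continuous_at_imp_continuous_on)
qed

lemma clock_borel [measurable]: "clock \<in> borel_measurable borel"
  by (rule borel_measurable_continuous_onI[OF continuous_clock])

lemma clock_measurable [measurable]: "clock \<in> borel_measurable \<nu>"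
  using measurable_compose[OF id_nu clock_borel] .

lemma clock_mono: "s \<le> t \<Longrightarrow> clock s \<le> clock t"
  unfolding clock_def by (intro finite_measure_mono) (auto simp: sets_nu sets_restrict_space_iff)

lemma clock_nonneg: "0 \<le> clock t"
  by (simp add: clock_def)

lemma clock_0 [simp]: "clock 0 = 0"
proof -
  have "{..0} \<inter> {0..T} = {0}" using T_nonneg by auto
  then show ?thesis using null_singleton[of 0] T_nonneg by (simp add: clock_def measure_def)
qed

lemma clock_T: "clock T = measure \<nu> (space \<nu>)"
proof -
  have "{..T} \<inter> {0..T} = {0..T}" by auto
  then show ?thesis by (simp add: clock_def space_nu)
qed

lemma clock_diff:
  assumes "0 \<le> r" "r \<le> t" "t \<le> T"
  shows "measure \<nu> {r<..t} = clock t - clock r"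
proof -
  have "measure \<nu> (({..t} \<inter> {0..T}) - ({..r} \<inter> {0..T})) = clock t - clock r"
    unfolding clock_def using assms
    by (intro finite_measure_Diff) (auto simp: sets_nu sets_restrict_space_iff)
  moreover have "({..t} \<inter> {0..T}) - ({..r} \<inter> {0..T}) = {r<..t}" using assms by auto
  ultimately show ?thesis by simp
qed

text \<open>The clock may have plateaus, so the last time \<open>m\<close> at which it is at most
  \<open>y\<close> is used. The intermediate value theorem provides some time with value exactly
  \<open>y\<close>; it precedes \<open>m\<close>, which forces the value \<open>y\<close> at
  \<open>m\<close> too, and the superlevel set is the interval after \<open>m\<close>.\<close>

lemma measure_clock_greater:
  assumes "0 \<le> y" "y \<le> clock T"
  shows "measure \<nu> {s\<in>space \<nu>. y < clock s} = clock T - y"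
proof -
  define Z where "Z = {0..T} \<inter> clock -` {..y}"
  have "closed Z"
    unfolding Z_def by (intro continuous_closed_preimage continuous_on_subset[OF continuous_clock]) auto
  then have cZ: "compact Z"
    unfolding Z_def by (metis bounded_Int bounded_closed_interval compact_eq_bounded_closed)
  have "0 \<in> Z" using T_nonneg assms by (auto simp: Z_def)
  then obtain m where m: "m \<in> Z" "\<And>s. s \<in> Z \<Longrightarrow> s \<le> m"
    using compact_attains_sup[OF cZ] by auto
  obtain s1 where s1: "0 \<le> s1" "s1 \<le> T" "clock s1 = y"
    using IVT'[of clock 0 y T] T_nonneg assms continuous_on_subset[OF continuous_clock] by auto
  have mT: "0 \<le> m" "m \<le> T" "clock m \<le> y" using m(1) by (auto simp: Z_def)
  have "s1 \<in> Z" using s1 by (simp add: Z_def)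
  then have my: "clock m = y"
    using m(2) s1(3) clock_mono[of s1 m] mT(3) by fastforce
  have "{s\<in>space \<nu>. y < clock s} = {m<..T}"
  proof (intro set_eqI iffI)
    fix s assume "s \<in> {s\<in>space \<nu>. y < clock s}"
    then have "s \<le> T" "clock m < clock s" by (auto simp: space_nu my)
    then show "s \<in> {m<..T}" using clock_mono[of s m] by (cases "s \<le> m") auto
  next
    fix s assume s: "s \<in> {m<..T}"
    then have "s \<notin> Z" using m(2) by force
    then show "s \<in> {s\<in>space \<nu>. y < clock s}" using s mT by (simp add: Z_def space_nu)
  qed
  then show ?thesis using clock_diff[of m T] mT my by simp
qed

text \<open>The upper tails of both measures agree by \<open>measure_clock_greater\<close>. A
  continuous clock thus transports its own measure to Lebesgue measure, and integrals of functions
  of the clock become elementary calculus.\<close>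

lemma distr_clock: "distr \<nu> borel clock = density lborel (indicator {0..clock T})"
proof (rule measure_eqI_lessThan)
  fix y :: real
  show "emeasure (distr \<nu> borel clock) {y<..} < \<infinity>"
    by (simp add: emeasure_distr less_top[symmetric])
  have "emeasure (distr \<nu> borel clock) {y<..} = ennreal (measure \<nu> {s\<in>space \<nu>. y < clock s})"
    by (simp add: emeasure_distr emeasure_eq_measure) (auto intro!: arg_cong[where f="measure \<nu>"])
  moreover have "emeasure (density lborel (indicator {0..clock T})) {y<..} = emeasure lborel ({0..clock T} \<inter> {y<..})"
    by (simp add: emeasure_density flip: indicator_inter_arith)
  moreover have "ennreal (measure \<nu> {s\<in>space \<nu>. y < clock s}) = emeasure lborel ({0..clock T} \<inter> {y<..})"
  proof -
    consider "y < 0" | "0 \<le> y" "y \<le> clock T" | "clock T < y" by linarith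
    then show ?thesis
    proof cases
      case 1
      then have "{s\<in>space \<nu>. y < clock s} = space \<nu>" "{0..clock T} \<inter> {y<..} = {0..clock T}"
        using less_le_trans[OF 1 clock_nonneg] by auto
      then show ?thesis by (simp add: clock_T)
    next
      case 2
      then have "{0..clock T} \<inter> {y<..} = {y<..clock T}" by auto
      with 2 show ?thesis by (simp add: measure_clock_greater)
    next
      case 3
      then have "{s\<in>space \<nu>. y < clock s} = {}" "{0..clock T} \<inter> {y<..} = {}"
        using clock_mono[of _ T] by (fastforce simp: space_nu)+
      then show ?thesis by (simp only: measure_empty emeasure_empty ennreal_0)
    qed
  qed
  ultimately show "emeasure (distr \<nu> borel clock) {y<..} = emeasure (density lborel (indicator {0..clock T})) {y<..}"
    by simp
qed auto

text \<open>The two sets differ only by a plateau of the clock following \<open>r\<close>, and a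
  plateau carries no mass.\<close>

lemma AE_clock_greater:
  assumes r: "r \<in> {0..T}"
  shows "AE s in \<nu>. indicator {r<..T} s = (indicator {clock r<..clock T} (clock s) :: real)"
proof -
  let ?B = "{s\<in>space \<nu>. clock r < clock s}"
  have B: "?B \<in> sets \<nu>" by measurable
  have sub: "?B \<subseteq> {r<..T}"
  proof
    fix s assume "s \<in> ?B"
    then show "s \<in> {r<..T}" using clock_mono[of s r] by (cases "s \<le> r") (auto simp: space_nu)
  qed
  have "measure \<nu> ({r<..T} - ?B) = measure \<nu> {r<..T} - measure \<nu> ?B"
    using r B sub by (intro finite_measure_Diff) auto
  also have "\<dots> = 0"
    using r clock_diff[of r T] measure_clock_greater[OF clock_nonneg clock_mono[of r T]] by simp
  finally have "{r<..T} - ?B \<in> null_sets \<nu>"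
    using r B by (auto simp: null_sets_def emeasure_eq_measure)
  then have "AE s in \<nu>. s \<notin> {r<..T} - ?B" by (rule AE_not_in)
  then show ?thesis
    using AE_space
  proof eventually_elim
    case (elim s)
    then show ?case
      using sub clock_mono[of s T] by (auto simp: space_nu split: split_indicator)
  qed
qed

text \<open>Substitution of the clock value for the time by \<open>distr_clock\<close>, then the
  fundamental theorem of calculus.\<close>

lemma integral_exp_clock_end:
  assumes r: "r \<in> {0..T}" and c: "c \<noteq> 0"
  shows "(LINT s:{r<..T}|\<nu>. exp (c * clock s)) = (exp (c * clock T) - exp (c * clock r)) / c"
proof -
  let ?a = "clock r" and ?b = "clock T"
  have ab: "0 \<le> ?a" "?a \<le> ?b" using r clock_mono[of r T] clock_nonneg by auto
  have "(LINT s:{r<..T}|\<nu>. exp (c * clock s)) = (LINT s|\<nu>. indicator {?a<..?b} (clock s) * exp (c * clock s))"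
    unfolding set_lebesgue_integral_def
    by (intro integral_cong_AE) (use AE_clock_greater[OF r] r in auto)
  also have "\<dots> = (LINT y|distr \<nu> borel clock. indicator {?a<..?b} y * exp (c * y))"
    by (subst integral_distr) auto
  also have "\<dots> = (LINT y|lborel. indicator {0..?b} y * (indicator {?a<..?b} y * exp (c * y)))"
    unfolding distr_clock
    by (subst integral_density[where g="indicator {0..?b}", unfolded ennreal_indicator]) auto
  also have "\<dots> = (LINT y|lborel. exp (c * y) * indicator {?a..?b} y)"
    by (intro integral_cong_AE) (use AE_lborel_singleton[of ?a] ab in \<open>auto split: split_indicator elim!: eventually_mono\<close>)
  also have "\<dots> = exp (c * ?b) / c - exp (c * ?a) / c"
    using c by (intro has_bochner_integral_integral_eq has_bochner_integral_FTC_Icc_real ab)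
       (auto intro!: derivative_eq_intros)
  finally show ?thesis by (simp add: diff_divide_distrib)
qed

section \<open>Integrals of bounded functions and of exponentials of the clock\<close>

lemma set_integrable_bounded:
  assumes "f \<in> borel_measurable \<nu>" "\<And>s. s \<in> J \<Longrightarrow> s \<in> {0..T} \<Longrightarrow> \<bar>f s\<bar> \<le> K" "J \<in> sets \<nu>"
  shows "set_integrable \<nu> J (f :: real \<Rightarrow> real)"
  unfolding set_integrable_def
proof (rule integrable_const_bound[where B="\<bar>K\<bar>"])
  have "norm (indicator J s *\<^sub>R f s) \<le> \<bar>K\<bar>" if "s \<in> space \<nu>" for s
    using assms(2)[of s] that by (cases "s \<in> J") (auto simp: space_nu)
  then show "AE s in \<nu>. norm (indicator J s *\<^sub>R f s) \<le> \<bar>K\<bar>" by (rule AE_I2)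
qed (use assms in measurable)

lemma clock_bounds: "s \<in> {0..T} \<Longrightarrow> 0 \<le> clock s \<and> clock s \<le> clock T"
  using clock_mono[of s T] clock_nonneg by auto

lemma exp_clock_bound: "s \<in> {0..T} \<Longrightarrow> \<bar>exp (c * clock s)\<bar> \<le> exp (\<bar>c\<bar> * clock T)"
  using clock_bounds[of s] mult_mono[of c "\<bar>c\<bar>" "clock s" "clock T"] by auto

lemma set_integrable_exp_clock: "J \<in> sets \<nu> \<Longrightarrow> set_integrable \<nu> J (\<lambda>s. exp (c * clock s))"
  by (rule set_integrable_bounded[OF _ exp_clock_bound]) auto

lemma integral_exp_clock:
  assumes r: "0 \<le> r" "r \<le> t" "t \<le> T" and c: "c \<noteq> 0"
  shows "(LINT s:{r<..t}|\<nu>. exp (c * clock s)) = (exp (c * clock t) - exp (c * clock r)) / c"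
proof -
  have "{r<..T} = {r<..t} \<union> {t<..T}" using r by auto
  then have "(LINT s:{r<..T}|\<nu>. exp (c * clock s))
      = (LINT s:{r<..t}|\<nu>. exp (c * clock s)) + (LINT s:{t<..T}|\<nu>. exp (c * clock s))"
    using r by (simp, intro set_integral_Un set_integrable_exp_clock) auto
  then show ?thesis
    using integral_exp_clock_end[of r c] integral_exp_clock_end[of t c] r c by (simp add: field_simps)
qed

text \<open>The variation-of-constants formula for the backward equation \<open>\<phi>' = \<phi> - \<gamma>\<close>
  driven by \<open>\<nu>\<close>.\<close>

definition discounted :: "real \<Rightarrow> (real \<Rightarrow> real) \<Rightarrow> real \<Rightarrow> real" where
  "discounted C \<gamma> r = exp (clock r - clock T) * C + (LINT s:{r<..T}|\<nu>. exp (clock r - clock s) * \<gamma> s)"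

context
  fixes \<gamma> :: "real \<Rightarrow> real" and K :: real
  assumes meas [measurable]: "\<gamma> \<in> borel_measurable \<nu>"
    and bd: "\<And>s. s \<in> {0..T} \<Longrightarrow> \<bar>\<gamma> s\<bar> \<le> K"
begin

text \<open>The integrated form of the backward equation for \<open>discounted\<close>. It follows
  from Fubini on the triangle \<open>r < s < q\<close>: for fixed \<open>q\<close>, the integral of
  \<open>exp (clock s - clock q)\<close> over \<open>s\<close> is
  \<open>1 - exp (clock r - clock q)\<close>, which splits off exactly the integral term of
  \<open>discounted\<close> at \<open>r\<close>.\<close>

lemma discounted_eq:
  assumes r: "r \<in> {0..T}"
  shows "(LINT s:{r<..T}|\<nu>. discounted C \<gamma> s) = C + (LINT s:{r<..T}|\<nu>. \<gamma> s) - discounted C \<gamma> r"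
    and "set_integrable \<nu> {r<..T} (discounted C \<gamma>)"
proof -
  interpret P: pair_sigma_finite \<nu> \<nu> by unfold_locales
  interpret PF: finite_measure "\<nu> \<Otimes>\<^sub>M \<nu>"
    by (rule finite_measure_pair_measure) unfold_locales
  have J [measurable]: "{r<..T} \<in> sets \<nu>" using r by auto
  let ?h = "\<lambda>s q. (if r < s \<and> s < q then exp (clock s - clock q) * \<gamma> q else 0)"
  have f1 [measurable]: "fst \<in> borel_measurable (\<nu> \<Otimes>\<^sub>M \<nu>)" and f2 [measurable]: "snd \<in> borel_measurable (\<nu> \<Otimes>\<^sub>M \<nu>)"
    using measurable_compose[OF measurable_fst id_nu] measurable_compose[OF measurable_snd id_nu] by auto
  have [measurable]: "(\<lambda>z. ?h (fst z) (snd z)) \<in> borel_measurable (\<nu> \<Otimes>\<^sub>M \<nu>)"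
    by measurable
  have hb: "\<bar>?h s q\<bar> \<le> K" if "s \<in> {0..T}" "q \<in> {0..T}" for s q
  proof -
    have "r < s \<and> s < q \<Longrightarrow> exp (clock s - clock q) \<le> 1" using clock_mono[of s q] by auto
    then have "r < s \<and> s < q \<Longrightarrow> exp (clock s - clock q) * \<bar>\<gamma> q\<bar> \<le> 1 * K"
      using bd[OF that(2)] by (intro mult_mono) auto
    moreover have "0 \<le> K" using bd[OF that(2)] by linarith
    ultimately show ?thesis by (auto simp: abs_mult)
  qed
  have hi: "integrable (\<nu> \<Otimes>\<^sub>M \<nu>) (\<lambda>(s, q). ?h s q)"
  proof (rule PF.integrable_const_bound[where B=K])
    show "AE z in \<nu> \<Otimes>\<^sub>M \<nu>. norm (case z of (s, q) \<Rightarrow> ?h s q) \<le> K"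
      by (rule AE_I2) (simp only: space_pair_measure space_nu case_prod_beta mem_Times_iff real_norm_def hb)
  qed (simp add: case_prod_beta)
  have inner1: "(LINT q|\<nu>. ?h s q) = indicator {r<..T} s *\<^sub>R (LINT q:{s<..T}|\<nu>. exp (clock s - clock q) * \<gamma> q)"
    if "s \<in> space \<nu>" for s
  proof (cases "r < s")
    case True
    then have "(LINT q|\<nu>. ?h s q) = (LINT q:{s<..T}|\<nu>. exp (clock s - clock q) * \<gamma> q)"
      unfolding set_lebesgue_integral_def
      by (intro Bochner_Integration.integral_cong) (auto simp: space_nu split: split_indicator)
    then show ?thesis using True that by (simp add: space_nu)
  qed simp
  have AEq: "AE s in \<nu>. s \<noteq> q" if "q \<in> space \<nu>" for q
  proof (rule AE_I[of _ _ "{q}"])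
    show "{q} \<in> sets \<nu>" using that by (auto simp: space_nu sets_nu sets_restrict_space_iff)
  qed (use that null_singleton in \<open>auto simp: space_nu\<close>)
  have inner2: "(LINT s|\<nu>. ?h s q) = indicator {r<..T} q *\<^sub>R (\<gamma> q - exp (clock r - clock q) * \<gamma> q)"
    if q: "q \<in> space \<nu>" for q
  proof (cases "r < q")
    case True
    have "(LINT s|\<nu>. ?h s q) = (LINT s|\<nu>. (exp (- clock q) * \<gamma> q) * (indicator {r<..q} s *\<^sub>R exp (1 * clock s)))"
    proof (rule integral_cong_AE)
      show "AE s in \<nu>. ?h s q = (exp (- clock q) * \<gamma> q) * (indicator {r<..q} s *\<^sub>R exp (1 * clock s))"
        \<comment> \<open>The triangle excludes the diagonal, while the half-open interval contains
          its right end; the single point \<open>q\<close> is null.\<close>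
        using AEq[OF q] by eventually_elim (auto simp: exp_diff exp_minus field_simps split: split_indicator)
      show "(\<lambda>s. ?h s q) \<in> borel_measurable \<nu>" by measurable
      have "{r<..q} \<in> sets \<nu>" using r q by (auto simp: space_nu)
      then show "(\<lambda>s. (exp (- clock q) * \<gamma> q) * (indicator {r<..q} s *\<^sub>R exp (1 * clock s))) \<in> borel_measurable \<nu>"
        by measurable
    qed
    also have "\<dots> = exp (- clock q) * \<gamma> q * (exp (clock q) - exp (clock r))"
      using integral_exp_clock[of r q 1] True r q
      by (simp add: set_lebesgue_integral_def space_nu)
    also have "\<dots> = \<gamma> q - exp (clock r - clock q) * \<gamma> q"
      by (simp add: exp_diff exp_minus field_simps)
    finally show ?thesis using True q by (simp add: space_nu)
  next
    case False
    then have "(\<lambda>s. ?h s q) = (\<lambda>_. 0)" by auto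
    then show ?thesis using False by simp
  qed
  have i\<gamma>: "set_integrable \<nu> {r<..T} \<gamma>"
    by (rule set_integrable_bounded[OF meas bd J])
  have ie: "set_integrable \<nu> {r<..T} (\<lambda>q. exp (clock r - clock q) * \<gamma> q)"
  proof (rule set_integrable_bounded[OF _ _ J])
    fix q assume q: "q \<in> {r<..T}" "q \<in> {0..T}"
    have "exp (clock r - clock q) * \<bar>\<gamma> q\<bar> \<le> 1 * K"
      using bd[OF q(2)] q clock_mono[of r q] by (intro mult_mono) auto
    then show "\<bar>exp (clock r - clock q) * \<gamma> q\<bar> \<le> K" by (simp add: abs_mult)
  qed measurable
  have ec: "set_integrable \<nu> {r<..T} (\<lambda>s. exp (clock s - clock T) * C)"
    unfolding exp_diff using set_integrable_mult_left[OF set_integrable_exp_clock[OF J, of 1], of "C / exp (clock T)"]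
    by simp
  have i1: "set_integrable \<nu> {r<..T} (\<lambda>s. LINT q:{s<..T}|\<nu>. exp (clock s - clock q) * \<gamma> q)"
    unfolding set_integrable_def
    using P.integrable_fst'[OF hi] by (rule Bochner_Integration.integrable_cong[THEN iffD1, rotated 2]) (auto simp: inner1)
  show "set_integrable \<nu> {r<..T} (discounted C \<gamma>)"
    unfolding discounted_def[abs_def] by (rule set_integral_add(1)[OF ec i1])
  have "(LINT s:{r<..T}|\<nu>. discounted C \<gamma> s)
      = (LINT s:{r<..T}|\<nu>. exp (clock s - clock T) * C) + (LINT s:{r<..T}|\<nu>. (LINT q:{s<..T}|\<nu>. exp (clock s - clock q) * \<gamma> q))"
    unfolding discounted_def by (rule set_integral_add(2)[OF ec i1])
  also have "(LINT s:{r<..T}|\<nu>. exp (clock s - clock T) * C) = (exp (clock T) - exp (clock r)) * (C / exp (clock T))"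
    using integral_exp_clock[of r T 1] r by (simp add: exp_diff)
  also have "\<dots> = C - exp (clock r - clock T) * C"
    by (simp add: exp_diff field_simps)
  also have "(LINT s:{r<..T}|\<nu>. (LINT q:{s<..T}|\<nu>. exp (clock s - clock q) * \<gamma> q)) = (LINT s|\<nu>. LINT q|\<nu>. ?h s q)"
    unfolding set_lebesgue_integral_def[of \<nu> "{r<..T}"] by (intro Bochner_Integration.integral_cong) (auto simp: inner1)
  also have "\<dots> = (LINT q|\<nu>. LINT s|\<nu>. ?h s q)"
    using P.Fubini_integral[of ?h, OF hi] by simp
  also have "\<dots> = (LINT q:{r<..T}|\<nu>. \<gamma> q - exp (clock r - clock q) * \<gamma> q)"
    unfolding set_lebesgue_integral_def by (intro Bochner_Integration.integral_cong) (auto simp: inner2)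
  also have "\<dots> = (LINT q:{r<..T}|\<nu>. \<gamma> q) - (LINT q:{r<..T}|\<nu>. exp (clock r - clock q) * \<gamma> q)"
    by (rule set_integral_diff(2)[OF i\<gamma> ie])
  finally show "(LINT s:{r<..T}|\<nu>. discounted C \<gamma> s) = C + (LINT s:{r<..T}|\<nu>. \<gamma> s) - discounted C \<gamma> r"
    by (simp add: discounted_def)
qed

end

end

section \<open>The linear backward equation\<close>

locale markov_time_measure = markov_time_space T d M F X P + time_measure T \<nu>
  for T :: real and d :: "('s::{metric_space, second_countable_topology}) pm"
    and M :: "'o measure" and F :: "real \<Rightarrow> 'o measure"
    and X :: "real \<Rightarrow> 'o \<Rightarrow> 's" and P :: "real \<Rightarrow> 's \<Rightarrow> 'o measure"
    and \<nu> :: "real measure"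
begin

section \<open>Comparison of means\<close>

lemma mean_le:
  assumes "bounded_slices K H" "s \<in> {0..T}" "fst p \<in> {0..T}" "\<And>y. H (s, y) \<le> c"
  shows "mean H s p \<le> c"
proof -
  interpret Q: prob_space "P (fst p) (snd p)" by (rule P_prob) fact
  show ?thesis
    unfolding mean_def using assms by (intro Q.integral_le_const mean_integrable) auto
qed

lemma mean_mono:
  assumes "bounded_slices K H" "bounded_slices K' G" "s \<in> {0..T}" "fst p \<in> {0..T}"
    and "\<And>y. H (s, y) \<le> G (s, y)"
  shows "mean H s p \<le> mean G s p"
  unfolding mean_def using assms by (intro integral_mono mean_integrable) auto

lemma mean_diff:
  assumes "bounded_slices K H" "bounded_slices K' G" "s \<in> {0..T}" "fst p \<in> {0..T}"
  shows "mean (\<lambda>z. H z - G z) s p = mean H s p - mean G s p"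
  unfolding mean_def using assms by (intro Bochner_Integration.integral_diff mean_integrable) auto

lemma mean_deterministic:
  assumes "fst p \<in> {0..T}" "\<And>y. H (s, y) = c"
  shows "mean H s p = c"
proof -
  interpret Q: prob_space "P (fst p) (snd p)" by (rule P_prob) fact
  show ?thesis by (simp add: mean_def assms(2) Q.prob_space)
qed

lemma bounded_slices_diff:
  "bounded_slices K H \<Longrightarrow> bounded_slices K' G \<Longrightarrow> bounded_slices (K + K') (\<lambda>z. H z - G z)"
  unfolding bounded_slices_def
proof (intro conjI ballI)
  fix p :: "real \<times> 's" assume "p \<in> TS"
    and "(\<forall>s\<in>{0..T}. (\<lambda>y. H (s, y)) \<in> borel_measurable borel) \<and> (\<forall>p\<in>TS. \<bar>H p\<bar> \<le> K)"
    and "(\<forall>s\<in>{0..T}. (\<lambda>y. G (s, y)) \<in> borel_measurable borel) \<and> (\<forall>p\<in>TS. \<bar>G p\<bar> \<le> K')"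
  then have "\<bar>H p\<bar> \<le> K" "\<bar>G p\<bar> \<le> K'" by blast+
  then show "\<bar>H p - G p\<bar> \<le> K + K'" by linarith
qed (simp add: borel_measurable_diff)

lemma mean_abs_diff_le:
  assumes "bounded_slices K H" "bounded_slices K' G" "s \<in> {0..T}" "fst p \<in> {0..T}"
    and "\<And>y. \<bar>H (s, y) - G (s, y)\<bar> \<le> c"
  shows "\<bar>mean H s p - mean G s p\<bar> \<le> c"
proof -
  interpret Q: prob_space "P (fst p) (snd p)" by (rule P_prob) fact
  have "\<bar>mean (\<lambda>z. H z - G z) s p\<bar> \<le> (\<integral>\<omega>. \<bar>H (s, X s \<omega>) - G (s, X s \<omega>)\<bar> \<partial>P (fst p) (snd p))"
    unfolding mean_def by (rule integral_abs_bound)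
  also have "\<dots> \<le> c"
    using assms by (intro Q.integral_le_const integrable_abs mean_integrable[OF bounded_slices_diff[OF assms(1,2)]]) auto
  finally show ?thesis using mean_diff[OF assms(1-4)] by simp
qed

text \<open>The mean is cut off up to the starting time because joint measurability is available
  only strictly after it. Integrals over \<open>{r<..T}\<close> do not see the cut-off, and no case
  distinction is needed inside them.\<close>

definition fmean :: "(real \<times> 's \<Rightarrow> real) \<Rightarrow> real \<times> 's \<Rightarrow> real \<Rightarrow> real" where
  "fmean H p s = (if fst p < s then mean H s p else 0)"

lemma sets_BTS_nu: "sets (BTS \<Otimes>\<^sub>M \<nu>) = sets (BTS \<Otimes>\<^sub>M BT)"
  by (rule sets_pair_measure_cong[OF refl sets_nu])

lemma fmean_jointly_measurable:
  "bounded_measurable K H \<Longrightarrow> (\<lambda>z. fmean H (fst z) (snd z)) \<in> borel_measurable (BTS \<Otimes>\<^sub>M \<nu>)"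
  unfolding fmean_def using mean_jointly_measurable measurable_cong_sets[OF sets_BTS_nu refl] by auto

lemma fmean_measurable:
  assumes "bounded_measurable K H" "p \<in> TS"
  shows "fmean H p \<in> borel_measurable \<nu>"
proof -
  have "(\<lambda>s. (p, s)) \<in> \<nu> \<rightarrow>\<^sub>M BTS \<Otimes>\<^sub>M \<nu>" using assms(2) by (intro measurable_Pair1') simp
  from measurable_compose[OF this fmean_jointly_measurable[OF assms(1)]] show ?thesis by simp
qed

lemma fmean_bound:
  assumes "bounded_measurable K H" "p \<in> TS" "s \<in> {0..T}"
  shows "\<bar>fmean H p s\<bar> \<le> K"
  using mean_bound[OF bounded_measurable_slices[OF assms(1)] assms(3), of p] bounded_slicesD(2)[OF bounded_measurable_slices[OF assms(1)]] assms(2)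
  by (auto simp: fmean_def)

lemma set_integrable_fmean:
  assumes "bounded_measurable K H" "p \<in> TS" "J \<in> sets \<nu>" "k \<in> borel_measurable \<nu>"
    and "\<And>s. s \<in> J \<Longrightarrow> s \<in> {0..T} \<Longrightarrow> \<bar>k s\<bar> \<le> L"
  shows "set_integrable \<nu> J (\<lambda>s. k s * fmean H p s)"
proof (rule set_integrable_bounded[OF _ _ assms(3)])
  show "(\<lambda>s. k s * fmean H p s) \<in> borel_measurable \<nu>"
    using assms(4) fmean_measurable[OF assms(1,2)] by measurable
  show "\<bar>k s * fmean H p s\<bar> \<le> L * K" if "s \<in> J" "s \<in> {0..T}" for s
    unfolding abs_mult using assms(5)[OF that] fmean_bound[OF assms(1,2) that(2)]
    by (intro mult_mono) (auto intro: order_trans[OF abs_ge_zero])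
qed

lemma set_integrable_fmean1:
  assumes "bounded_measurable K H" "p \<in> TS" "J \<in> sets \<nu>"
  shows "set_integrable \<nu> J (fmean H p)"
  using set_integrable_fmean[OF assms, of "\<lambda>_. 1" 1] by simp

text \<open>After Fubini, the inner expectation is a mean of means, which \<open>mean_markov\<close>
  collapses to the mean from the earlier start \<open>(r, x)\<close>.\<close>

lemma mean_fmean_integral:
  assumes bm: "bounded_measurable K H" and r: "r \<in> {0..T}" and s: "s \<in> {r..T}"
    and k [measurable]: "k \<in> borel_measurable \<nu>" and kb: "\<And>q. q \<in> {0..T} \<Longrightarrow> q > s \<Longrightarrow> \<bar>k q\<bar> \<le> L"
  shows "(\<integral>\<omega>. (LINT q:{s<..T}|\<nu>. k q * fmean H (s, X s \<omega>) q) \<partial>P r x)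
       = (LINT q:{s<..T}|\<nu>. k q * fmean H (r, x) q)" (is ?eq)
    and "integrable (P r x) (\<lambda>\<omega>. LINT q:{s<..T}|\<nu>. k q * fmean H (s, X s \<omega>) q)"
proof -
  interpret Q: prob_space "P r x" by (rule P_prob) fact
  interpret PP: pair_sigma_finite "P r x" \<nu> by unfold_locales
  interpret PF: finite_measure "P r x \<Otimes>\<^sub>M \<nu>"
    by (rule finite_measure_pair_measure) unfold_locales
  have sT: "s \<in> {0..T}" using r s by auto
  have J [measurable]: "{s<..T} \<in> sets \<nu>" using sT by auto
  have "(\<lambda>\<omega>. (s, X s \<omega>)) \<in> P r x \<rightarrow>\<^sub>M BTS"
    using sT X_measurable_P[OF sT r] by (intro pair_measurable_BTS) auto
  then have "(\<lambda>z. ((s, X s (fst z)), snd z)) \<in> P r x \<Otimes>\<^sub>M \<nu> \<rightarrow>\<^sub>M BTS \<Otimes>\<^sub>M \<nu>"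
    by (intro measurable_Pair measurable_snd measurable_compose[OF measurable_fst])
  from measurable_compose[OF this fmean_jointly_measurable[OF bm]]
  have [measurable]: "(\<lambda>z. fmean H (s, X s (fst z)) (snd z)) \<in> borel_measurable (P r x \<Otimes>\<^sub>M \<nu>)" by simp
  let ?h = "\<lambda>\<omega> q. indicator {s<..T} q *\<^sub>R (k q * fmean H (s, X s \<omega>) q)"
  have hi: "integrable (P r x \<Otimes>\<^sub>M \<nu>) (\<lambda>(\<omega>, q). ?h \<omega> q)"
  proof (rule PF.integrable_const_bound[where B="\<bar>L\<bar> * K"])
    show "AE z in P r x \<Otimes>\<^sub>M \<nu>. norm (case z of (\<omega>, q) \<Rightarrow> ?h \<omega> q) \<le> \<bar>L\<bar> * K"
    proof (rule AE_I2)
      fix z assume z: "z \<in> space (P r x \<Otimes>\<^sub>M \<nu>)"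
      then have q: "snd z \<in> {0..T}" by (auto simp: space_pair_measure space_nu)
      have f: "\<bar>fmean H (s, X s (fst z)) (snd z)\<bar> \<le> K" using sT by (intro fmean_bound[OF bm _ q]) auto
      have "snd z > s \<Longrightarrow> \<bar>k (snd z)\<bar> * \<bar>fmean H (s, X s (fst z)) (snd z)\<bar> \<le> \<bar>L\<bar> * K"
        using kb[OF q] f by (intro mult_mono) auto
      moreover have "0 \<le> \<bar>L\<bar> * K" using f by (intro mult_nonneg_nonneg) auto
      ultimately show "norm (case z of (\<omega>, q) \<Rightarrow> ?h \<omega> q) \<le> \<bar>L\<bar> * K"
        by (cases z) (auto simp: abs_mult split: split_indicator)
    qed
    show "(\<lambda>(\<omega>, q). ?h \<omega> q) \<in> borel_measurable (P r x \<Otimes>\<^sub>M \<nu>)"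
      unfolding case_prod_beta by measurable
  qed
  have inner: "(\<integral>\<omega>. ?h \<omega> q \<partial>P r x) = indicator {s<..T} q *\<^sub>R (k q * fmean H (r, x) q)" if "q \<in> space \<nu>" for q
  proof (cases "s < q")
    case True
    have "q \<in> {s..T}" using True that by (auto simp: space_nu)
    then have "(\<integral>\<omega>. mean H q (s, X s \<omega>) \<partial>P r x) = mean H q (r, x)"
      by (rule mean_markov[OF bounded_measurable_slices[OF bm] r s])
    then show ?thesis
      using True s by (simp add: fmean_def)
  qed simp
  have "(\<integral>\<omega>. (LINT q|\<nu>. ?h \<omega> q) \<partial>P r x) = (LINT q|\<nu>. (\<integral>\<omega>. ?h \<omega> q \<partial>P r x))"
    by (rule PP.Fubini_integral[of ?h, OF hi, symmetric])
  also have "\<dots> = (LINT q|\<nu>. indicator {s<..T} q *\<^sub>R (k q * fmean H (r, x) q))"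
    by (intro Bochner_Integration.integral_cong refl inner)
  finally show ?eq
    unfolding set_lebesgue_integral_def .
  show "integrable (P r x) (\<lambda>\<omega>. LINT q:{s<..T}|\<nu>. k q * fmean H (s, X s \<omega>) q)"
    using PP.integrable_fst'[OF hi] by (simp add: set_lebesgue_integral_def)
qed

text \<open>Fubini, made possible by progressive measurability. From here on the path of the process
  can be replaced by the deterministic function of its means.\<close>

lemma path_integral:
  assumes bm: "bounded_measurable K H" and r: "0 \<le> r" "r \<le> t" "t \<le> T"
  shows "(\<integral>\<omega>. (LINT q:{r<..t}|\<nu>. H (q, X q \<omega>)) \<partial>P r x) = (LINT q:{r<..t}|\<nu>. fmean H (r, x) q)" (is ?eq)
    and "integrable (P r x) (\<lambda>\<omega>. LINT q:{r<..t}|\<nu>. H (q, X q \<omega>))"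
proof -
  have rT: "r \<in> {0..T}" using r by auto
  interpret Q: prob_space "P r x" by (rule P_prob) fact
  interpret PP: pair_sigma_finite "P r x" \<nu> by unfold_locales
  interpret PF: finite_measure "P r x \<Otimes>\<^sub>M \<nu>"
    by (rule finite_measure_pair_measure) unfold_locales
  have J [measurable]: "{r<..t} \<in> sets \<nu>" using r by auto
  have sets_eq: "sets (BT \<Otimes>\<^sub>M M) = sets (\<nu> \<Otimes>\<^sub>M P r x)"
    by (intro sets_pair_measure_cong) (simp_all add: sets_nu sets_P[OF rT])
  have "(\<lambda>z. (fst z, X (fst z) (snd z))) \<in> \<nu> \<Otimes>\<^sub>M P r x \<rightarrow>\<^sub>M BTS"
    using path_measurable measurable_cong_sets[OF sets_eq refl] by blast
  from measurable_compose[OF measurable_pair_swap' measurable_compose[OF this, of H borel]]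
  have [measurable]: "(\<lambda>z. H (snd z, X (snd z) (fst z))) \<in> borel_measurable (P r x \<Otimes>\<^sub>M \<nu>)"
    using bm by (auto simp: bounded_measurable_def case_prod_beta)
  let ?h = "\<lambda>\<omega> q. indicator {r<..t} q *\<^sub>R H (q, X q \<omega>)"
  have hi: "integrable (P r x \<Otimes>\<^sub>M \<nu>) (\<lambda>(\<omega>, q). ?h \<omega> q)"
  proof (rule PF.integrable_const_bound[where B=K])
    show "AE z in P r x \<Otimes>\<^sub>M \<nu>. norm (case z of (\<omega>, q) \<Rightarrow> ?h \<omega> q) \<le> K"
    proof (rule AE_I2)
      fix z assume z: "z \<in> space (P r x \<Otimes>\<^sub>M \<nu>)"
      then have q: "snd z \<in> {0..T}" by (auto simp: space_pair_measure space_nu)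
      show "norm (case z of (\<omega>, q) \<Rightarrow> ?h \<omega> q) \<le> K"
        using bounded_slicesD(1)[OF bounded_measurable_slices[OF bm] q] bounded_slicesD(2)[OF bounded_measurable_slices[OF bm]]
        by (cases z) (auto split: split_indicator)
    qed
    show "(\<lambda>(\<omega>, q). ?h \<omega> q) \<in> borel_measurable (P r x \<Otimes>\<^sub>M \<nu>)"
      unfolding case_prod_beta by measurable
  qed
  have inner: "(\<integral>\<omega>. ?h \<omega> q \<partial>P r x) = indicator {r<..t} q *\<^sub>R fmean H (r, x) q" if "q \<in> space \<nu>" for q
    by (auto simp: fmean_def mean_def split: split_indicator)
  have "(\<integral>\<omega>. (LINT q|\<nu>. ?h \<omega> q) \<partial>P r x) = (LINT q|\<nu>. (\<integral>\<omega>. ?h \<omega> q \<partial>P r x))"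
    by (rule PP.Fubini_integral[of ?h, OF hi, symmetric])
  also have "\<dots> = (LINT q|\<nu>. indicator {r<..t} q *\<^sub>R fmean H (r, x) q)"
    by (intro Bochner_Integration.integral_cong refl inner)
  finally show ?eq
    unfolding set_lebesgue_integral_def .
  show "integrable (P r x) (\<lambda>\<omega>. LINT q:{r<..t}|\<nu>. H (q, X q \<omega>))"
    using PP.integrable_fst'[OF hi] by (simp add: set_lebesgue_integral_def)
qed

section \<open>The solution operator of the linear equation\<close>

definition lin :: "(real \<times> 's \<Rightarrow> real) \<Rightarrow> (real \<times> 's \<Rightarrow> real) \<Rightarrow> real \<times> 's \<Rightarrow> real" where
  "lin g H p = discounted (mean g T p) (fmean H p) (fst p)"

lemma lin_alt:
  "lin g H p = exp (clock (fst p) - clock T) * mean g T p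
     + (LINT s:{fst p<..T}|\<nu>. exp (clock (fst p) - clock s) * fmean H p s)"
  by (simp add: lin_def discounted_def)

lemma T_mem: "T \<in> {0..T}" "0 \<in> {0..T}" using T_pos by auto

lemma exp_clock_le_1: "r \<le> s \<Longrightarrow> \<bar>exp (clock r - clock s)\<bar> \<le> 1"
  using clock_mono by auto

lemma set_integrable_exp_fmean:
  assumes "bounded_measurable K H" "p \<in> TS"
  shows "set_integrable \<nu> {fst p<..T} (\<lambda>s. exp (clock (fst p) - clock s) * fmean H p s)"
proof (rule set_integrable_fmean[OF assms])
  show "{fst p<..T} \<in> sets \<nu>" using assms(2) by auto
  show "\<bar>exp (clock (fst p) - clock s)\<bar> \<le> 1" if "s \<in> {fst p<..T}" for s
    using that by (intro exp_clock_le_1) simp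
qed measurable

lemma measure_bound_integral:
  assumes r: "r \<in> {0..T}" and f: "set_integrable \<nu> {r<..T} f" and b: "\<And>s. s \<in> {r<..T} \<Longrightarrow> \<bar>f s\<bar> \<le> K"
    and "0 \<le> K"
  shows "\<bar>LINT s:{r<..T}|\<nu>. f s\<bar> \<le> K * clock T"
proof -
  have J: "{r<..T} \<in> sets \<nu>" using r by auto
  have i: "set_integrable \<nu> {r<..T} (\<lambda>s. K)"
    by (rule set_integrable_bounded[OF _ _ J, of _ "\<bar>K\<bar>"]) auto
  have "\<bar>LINT s:{r<..T}|\<nu>. f s\<bar> \<le> (LINT s:{r<..T}|\<nu>. \<bar>f s\<bar>)"
    using set_integral_norm_bound[OF f] by simp
  also have "\<dots> \<le> (LINT s:{r<..T}|\<nu>. K)"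
    by (intro set_integral_mono i b set_integrable_abs f)
  also have "\<dots> = K * (clock T - clock r)"
    using r by (simp add: set_lebesgue_integral_def clock_diff)
  also have "\<dots> \<le> K * clock T" using clock_nonneg[of r] \<open>0 \<le> K\<close> by (intro mult_left_mono) auto
  finally show ?thesis .
qed

context
  fixes g H :: "real \<times> 's \<Rightarrow> real" and C K :: real
  assumes bg: "bounded_slices C g" and bH: "bounded_measurable K H"
begin

lemma lin_bound:
  assumes p: "p \<in> TS"
  shows "\<bar>lin g H p\<bar> \<le> C + K * clock T"
proof -
  have pT: "fst p \<in> {0..T}" using p by auto
  have "\<bar>exp (clock (fst p) - clock T) * mean g T p\<bar> \<le> 1 * C"
    unfolding abs_mult using mean_bound[OF bg T_mem(1) pT] exp_clock_le_1[of "fst p" T] pT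
    by (intro mult_mono) auto
  moreover have "\<bar>LINT s:{fst p<..T}|\<nu>. exp (clock (fst p) - clock s) * fmean H p s\<bar> \<le> K * clock T"
  proof (rule measure_bound_integral[OF pT set_integrable_exp_fmean[OF bH p]])
    fix s assume s: "s \<in> {fst p<..T}"
    have "\<bar>exp (clock (fst p) - clock s) * fmean H p s\<bar> \<le> 1 * K"
      unfolding abs_mult using s pT exp_clock_le_1[of "fst p" s] fmean_bound[OF bH p, of s]
      by (intro mult_mono) auto
    then show "\<bar>exp (clock (fst p) - clock s) * fmean H p s\<bar> \<le> K" by simp
  qed (rule bounded_slicesD(2)[OF bounded_measurable_slices[OF bH]])
  ultimately show ?thesis unfolding lin_alt by linarith
qed

lemma lin_measurable: "lin g H \<in> borel_measurable BTS"
proof -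
  have [measurable]: "(\<lambda>p. clock (fst p)) \<in> borel_measurable BTS"
    by (rule measurable_compose[OF pm_continuous_measurable[OF time_continuous] clock_borel])
  have [measurable]: "mean g T \<in> borel_measurable BTS"
    by (rule mean_measurable_slab[OF bg T_mem(1)])
  have [measurable]: "(\<lambda>z. fmean H (fst z) (snd z)) \<in> borel_measurable (BTS \<Otimes>\<^sub>M \<nu>)"
    by (rule fmean_jointly_measurable[OF bH])
  have [measurable]: "(\<lambda>z. fst (fst z)) \<in> borel_measurable (BTS \<Otimes>\<^sub>M \<nu>)"
    "snd \<in> borel_measurable (BTS \<Otimes>\<^sub>M \<nu>)"
    using measurable_compose[OF measurable_fst pm_continuous_measurable[OF time_continuous]]
      measurable_compose[OF measurable_snd id_nu] by auto
  \<comment> \<open>The domain of integration moves with \<open>p\<close>. Writing it as a cut-off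
    of the integrand gives a function on a fixed product space, to which measurability of parameter
    integrals applies.\<close>
  have "(\<lambda>z. if fst (fst z) < snd z \<and> snd z \<le> T then exp (clock (fst (fst z)) - clock (snd z)) * fmean H (fst z) (snd z) else 0)
      \<in> borel_measurable (BTS \<Otimes>\<^sub>M \<nu>)" by measurable
  then have "(\<lambda>p. LINT s|\<nu>. (if fst p < s \<and> s \<le> T then exp (clock (fst p) - clock s) * fmean H p s else 0)) \<in> borel_measurable BTS"
    by (intro borel_measurable_lebesgue_integral) (simp add: case_prod_beta)
  moreover have "(LINT s|\<nu>. (if fst p < s \<and> s \<le> T then exp (clock (fst p) - clock s) * fmean H p s else 0))
      = (LINT s:{fst p<..T}|\<nu>. exp (clock (fst p) - clock s) * fmean H p s)" for p
    unfolding set_lebesgue_integral_def by (intro Bochner_Integration.integral_cong) auto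
  ultimately show ?thesis
    unfolding lin_alt[abs_def] by simp
qed

lemma lin_bounded_measurable: "bounded_measurable (C + K * clock T) (lin g H)"
  unfolding bounded_measurable_def using lin_measurable lin_bound by auto

lemma lin_consistent: "pm_consistent TS d (lin g H)"
  unfolding pm_consistent_def
proof (intro ballI impI)
  fix p q assume p: "p \<in> TS" and q: "q \<in> TS" and 0: "d p q = 0"
  have t: "fst p = fst q" by (rule d_zero_time[OF p q 0])
  have m: "mean G s p = mean G s q" if "bounded_slices K' G" "s \<in> {0..T}" "fst p \<le> s" for G K' s
    using that p q t by (intro mean_consistent[OF that(1,2) _ _ 0]) (auto simp: mem_Times_iff)
  have "(LINT s:{fst p<..T}|\<nu>. exp (clock (fst p) - clock s) * fmean H p s)
      = (LINT s:{fst p<..T}|\<nu>. exp (clock (fst p) - clock s) * fmean H q s)"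
  proof (rule set_lebesgue_integral_cong)
    show "{fst p<..T} \<in> sets \<nu>" using p by auto
    show "\<forall>s. s \<in> {fst p<..T} \<longrightarrow> exp (clock (fst p) - clock s) * fmean H p s = exp (clock (fst p) - clock s) * fmean H q s"
      using p t m[OF bounded_measurable_slices[OF bH]] by (auto simp: fmean_def)
  qed
  then show "lin g H p = lin g H q"
    unfolding lin_alt using m[OF bg T_mem(1)] p by (simp add: t mem_Times_iff)
qed

text \<open>Averaging over the position at time \<open>s\<close> leaves the data of
  \<open>discounted\<close> in place, namely the means seen from \<open>(r, x)\<close>, and only
  advances the time. For each fixed start the linear problem thereby becomes an equation in time
  alone.\<close>

lemma mean_lin:
  assumes r: "r \<in> {0..T}" and s: "s \<in> {r..T}"
  shows "mean (lin g H) s (r, x) = discounted (mean g T (r, x)) (fmean H (r, x)) s"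
proof -
  interpret Q: prob_space "P r x" by (rule P_prob) fact
  have sT: "s \<in> {0..T}" using r s by auto
  have TT: "T \<in> {s..T}" using sT by auto
  have i1: "integrable (P r x) (\<lambda>\<omega>. mean g T (s, X s \<omega>))"
  proof (rule Q.integrable_const_bound[where B=C])
    show "AE \<omega> in P r x. norm (mean g T (s, X s \<omega>)) \<le> C"
      using mean_bound[OF bg T_mem(1)] sT by auto
    show "(\<lambda>\<omega>. mean g T (s, X s \<omega>)) \<in> borel_measurable (P r x)"
      using sT by (intro measurable_compose[OF X_measurable_P[OF sT r] mean_measurable_state[OF bg T_mem(1)]]) auto
  qed
  have k: "(\<lambda>q. exp (clock s - clock q)) \<in> borel_measurable \<nu>" by measurable
  have kb: "\<bar>exp (clock s - clock q)\<bar> \<le> 1" if "q > s" for q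
    using that by (intro exp_clock_le_1) simp
  have F: "(\<integral>\<omega>. (LINT q:{s<..T}|\<nu>. exp (clock s - clock q) * fmean H (s, X s \<omega>) q) \<partial>P r x)
       = (LINT q:{s<..T}|\<nu>. exp (clock s - clock q) * fmean H (r, x) q)"
    "integrable (P r x) (\<lambda>\<omega>. LINT q:{s<..T}|\<nu>. exp (clock s - clock q) * fmean H (s, X s \<omega>) q)"
    by (rule mean_fmean_integral[OF bH r s k, of 1], rule kb, assumption)+
  have "mean (lin g H) s (r, x) = exp (clock s - clock T) * (\<integral>\<omega>. mean g T (s, X s \<omega>) \<partial>P r x)
     + (\<integral>\<omega>. (LINT q:{s<..T}|\<nu>. exp (clock s - clock q) * fmean H (s, X s \<omega>) q) \<partial>P r x)"
    unfolding mean_def[of "lin g H"] lin_alt fst_conv snd_conv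
    using i1 F(2) by simp
  also have "\<dots> = discounted (mean g T (r, x)) (fmean H (r, x)) s"
    unfolding discounted_def F(1) mean_markov[OF bg r s TT] ..
  finally show ?thesis .
qed

text \<open>By \<open>mean_lin\<close> the means of \<open>lin g H\<close> form a
  \<open>discounted\<close> function, so \<open>discounted_eq\<close> applies. The result is the
  equation with driver \<open>u - H\<close>: a source \<open>H = u - h(u)\<close> will make the
  extra \<open>u\<close> cancel.\<close>

lemma lin_eq:
  assumes r: "r \<in> {0..T}"
  shows "lin g H (r, x) = mean g T (r, x) + (LINT s:{r<..T}|\<nu>. fmean H (r, x) s)
            - (LINT s:{r<..T}|\<nu>. fmean (lin g H) (r, x) s)"
proof -
  have p: "(r, x) \<in> TS" using r by auto
  have J: "{r<..T} \<in> sets \<nu>" using r by auto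
  have "(LINT s:{r<..T}|\<nu>. fmean (lin g H) (r, x) s)
      = (LINT s:{r<..T}|\<nu>. discounted (mean g T (r, x)) (fmean H (r, x)) s)"
    by (rule set_lebesgue_integral_cong[OF J]) (auto simp: fmean_def mean_lin[OF r])
  also have "\<dots> = mean g T (r, x) + (LINT s:{r<..T}|\<nu>. fmean H (r, x) s) - lin g H (r, x)"
    unfolding lin_def fst_conv
    by (rule discounted_eq(1)[OF fmean_measurable[OF bH p] fmean_bound[OF bH p] r])
  finally show ?thesis by simp
qed

end

text \<open>The rate 4 is chosen so that the integral of the weight after \<open>r\<close> is at
  most a quarter of its value at \<open>r\<close>. For a source that is 2-Lipschitz in the solution
  this leaves the contraction factor \<open>2 / 4 = 1 / 2\<close>.\<close>

definition weight :: "real \<Rightarrow> real" where "weight s = exp (4 * (clock T - clock s))"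

lemma weight_ge_1: "s \<le> T \<Longrightarrow> 1 \<le> weight s"
  using clock_mono by (simp add: weight_def)

lemma weight_alt: "weight s = exp (4 * clock T) * exp (-4 * clock s)"
  by (simp add: weight_def flip: exp_add)

lemma weight_le: "s \<in> {0..T} \<Longrightarrow> weight s \<le> exp (4 * clock T)"
  using clock_nonneg by (simp add: weight_def)

lemma set_integrable_weight: "J \<in> sets \<nu> \<Longrightarrow> set_integrable \<nu> J weight"
  unfolding weight_alt[abs_def] by (intro set_integrable_mult_right set_integrable_exp_clock)

lemma weight_integral:
  assumes r: "r \<in> {0..T}"
  shows "(LINT s:{r<..T}|\<nu>. weight s) \<le> weight r / 4"
proof -
  have "(LINT s:{r<..T}|\<nu>. weight s) = exp (4 * clock T) * (LINT s:{r<..T}|\<nu>. exp (-4 * clock s))"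
    unfolding weight_alt by (rule set_integral_mult_right)
  also have "\<dots> = exp (4 * clock T) * ((exp (-4 * clock r) - exp (-4 * clock T)) / 4)"
    by (subst integral_exp_clock) (use r in \<open>auto simp: diff_divide_distrib\<close>)
  also have "\<dots> = (weight r - 1) / 4"
    by (simp add: weight_alt right_diff_distrib flip: exp_add)
  finally show ?thesis by simp
qed

lemma integral_weight_bound:
  assumes r: "r \<in> {0..T}" and f: "set_integrable \<nu> {r<..T} f"
    and b: "\<And>s. s \<in> {r<..T} \<Longrightarrow> \<bar>f s\<bar> \<le> N * weight s" and N: "0 \<le> N"
  shows "\<bar>LINT s:{r<..T}|\<nu>. f s\<bar> \<le> N / 4 * weight r"
proof -
  have J: "{r<..T} \<in> sets \<nu>" using r by auto
  have "\<bar>LINT s:{r<..T}|\<nu>. f s\<bar> \<le> (LINT s:{r<..T}|\<nu>. \<bar>f s\<bar>)"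
    using set_integral_norm_bound[OF f] by simp
  also have "\<dots> \<le> (LINT s:{r<..T}|\<nu>. N * weight s)"
    by (intro set_integral_mono b set_integrable_abs f set_integrable_mult_right set_integrable_weight J)
  also have "\<dots> = N * (LINT s:{r<..T}|\<nu>. weight s)"
    by (rule set_integral_mult_right)
  also have "\<dots> \<le> N * (weight r / 4)"
    by (rule mult_left_mono[OF weight_integral[OF r] N])
  finally show ?thesis by simp
qed

text \<open>Each application of the step halves the bound in the weighted norm. Starting from the
  crude bound \<open>B\<close> and iterating forces the function to vanish. The lower time
  \<open>r0\<close> is free so that solutions on smaller intervals can be compared as well.\<close>

lemma gronwall:
  assumes bd: "\<And>r x. r \<in> {r0..T} \<Longrightarrow> \<bar>w (r, x)\<bar> \<le> B"
    and step: "\<And>N r x. \<lbrakk>0 \<le> N; \<And>s y. s \<in> {r0..T} \<Longrightarrow> \<bar>w (s, y)\<bar> \<le> N * weight s; r \<in> {r0..T}\<rbrakk>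
        \<Longrightarrow> \<bar>w (r, x)\<bar> \<le> N / 2 * weight r"
    and r: "r \<in> {r0..T}"
  shows "w (r, x :: 's) = (0::real)"
proof -
  have *: "\<bar>w (r, x)\<bar> \<le> \<bar>B\<bar> * (1/2) ^ n * weight r" if "r \<in> {r0..T}" for n r x
    using that
  proof (induction n arbitrary: r x)
    case 0
    have "\<bar>w (r, x)\<bar> \<le> \<bar>B\<bar> * 1" using bd[OF 0, of x] by simp
    also have "\<dots> \<le> \<bar>B\<bar> * weight r" using weight_ge_1[of r] 0 by (intro mult_left_mono) auto
    finally show ?case by simp
  next
    case (Suc n)
    have "\<bar>w (r, x)\<bar> \<le> (\<bar>B\<bar> * (1/2) ^ n) / 2 * weight r"
      by (rule step) (use Suc in auto)
    then show ?case by simp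
  qed
  have "(\<lambda>n. \<bar>B\<bar> * (1/2) ^ n * weight r) \<longlonglongrightarrow> \<bar>B\<bar> * 0 * weight r"
    by (intro tendsto_intros LIMSEQ_power_zero) auto
  then have "\<bar>w (r, x)\<bar> \<le> \<bar>B\<bar> * 0 * weight r"
    by (rule LIMSEQ_le_const) (use *[OF r] in auto)
  then show ?thesis by simp
qed

text \<open>The factor 2 in the hypothesis anticipates the Lipschitz constant of
  \<open>w - h(w)\<close>; the weight contributes a quarter, and the discount factor is at most
  1.\<close>

lemma lin_contraction:
  assumes bH: "bounded_measurable K H" and bH': "bounded_measurable K' H'"
    and N: "0 \<le> N" and le: "\<And>s y. s \<in> {0..T} \<Longrightarrow> \<bar>H (s, y) - H' (s, y)\<bar> \<le> 2 * N * weight s"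
    and p: "p \<in> TS"
  shows "\<bar>lin g H p - lin g H' p\<bar> \<le> N / 2 * weight (fst p)"
proof -
  have r: "fst p \<in> {0..T}" using p by auto
  let ?f = "\<lambda>G s. exp (clock (fst p) - clock s) * fmean G p s"
  have i: "set_integrable \<nu> {fst p<..T} (?f H)" "set_integrable \<nu> {fst p<..T} (?f H')"
    using set_integrable_exp_fmean[OF bH p] set_integrable_exp_fmean[OF bH' p] .
  have "lin g H p - lin g H' p = (LINT s:{fst p<..T}|\<nu>. ?f H s - ?f H' s)"
    unfolding lin_alt using set_integral_diff(2)[OF i] by simp
  also have "\<bar>\<dots>\<bar> \<le> (2 * N) / 4 * weight (fst p)"
  proof (rule integral_weight_bound[OF r set_integral_diff(1)[OF i]])
    fix s assume s: "s \<in> {fst p<..T}"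
    then have sT: "s \<in> {0..T}" using r by auto
    have "\<bar>mean H s p - mean H' s p\<bar> \<le> 2 * N * weight s"
      by (rule mean_abs_diff_le[OF bounded_measurable_slices[OF bH] bounded_measurable_slices[OF bH'] sT r le[OF sT]])
    then have "\<bar>exp (clock (fst p) - clock s)\<bar> * \<bar>mean H s p - mean H' s p\<bar> \<le> 1 * (2 * N * weight s)"
      using s exp_clock_le_1[of "fst p" s] by (intro mult_mono) auto
    then show "\<bar>?f H s - ?f H' s\<bar> \<le> 2 * N * weight s"
      using s by (simp add: fmean_def abs_mult flip: right_diff_distrib)
  qed (use N in auto)
  finally show ?thesis by simp
qed

text \<open>Both discount factors in \<open>lin_alt\<close> are positive and means preserve order.
  This positivity is what the discounted form of the equation gains over the original one, where the
  driver enters with a minus sign.\<close>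

lemma lin_mono:
  assumes bg: "bounded_slices C g" "bounded_slices C' g'"
    and bH: "bounded_measurable K H" and bH': "bounded_measurable K' H'"
    and g: "\<And>y. g (T, y) \<le> g' (T, y)" and H: "\<And>s y. s \<in> {0..T} \<Longrightarrow> H (s, y) \<le> H' (s, y)"
    and p: "p \<in> TS"
  shows "lin g H p \<le> lin g' H' p"
proof -
  have r: "fst p \<in> {0..T}" using p by auto
  have "(LINT s:{fst p<..T}|\<nu>. exp (clock (fst p) - clock s) * fmean H p s)
      \<le> (LINT s:{fst p<..T}|\<nu>. exp (clock (fst p) - clock s) * fmean H' p s)"
  proof (rule set_integral_mono[OF set_integrable_exp_fmean[OF bH p] set_integrable_exp_fmean[OF bH' p]])
    fix s assume s: "s \<in> {fst p<..T}"
    then have sT: "s \<in> {0..T}" using r by auto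
    have "mean H s p \<le> mean H' s p"
      by (rule mean_mono[OF bounded_measurable_slices[OF bH] bounded_measurable_slices[OF bH'] sT r H[OF sT]])
    then show "exp (clock (fst p) - clock s) * fmean H p s \<le> exp (clock (fst p) - clock s) * fmean H' p s"
      using s by (simp add: fmean_def)
  qed
  moreover have "exp (clock (fst p) - clock T) * mean g T p \<le> exp (clock (fst p) - clock T) * mean g' T p"
    by (intro mult_left_mono mean_mono[OF bg T_mem(1) r g]) auto
  ultimately show ?thesis unfolding lin_alt by linarith
qed

text \<open>The discount factors integrate to one minus the discount at the end. The value is thus a
  convex combination in which the mean of the terminal value keeps a strictly positive share; at a
  finite end of \<open>D\<close> this share is what keeps the solution inside.\<close>

lemma lin_constant:
  assumes H: "\<And>s y. s \<in> {0..T} \<Longrightarrow> H (s, y) = c" and p: "p \<in> TS"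
  shows "lin g H p = exp (clock (fst p) - clock T) * mean g T p + (1 - exp (clock (fst p) - clock T)) * c"
proof -
  have r: "fst p \<in> {0..T}" using p by auto
  have "(LINT s:{fst p<..T}|\<nu>. exp (clock (fst p) - clock s) * fmean H p s)
      = (LINT s:{fst p<..T}|\<nu>. (exp (clock (fst p)) * c) * exp (-1 * clock s))"
  proof (rule set_lebesgue_integral_cong)
    show "\<forall>s. s \<in> {fst p<..T} \<longrightarrow> exp (clock (fst p) - clock s) * fmean H p s = (exp (clock (fst p)) * c) * exp (-1 * clock s)"
    proof (intro allI impI)
      fix s assume s: "s \<in> {fst p<..T}"
      then have sT: "s \<in> {0..T}" using r by auto
      have "mean H s p = c" by (rule mean_deterministic[OF r]) (rule H[OF sT])
      then show "exp (clock (fst p) - clock s) * fmean H p s = (exp (clock (fst p)) * c) * exp (-1 * clock s)"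
        using s by (simp add: fmean_def exp_diff exp_minus field_simps)
    qed
  qed (use r in auto)
  also have "\<dots> = (exp (clock (fst p)) * c) * (LINT s:{fst p<..T}|\<nu>. exp (-1 * clock s))"
    by (rule set_integral_mult_right)
  also have "\<dots> = (exp (clock (fst p)) * c) * (exp (- clock (fst p)) - exp (- clock T))"
    using integral_exp_clock[of "fst p" T "-1"] r by simp
  also have "\<dots> = (1 - exp (clock (fst p) - clock T)) * c"
    by (simp add: exp_diff exp_minus field_simps)
  finally show ?thesis by (simp add: lin_alt)
qed

lemma fmean_abs_le:
  assumes "bounded_measurable K H" "p \<in> TS" "s \<in> {fst p<..T}" "\<And>y. \<bar>H (s, y)\<bar> \<le> c"
  shows "\<bar>fmean H p s\<bar> \<le> c"
proof -
  have "bounded_slices 0 (\<lambda>_. 0)" by (simp add: bounded_slices_def)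
  moreover have "fst p \<in> {0..T}" "s \<in> {0..T}" using assms by auto
  ultimately have "\<bar>mean H s p - mean (\<lambda>_. 0) s p\<bar> \<le> c"
    using assms(4) by (intro mean_abs_diff_le[OF bounded_measurable_slices[OF assms(1)]]) auto
  then show ?thesis using assms(3) by (simp add: fmean_def mean_def)
qed

lemma fmean_diff:
  assumes "bounded_measurable K H" "bounded_measurable K' G" "p \<in> TS" "s \<in> {0..T}"
  shows "fmean (\<lambda>z. H z - G z) p s = fmean H p s - fmean G p s"
proof -
  have "fst p \<in> {0..T}" using assms by auto
  then show ?thesis
    using mean_diff[OF bounded_measurable_slices[OF assms(1)] bounded_measurable_slices[OF assms(2)] assms(4)]
    by (simp add: fmean_def)
qed

lemma bounded_measurable_diff:
  assumes "bounded_measurable K H" "bounded_measurable K' G"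
  shows "bounded_measurable (K + K') (\<lambda>z. H z - G z)"
  unfolding bounded_measurable_def
proof (intro conjI ballI)
  fix p :: "real \<times> 's" assume "p \<in> TS"
  then have "\<bar>H p\<bar> \<le> K" "\<bar>G p\<bar> \<le> K'" using assms by (auto simp: bounded_measurable_def)
  then show "\<bar>H p - G p\<bar> \<le> K + K'" by linarith
qed (use assms in \<open>simp add: bounded_measurable_def borel_measurable_diff\<close>)

text \<open>The difference of two solutions solves the homogeneous equation, to which
  \<open>gronwall\<close> applies. The lemma serves to recognise \<open>grow\<close> as
  \<open>lin\<close> of an explicit source without computing the integral in
  \<open>lin\<close>.\<close>

lemma lin_unique:
  assumes bg: "bounded_slices C g" and bH: "bounded_measurable K H" and bv: "bounded_measurable K' v"
    and eq: "\<And>r x. r \<in> {0..T} \<Longrightarrow> v (r, x) = mean g T (r, x) + (LINT s:{r<..T}|\<nu>. fmean H (r, x) s)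
            - (LINT s:{r<..T}|\<nu>. fmean v (r, x) s)"
    and r: "r \<in> {0..T}"
  shows "v (r, x) = lin g H (r, x)"
proof -
  define w where "w = (\<lambda>z. v z - lin g H z)"
  note bl = lin_bounded_measurable[OF bg bH]
  note bw = bounded_measurable_diff[OF bv bl, folded w_def]
  have "w (r, x) = 0"
  proof (rule gronwall[of 0 w])
    show "\<bar>w (r, x)\<bar> \<le> K' + (C + K * clock T)" if "r \<in> {0..T}" for r x
      using bw that by (auto simp: bounded_measurable_def)
  next
    fix N r and x :: 's
    assume N: "0 \<le> N" and le: "\<And>s y. s \<in> {0..T} \<Longrightarrow> \<bar>w (s, y)\<bar> \<le> N * weight s" and r: "r \<in> {0..T}"
    have p: "(r, x) \<in> TS" and J: "{r<..T} \<in> sets \<nu>" using r by auto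
    have "w (r, x) = (LINT s:{r<..T}|\<nu>. fmean (lin g H) (r, x) s) - (LINT s:{r<..T}|\<nu>. fmean v (r, x) s)"
      unfolding w_def eq[OF r] using lin_eq[OF bg bH r, of x] by simp
    also have "\<dots> = (LINT s:{r<..T}|\<nu>. fmean (lin g H) (r, x) s - fmean v (r, x) s)"
      by (rule set_integral_diff(2)[symmetric, OF set_integrable_fmean1[OF bl p J] set_integrable_fmean1[OF bv p J]])
    also have "\<bar>\<dots>\<bar> \<le> N / 4 * weight r"
    proof (rule integral_weight_bound[OF r set_integral_diff(1)[OF set_integrable_fmean1[OF bl p J] set_integrable_fmean1[OF bv p J]] _ N])
      fix s assume s: "s \<in> {r<..T}"
      then have sT: "s \<in> {0..T}" using r by auto
      have "\<bar>fmean w (r, x) s\<bar> \<le> N * weight s"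
        using s by (intro fmean_abs_le[OF bw p] le sT) auto
      then show "\<bar>fmean (lin g H) (r, x) s - fmean v (r, x) s\<bar> \<le> N * weight s"
        using fmean_diff[OF bv bl p sT] by (simp add: w_def abs_minus_commute)
    qed
    also have "\<dots> \<le> N / 2 * weight r"
      using N weight_ge_1[of r] r by (intro mult_right_mono) auto
    finally show "\<bar>w (r, x)\<bar> \<le> N / 2 * weight r" .
  qed (use r in auto)
  then show ?thesis by (simp add: w_def)
qed

text \<open>The relation restricts the times from which a point may be approached. Always true, it
  gives continuity; with \<open>\<le>\<close> it gives right-continuity. One argument then serves
  the Feller and the right-hand Feller case.\<close>

definition continuous_along :: "(real \<Rightarrow> real \<Rightarrow> bool) \<Rightarrow> real set \<Rightarrow> (real \<times> 's \<Rightarrow> real) \<Rightarrow> bool" where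
  "continuous_along R J u \<longleftrightarrow>
     (\<forall>r\<in>J. \<forall>x. \<forall>\<epsilon>>0. \<exists>\<delta>>0. \<forall>s\<in>J. \<forall>y. R r s \<and> d (s, y) (r, x) < \<delta> \<longrightarrow> \<bar>u (s, y) - u (r, x)\<bar> < \<epsilon>)"

definition feller_along :: "(real \<Rightarrow> real \<Rightarrow> bool) \<Rightarrow> bool" where
  "feller_along R \<longleftrightarrow>
     (\<forall>t\<in>{0..T}. \<forall>\<phi> :: 's \<Rightarrow> real. continuous_on UNIV \<phi> \<and> bounded (range \<phi>) \<longrightarrow>
        continuous_along R {0..t} (\<lambda>(r, x). \<integral>\<omega>. \<phi> (X t \<omega>) \<partial>P r x))"

lemma continuous_along_sequentially:
  assumes u: "continuous_along R J u" and r: "r \<in> J"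
    and ev: "\<forall>\<^sub>F n in sequentially. s n \<in> J" and R: "\<And>n. R r (s n)"
    and lim: "(\<lambda>n. d (s n, y n) (r, x)) \<longlonglongrightarrow> 0"
  shows "(\<lambda>n. u (s n, y n)) \<longlonglongrightarrow> u (r, x)"
proof (rule tendstoI)
  fix \<epsilon> :: real assume "\<epsilon> > 0"
  with u r obtain \<delta> where \<delta>: "\<delta> > 0" "\<And>s y. s \<in> J \<Longrightarrow> R r s \<Longrightarrow> d (s, y) (r, x) < \<delta> \<Longrightarrow> \<bar>u (s, y) - u (r, x)\<bar> < \<epsilon>"
    unfolding continuous_along_def by metis
  have "\<forall>\<^sub>F n in sequentially. d (s n, y n) (r, x) < \<delta>"
    using order_tendstoD(2)[OF lim \<delta>(1)] .
  with ev show "\<forall>\<^sub>F n in sequentially. dist (u (s n, y n)) (u (r, x)) < \<epsilon>"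
    by eventually_elim (simp add: dist_real_def \<delta>(2) R)
qed

text \<open>Failure at some tolerance yields points at distance below \<open>1 / Suc n\<close> that
  violate it. Sequences are wanted because dominated convergence is stated for them.\<close>

lemma continuous_alongI_sequentially:
  assumes "\<And>r x s y. \<lbrakk>r \<in> {0..T}; \<And>n. s n \<in> {0..T}; \<And>n. R r (s n); (\<lambda>n. d (s n, y n) (r, x)) \<longlonglongrightarrow> 0\<rbrakk>
      \<Longrightarrow> (\<lambda>n::nat. u (s n, y n)) \<longlonglongrightarrow> u (r, x)"
  shows "continuous_along R {0..T} u"
  unfolding continuous_along_def
proof (intro ballI allI impI, rule ccontr)
  fix r x and \<epsilon> :: real
  assume r: "r \<in> {0..T}" and \<epsilon>: "\<epsilon> > 0"
    and no: "\<not> (\<exists>\<delta>>0. \<forall>s\<in>{0..T}. \<forall>y. R r s \<and> d (s, y) (r, x) < \<delta> \<longrightarrow> \<bar>u (s, y) - u (r, x)\<bar> < \<epsilon>)"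
  have "\<exists>z. fst z \<in> {0..T} \<and> R r (fst z) \<and> d z (r, x) < 1 / real (Suc n) \<and> \<not> \<bar>u z - u (r, x)\<bar> < \<epsilon>" for n
  proof (rule ccontr)
    assume "\<not> ?thesis"
    then have "\<forall>s\<in>{0..T}. \<forall>y. R r s \<and> d (s, y) (r, x) < 1 / real (Suc n) \<longrightarrow> \<bar>u (s, y) - u (r, x)\<bar> < \<epsilon>"
      by auto
    moreover have "1 / real (Suc n) > 0" by simp
    ultimately show False using no by blast
  qed
  then obtain z where z: "\<And>n. fst (z n) \<in> {0..T}" "\<And>n. R r (fst (z n))" "\<And>n. d (z n) (r, x) < 1 / real (Suc n)"
    "\<And>n. \<not> \<bar>u (z n) - u (r, x)\<bar> < \<epsilon>"
    by metis
  have "(\<lambda>n. d (z n) (r, x)) \<longlonglongrightarrow> 0"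
  proof (rule real_tendsto_sandwich[of "\<lambda>_. 0" _ _ "\<lambda>n. 1 / real (Suc n)"])
    show "\<forall>\<^sub>F n in sequentially. 0 \<le> d (z n) (r, x)"
      using z(1) r by (intro always_eventually allI pseudometric_onD(1)[OF pm]) (auto simp: mem_Times_iff)
    show "\<forall>\<^sub>F n in sequentially. d (z n) (r, x) \<le> 1 / real (Suc n)"
      using z(3) by (intro always_eventually allI less_imp_le)
    show "(\<lambda>n. 1 / real (Suc n)) \<longlonglongrightarrow> 0" by (rule LIMSEQ_Suc[OF lim_1_over_n])
  qed simp
  then have "(\<lambda>n. u (z n)) \<longlonglongrightarrow> u (r, x)"
    using assms[of r "\<lambda>n. fst (z n)" "\<lambda>n. snd (z n)" x] r z(1,2) by simp
  then have "\<forall>\<^sub>F n in sequentially. dist (u (z n)) (u (r, x)) < \<epsilon>"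
    using \<epsilon> by (rule tendstoD)
  then show False
    using z(4) by (auto simp: dist_real_def eventually_sequentially)
qed

lemma mean_continuous_along:
  assumes F: "feller_along R" and bH: "bounded_slices K H" and t: "t \<in> {0..T}"
    and c: "continuous_on UNIV (\<lambda>y. H (t, y))"
  shows "continuous_along R {0..t} (mean H t)"
proof -
  have "bounded (range (\<lambda>y. H (t, y)))"
    using bounded_slicesD(1)[OF bH t] by (auto simp: bounded_iff)
  with F t c have "continuous_along R {0..t} (\<lambda>(r, x). \<integral>\<omega>. H (t, X t \<omega>) \<partial>P r x)"
    unfolding feller_along_def by blast
  then show ?thesis by (simp add: mean_def[abs_def] case_prod_beta')
qed

text \<open>Dominated convergence in the time integral. For \<open>q\<close> before \<open>r\<close>
  the integrand is eventually zero; for \<open>q\<close> after \<open>r\<close> the approaching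
  starts eventually lie before \<open>q\<close>, where the Feller property yields convergence of the
  mean. The one undecided time, \<open>q = r\<close>, is null.\<close>

lemma lin_continuous_along:
  assumes F: "feller_along R" and bg: "bounded_slices C g" and bH: "bounded_measurable K H"
    and g: "continuous_on UNIV (\<lambda>y. g (T, y))"
    and H: "\<And>s. s \<in> {0..T} \<Longrightarrow> continuous_on UNIV (\<lambda>y. H (s, y))"
  shows "continuous_along R {0..T} (lin g H)"
proof (rule continuous_alongI_sequentially)
  fix r and x :: 's and s and y :: "nat \<Rightarrow> 's"
  assume r: "r \<in> {0..T}" and s: "\<And>n. s n \<in> {0..T}" and R: "\<And>n. R r (s n)"
    and lim: "(\<lambda>n. d (s n, y n) (r, x)) \<longlonglongrightarrow> 0"
  note bHs = bounded_measurable_slices[OF bH]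
  \<comment> \<open>Convergence for \<open>d\<close> must first be seen to entail convergence of the
    times, which is continuity of the time coordinate.\<close>
  have "continuous_along (\<lambda>_ _. True) {0..T} fst"
    using time_continuous[unfolded pm_continuous_iff[OF pm]] unfolding continuous_along_def by auto
  from continuous_along_sequentially[OF this r _ _ lim] s have sr: "s \<longlonglongrightarrow> r" by auto
  have cl: "(\<lambda>n. clock (s n)) \<longlonglongrightarrow> clock r"
    using continuous_on_tendsto_compose[OF continuous_clock sr] by auto
  have 1: "(\<lambda>n. mean g T (s n, y n)) \<longlonglongrightarrow> mean g T (r, x)"
    using s by (intro continuous_along_sequentially[OF mean_continuous_along[OF F bg T_mem(1) g] r _ R lim]) auto
  let ?f = "\<lambda>p q. indicator {fst p<..T} q *\<^sub>R (exp (clock (fst p) - clock q) * fmean H p q)"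
  have 2: "(\<lambda>n. LINT q|\<nu>. ?f (s n, y n) q) \<longlonglongrightarrow> (LINT q|\<nu>. ?f (r, x) q)"
  proof (rule integral_dominated_convergence[where w="\<lambda>_. K"])
    have m: "?f p \<in> borel_measurable \<nu>" if "p \<in> TS" for p
      using set_integrable_exp_fmean[OF bH that] unfolding set_integrable_def by (rule borel_measurable_integrable)
    show "?f (r, x) \<in> borel_measurable \<nu>" "?f (s n, y n) \<in> borel_measurable \<nu>" for n
      using m[of "(r, x)"] m[of "(s n, y n)"] r s[of n] by auto
    show "AE q in \<nu>. norm (?f (s n, y n) q) \<le> K" for n
    proof (rule AE_I2)
      fix q assume q: "q \<in> space \<nu>"
      have f: "\<bar>fmean H (s n, y n) q\<bar> \<le> K" using q s[of n] by (intro fmean_bound[OF bH]) (auto simp: space_nu)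
      have "s n < q \<Longrightarrow> \<bar>exp (clock (s n) - clock q)\<bar> * \<bar>fmean H (s n, y n) q\<bar> \<le> 1 * K"
        using f exp_clock_le_1[of "s n" q] by (intro mult_mono) auto
      moreover have "0 \<le> K" using f by linarith
      ultimately show "norm (?f (s n, y n) q) \<le> K"
        by (auto simp: abs_mult split: split_indicator)
    qed
    have "AE q in \<nu>. q \<noteq> r"
    proof (rule AE_I[of _ _ "{r}"])
      show "{r} \<in> sets \<nu>" using r by (auto simp: sets_nu sets_restrict_space_iff)
    qed (use r null_singleton in auto)
    then show "AE q in \<nu>. (\<lambda>n. ?f (s n, y n) q) \<longlonglongrightarrow> ?f (r, x) q"
      using AE_space
    proof eventually_elim
      case (elim q)
      then have q: "q \<in> {0..T}" by (simp add: space_nu)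
      show ?case
      proof (cases "q < r")
        case True
        have "\<forall>\<^sub>F n in sequentially. q < s n" using order_tendstoD(1)[OF sr True] .
        then have "\<forall>\<^sub>F n in sequentially. ?f (s n, y n) q = 0" by eventually_elim simp
        then show ?thesis using True by (simp add: tendsto_eventually)
      next
        case False
        then have rq: "r < q" using elim by simp
        have ev: "\<forall>\<^sub>F n in sequentially. s n < q" using order_tendstoD(2)[OF sr rq] .
        have "(\<lambda>n. mean H q (s n, y n)) \<longlonglongrightarrow> mean H q (r, x)"
        proof (rule continuous_along_sequentially[OF mean_continuous_along[OF F bHs q H[OF q]] _ _ R lim])
          show "\<forall>\<^sub>F n in sequentially. s n \<in> {0..q}" using ev by eventually_elim (use s in \<open>auto intro: less_imp_le\<close>)
        qed (use rq r in auto)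
        then have "(\<lambda>n. exp (clock (s n) - clock q) * mean H q (s n, y n)) \<longlonglongrightarrow> exp (clock r - clock q) * mean H q (r, x)"
          using cl by (intro tendsto_intros)
        moreover have "\<forall>\<^sub>F n in sequentially. exp (clock (s n) - clock q) * mean H q (s n, y n) = ?f (s n, y n) q"
          using ev by eventually_elim (use q in \<open>simp add: fmean_def\<close>)
        ultimately have "(\<lambda>n. ?f (s n, y n) q) \<longlonglongrightarrow> exp (clock r - clock q) * mean H q (r, x)"
          by (rule Lim_transform_eventually)
        then show ?thesis using rq q by (simp add: fmean_def)
      qed
    qed
  qed simp
  have "(\<lambda>n. exp (clock (s n) - clock T) * mean g T (s n, y n) + (LINT q|\<nu>. ?f (s n, y n) q))
      \<longlonglongrightarrow> exp (clock r - clock T) * mean g T (r, x) + (LINT q|\<nu>. ?f (r, x) q)"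
    by (intro tendsto_intros 1 2 cl)
  then show "(\<lambda>n. lin g H (s n, y n)) \<longlonglongrightarrow> lin g H (r, x)"
    by (simp add: lin_alt set_lebesgue_integral_def)
qed

end

section \<open>Lipschitz drivers\<close>

locale lipschitz_driver = markov_time_measure T d M F X P \<nu>
  for T :: real and d :: "('s::{metric_space, second_countable_topology}) pm"
    and M :: "'o measure" and F :: "real \<Rightarrow> 'o measure"
    and X :: "real \<Rightarrow> 'o \<Rightarrow> 's" and P :: "real \<Rightarrow> 's \<Rightarrow> 'o measure"
    and \<nu> :: "real measure" +
  fixes D :: "real set" and h :: "real \<Rightarrow> 's \<Rightarrow> real \<Rightarrow> real" and R :: real
  assumes h_measurable: "(\<lambda>((t, x), w). h t x w) \<in> borel_measurable (BTS \<Otimes>\<^sub>M restrict_space borel D)"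
    and h_bound: "t \<in> {0..T} \<Longrightarrow> w \<in> D \<Longrightarrow> \<bar>w\<bar> \<le> R \<Longrightarrow> \<bar>h t x w\<bar> \<le> 1"
    and h_lipschitz: "t \<in> {0..T} \<Longrightarrow> w \<in> D \<Longrightarrow> \<bar>w\<bar> \<le> R \<Longrightarrow> w' \<in> D \<Longrightarrow> \<bar>w'\<bar> \<le> R \<Longrightarrow>
      \<bar>h t x w - h t x w'\<bar> \<le> \<bar>w - w'\<bar>"
begin

definition hc :: "(real \<times> 's \<Rightarrow> real) \<Rightarrow> real \<times> 's \<Rightarrow> real" where
  "hc u p = h (fst p) (snd p) (u p)"

definition driver_domain :: "(real \<times> 's \<Rightarrow> real) set" where
  "driver_domain = {u. u \<in> borel_measurable BTS \<and> (\<forall>p\<in>TS. u p \<in> D \<and> \<bar>u p\<bar> \<le> R)}"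

lemma driver_domain_bounded: "u \<in> driver_domain \<Longrightarrow> bounded_measurable R u"
  by (simp add: driver_domain_def bounded_measurable_def)

lemma hc_bounded_measurable:
  assumes u: "u \<in> driver_domain"
  shows "bounded_measurable 1 (hc u)"
  unfolding bounded_measurable_def
proof (intro conjI ballI)
  have "u \<in> BTS \<rightarrow>\<^sub>M restrict_space borel D"
    using u by (intro measurable_restrict_space2) (auto simp: driver_domain_def)
  then have "(\<lambda>p. (p, u p)) \<in> BTS \<rightarrow>\<^sub>M BTS \<Otimes>\<^sub>M restrict_space borel D"
    by (intro measurable_Pair) auto
  from measurable_compose[OF this h_measurable]
  show "hc u \<in> borel_measurable BTS"
    by (simp add: case_prod_beta hc_def[abs_def])
  show "\<bar>hc u p\<bar> \<le> 1" if "p \<in> TS" for p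
    using u that by (cases p) (auto simp: driver_domain_def hc_def intro!: h_bound)
qed

lemma hc_lipschitz:
  assumes "u \<in> driver_domain" "v \<in> driver_domain" "p \<in> TS"
  shows "\<bar>hc u p - hc v p\<bar> \<le> \<bar>u p - v p\<bar>"
  using assms by (cases p) (auto simp: driver_domain_def hc_def intro!: h_lipschitz)

text \<open>The common term \<open>c\<close> cancels in the difference, and the Lipschitz bound on
  the driver produces the step required by \<open>gronwall\<close>. Only times from
  \<open>r0\<close> on enter, because the equation at \<open>r\<close> looks only at later
  times.\<close>

lemma backward_equation_unique:
  assumes u: "u \<in> driver_domain" and v: "v \<in> driver_domain" and r0: "0 \<le> r0"
    and equ: "\<And>r x. r \<in> {r0..T} \<Longrightarrow> u (r, x) = c (r, x) - (LINT s:{r<..T}|\<nu>. fmean (hc u) (r, x) s)"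
    and eqv: "\<And>r x. r \<in> {r0..T} \<Longrightarrow> v (r, x) = c (r, x) - (LINT s:{r<..T}|\<nu>. fmean (hc v) (r, x) s)"
    and r: "r \<in> {r0..T}"
  shows "u (r, x) = v (r, x)"
proof -
  define w where "w = (\<lambda>z. u z - v z)"
  note bu = hc_bounded_measurable[OF u] and bv = hc_bounded_measurable[OF v]
  note bw = bounded_measurable_diff[OF bu bv]
  have "w (r, x) = 0"
  proof (rule gronwall[of r0 w])
    show "\<bar>w (r, x)\<bar> \<le> R + R" if "r \<in> {r0..T}" for r x
      using bounded_measurable_diff[OF driver_domain_bounded[OF u] driver_domain_bounded[OF v]] that r0
      by (auto simp: bounded_measurable_def w_def)
  next
    fix N r and x :: 's
    assume N: "0 \<le> N" and le: "\<And>s y. s \<in> {r0..T} \<Longrightarrow> \<bar>w (s, y)\<bar> \<le> N * weight s" and r: "r \<in> {r0..T}"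
    have rT: "r \<in> {0..T}" and p: "(r, x) \<in> TS" and J: "{r<..T} \<in> sets \<nu>" using r r0 by auto
    note iu = set_integrable_fmean1[OF bu p J] and iv = set_integrable_fmean1[OF bv p J]
    have "w (r, x) = (LINT s:{r<..T}|\<nu>. fmean (hc v) (r, x) s) - (LINT s:{r<..T}|\<nu>. fmean (hc u) (r, x) s)"
      unfolding w_def equ[OF r] eqv[OF r] by simp
    also have "\<dots> = (LINT s:{r<..T}|\<nu>. fmean (hc v) (r, x) s - fmean (hc u) (r, x) s)"
      by (rule set_integral_diff(2)[symmetric, OF iv iu])
    also have "\<bar>\<dots>\<bar> \<le> N / 4 * weight r"
    proof (rule integral_weight_bound[OF rT set_integral_diff(1)[OF iv iu] _ N])
      fix s assume s: "s \<in> {r<..T}"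
      then have sT: "s \<in> {0..T}" "s \<in> {r0..T}" using r r0 by auto
      have "\<bar>hc u (s, y) - hc v (s, y)\<bar> \<le> N * weight s" for y
        using hc_lipschitz[OF u v, of "(s, y)"] le[OF sT(2), of y] sT by (simp add: w_def)
      then have "\<bar>fmean (\<lambda>z. hc u z - hc v z) (r, x) s\<bar> \<le> N * weight s"
        using s by (intro fmean_abs_le[OF bw p]) auto
      then show "\<bar>fmean (hc v) (r, x) s - fmean (hc u) (r, x) s\<bar> \<le> N * weight s"
        using fmean_diff[OF bu bv p sT(1)] by (simp add: abs_minus_commute)
    qed
    also have "\<dots> \<le> N / 2 * weight r"
      using N weight_ge_1[of r] r by (intro mult_right_mono) auto
    finally show "\<bar>w (r, x)\<bar> \<le> N / 2 * weight r" .
  qed (use r in auto)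
  then show ?thesis by (simp add: w_def)
qed

end

text \<open>The conditions form a closed circle: values between \<open>\<alpha>\<close> and
  \<open>\<beta>\<close> give sources between \<open>lo\<close> and \<open>hi\<close>, and the
  linear solutions with these sources stay between \<open>\<alpha>\<close> and
  \<open>\<beta>\<close> and inside \<open>D\<close>. The four functions are left abstract because
  their choice depends on which ends of \<open>D\<close> are finite, whereas the iteration does
  not.\<close>

locale driver_band = lipschitz_driver T d M F X P \<nu> D h R
  for T :: real and d :: "('s::{metric_space, second_countable_topology}) pm"
    and M :: "'o measure" and F :: "real \<Rightarrow> 'o measure"
    and X :: "real \<Rightarrow> 'o \<Rightarrow> 's" and P :: "real \<Rightarrow> 's \<Rightarrow> 'o measure"
    and \<nu> :: "real measure" and D h R +
  fixes g :: "'s \<Rightarrow> real" and \<alpha> \<beta> lo hi :: "real \<Rightarrow> real" and C L :: real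
  assumes D_interval: "is_interval D"
    and g_slices: "bounded_slices C (\<lambda>p. g (snd p))"
    and band: "s \<in> {0..T} \<Longrightarrow> - R \<le> \<alpha> s" "s \<in> {0..T} \<Longrightarrow> \<beta> s \<le> R"
    and lo_bounded: "bounded_measurable L (\<lambda>p. lo (fst p))"
    and hi_bounded: "bounded_measurable L (\<lambda>p. hi (fst p))"
    and lo_le_hi: "s \<in> {0..T} \<Longrightarrow> lo s \<le> hi s"
    and step_lo: "s \<in> {0..T} \<Longrightarrow> w \<in> D \<Longrightarrow> \<alpha> s \<le> w \<Longrightarrow> w \<le> \<beta> s \<Longrightarrow> lo s \<le> w - h s x w"
    and step_hi: "s \<in> {0..T} \<Longrightarrow> w \<in> D \<Longrightarrow> \<alpha> s \<le> w \<Longrightarrow> w \<le> \<beta> s \<Longrightarrow> w - h s x w \<le> hi s"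
    and lin_lo: "p \<in> TS \<Longrightarrow> \<alpha> (fst p) \<le> lin (\<lambda>p. g (snd p)) (\<lambda>p. lo (fst p)) p \<and>
                            lin (\<lambda>p. g (snd p)) (\<lambda>p. lo (fst p)) p \<in> D"
    and lin_hi: "p \<in> TS \<Longrightarrow> lin (\<lambda>p. g (snd p)) (\<lambda>p. hi (fst p)) p \<le> \<beta> (fst p) \<and>
                            lin (\<lambda>p. g (snd p)) (\<lambda>p. hi (fst p)) p \<in> D"
begin

abbreviation g' :: "real \<times> 's \<Rightarrow> real" where "g' \<equiv> \<lambda>p. g (snd p)"
abbreviation lb :: "real \<times> 's \<Rightarrow> real" where "lb \<equiv> lin g' (\<lambda>p. lo (fst p))"
abbreviation ub :: "real \<times> 's \<Rightarrow> real" where "ub \<equiv> lin g' (\<lambda>p. hi (fst p))"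

definition between :: "(real \<times> 's \<Rightarrow> real) set" where
  "between = {u. u \<in> borel_measurable BTS \<and> (\<forall>p\<in>TS. lb p \<le> u p \<and> u p \<le> ub p)}"

lemma betweenD:
  assumes u: "u \<in> between" and p: "p \<in> TS"
  shows "u p \<in> D" "\<alpha> (fst p) \<le> u p" "u p \<le> \<beta> (fst p)" "\<bar>u p\<bar> \<le> R"
proof -
  have le: "lb p \<le> u p" "u p \<le> ub p" using assms by (auto simp: between_def)
  show "u p \<in> D"
    using D_interval lin_lo[OF p] lin_hi[OF p] le by (meson mem_is_interval_1_I)
  show *: "\<alpha> (fst p) \<le> u p" "u p \<le> \<beta> (fst p)" using le lin_lo[OF p] lin_hi[OF p] by linarith+
  have "fst p \<in> {0..T}" using p by auto
  then show "\<bar>u p\<bar> \<le> R" using * band[of "fst p"] by linarith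
qed

lemma between_driver: "u \<in> between \<Longrightarrow> u \<in> driver_domain"
  using betweenD by (simp add: driver_domain_def between_def)

text \<open>Since \<open>h\<close> is 1-Lipschitz, \<open>w - h s x w\<close> is nondecreasing in \<open>w\<close>; this makes the
  band between \<open>lb\<close> and \<open>ub\<close> invariant.\<close>

definition picard :: "(real \<times> 's \<Rightarrow> real) \<Rightarrow> real \<times> 's \<Rightarrow> real" where
  "picard u = lin g' (\<lambda>p. u p - hc u p)"

lemma picard_source_bounded: "u \<in> between \<Longrightarrow> bounded_measurable (R + 1) (\<lambda>p. u p - hc u p)"
  by (intro bounded_measurable_diff driver_domain_bounded hc_bounded_measurable between_driver)

text \<open>While \<open>u\<close> lies in the band, the step conditions confine its source between
  \<open>lo\<close> and \<open>hi\<close>, and monotonicity of \<open>lin\<close> does the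
  rest.\<close>

lemma picard_between:
  assumes u: "u \<in> between"
  shows "picard u \<in> between"
proof -
  note b = picard_source_bounded[OF u]
  have src: "lo s \<le> u (s, y) - hc u (s, y)" "u (s, y) - hc u (s, y) \<le> hi s" if s: "s \<in> {0..T}" for s y
    using betweenD[OF u, of "(s, y)"] s step_lo[OF s] step_hi[OF s] by (auto simp: hc_def)
  have "lb p \<le> picard u p" "picard u p \<le> ub p" if "p \<in> TS" for p
    unfolding picard_def using src that
    by (auto intro!: lin_mono[OF g_slices g_slices lo_bounded b] lin_mono[OF g_slices g_slices b hi_bounded])
  moreover have "picard u \<in> borel_measurable BTS"
    unfolding picard_def by (rule lin_measurable[OF g_slices b])
  ultimately show ?thesis by (simp add: between_def)
qed

lemma lb_between: "lb \<in> between"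
  unfolding between_def using lin_measurable[OF g_slices lo_bounded] lo_le_hi
  by (auto intro!: lin_mono[OF g_slices g_slices lo_bounded hi_bounded])

lemma picard_contraction:
  assumes u: "u \<in> between" and v: "v \<in> between" and N: "0 \<le> N"
    and le: "\<And>p. p \<in> TS \<Longrightarrow> \<bar>u p - v p\<bar> \<le> N * weight (fst p)" and p: "p \<in> TS"
  shows "\<bar>picard u p - picard v p\<bar> \<le> N / 2 * weight (fst p)"
  unfolding picard_def
proof (rule lin_contraction[OF picard_source_bounded[OF u] picard_source_bounded[OF v] N _ p])
  fix s and y :: 's assume "s \<in> {0..T}"
  then have "(s, y) \<in> TS" by auto
  from le[OF this] hc_lipschitz[OF between_driver[OF u] between_driver[OF v] this]
  show "\<bar>u (s, y) - hc u (s, y) - (v (s, y) - hc v (s, y))\<bar> \<le> 2 * N * weight s"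
    by simp
qed

section \<open>Picard iteration and its limit\<close>

definition iter :: "nat \<Rightarrow> real \<times> 's \<Rightarrow> real" where "iter n = (picard ^^ n) lb"

lemma iter_Suc: "iter (Suc n) = picard (iter n)" by (simp add: iter_def)

lemma iter_between: "iter n \<in> between"
  by (induction n) (simp_all add: iter_def lb_between picard_between)

lemma R_nonneg: "0 \<le> R"
  using betweenD(4)[OF lb_between, of "(0, undefined)"] T_pos by auto

lemma iter_step: "p \<in> TS \<Longrightarrow> \<bar>iter (Suc n) p - iter n p\<bar> \<le> 2 * R * (1/2) ^ n * weight (fst p)"
proof (induction n arbitrary: p)
  case 0
  have "\<bar>iter 1 p\<bar> \<le> R" "\<bar>iter 0 p\<bar> \<le> R"
    by (intro betweenD(4)[OF iter_between 0])+
  then have "\<bar>iter (Suc 0) p - iter 0 p\<bar> \<le> 2 * R * 1" by simp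
  also have "\<dots> \<le> 2 * R * weight (fst p)"
    using 0 R_nonneg weight_ge_1[of "fst p"] by (intro mult_left_mono) auto
  finally show ?case by simp
next
  case (Suc n)
  have "\<bar>picard (iter (Suc n)) p - picard (iter n) p\<bar> \<le> (2 * R * (1/2) ^ n) / 2 * weight (fst p)"
    using R_nonneg by (intro picard_contraction iter_between Suc) auto
  then show ?case by (simp add: iter_Suc)
qed

text \<open>The first step is at most \<open>2 * R\<close>, later steps halve, and the weight is at
  most \<open>exp (4 * clock T)\<close>. Summing the geometric series from step \<open>n\<close> on
  doubles the leading constant and leaves \<open>rate * (1/2) ^ n\<close>.\<close>

definition rate :: real where "rate = 4 * R * exp (4 * clock T)"

lemma rate_nonneg: "0 \<le> rate" using R_nonneg by (simp add: rate_def)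

lemma iter_close: "p \<in> TS \<Longrightarrow> \<bar>iter (n + k) p - iter n p\<bar> \<le> rate * ((1/2) ^ n - (1/2) ^ (n + k))"
proof (induction k)
  case (Suc k)
  have "\<bar>iter (Suc (n + k)) p - iter (n + k) p\<bar> \<le> 2 * R * (1/2) ^ (n + k) * weight (fst p)"
    by (rule iter_step[OF Suc.prems])
  also have "\<dots> \<le> 2 * R * (1/2) ^ (n + k) * exp (4 * clock T)"
    using Suc.prems R_nonneg by (intro mult_left_mono weight_le) auto
  also have "\<dots> = rate * ((1/2) ^ (n + k) - (1/2) ^ (n + Suc k))" by (simp add: rate_def)
  finally have "\<bar>iter (Suc (n + k)) p - iter (n + k) p\<bar> \<le> rate * ((1/2) ^ (n + k) - (1/2) ^ (n + Suc k))" .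
  moreover have "\<bar>iter (n + k) p - iter n p\<bar> \<le> rate * ((1/2) ^ n - (1/2) ^ (n + k))"
    by (rule Suc.IH[OF Suc.prems])
  ultimately have "\<bar>iter (n + Suc k) p - iter n p\<bar>
      \<le> rate * ((1/2) ^ (n + k) - (1/2) ^ (n + Suc k)) + rate * ((1/2) ^ n - (1/2) ^ (n + k))"
    unfolding add_Suc_right by linarith
  also have "\<dots> = rate * ((1/2) ^ n - (1/2) ^ (n + Suc k))" by (simp only: right_diff_distrib)
  finally show ?case .
qed simp

lemma iter_close': "p \<in> TS \<Longrightarrow> n \<le> m \<Longrightarrow> \<bar>iter m p - iter n p\<bar> \<le> rate * (1/2) ^ n"
proof -
  assume p: "p \<in> TS" and nm: "n \<le> m"
  have "\<bar>iter (n + (m - n)) p - iter n p\<bar> \<le> rate * ((1/2) ^ n - (1/2) ^ (n + (m - n)))"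
    by (rule iter_close[OF p])
  also have "\<dots> \<le> rate * (1/2) ^ n"
    using rate_nonneg by (intro mult_left_mono) auto
  finally show ?thesis using nm by simp
qed

lemma rate_LIMSEQ: "(\<lambda>n. rate * (1/2) ^ n) \<longlonglongrightarrow> 0"
  using tendsto_mult[OF tendsto_const LIMSEQ_power_zero[of "1/2 :: real"], of rate] by simp

definition sol :: "real \<times> 's \<Rightarrow> real" where "sol p = lim (\<lambda>n. iter n p)"

lemma iter_LIMSEQ:
  assumes p: "p \<in> TS"
  shows "(\<lambda>n. iter n p) \<longlonglongrightarrow> sol p"
proof -
  have "Cauchy (\<lambda>n. iter n p)"
  proof (rule CauchyI')
    fix \<epsilon> :: real assume "\<epsilon> > 0"
    then have "\<forall>\<^sub>F n in sequentially. rate * (1/2) ^ n < \<epsilon>"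
      by (rule order_tendstoD(2)[OF rate_LIMSEQ])
    then obtain N where N: "\<And>n. n \<ge> N \<Longrightarrow> rate * (1/2) ^ n < \<epsilon>"
      by (auto simp: eventually_sequentially)
    show "\<exists>N. \<forall>m\<ge>N. \<forall>n>m. dist (iter m p) (iter n p) < \<epsilon>"
    proof (intro exI allI impI)
      fix m n assume "m \<ge> N" "n > m"
      then have "\<bar>iter n p - iter m p\<bar> \<le> rate * (1/2) ^ m" by (intro iter_close' p) simp
      with N[OF \<open>m \<ge> N\<close>] show "dist (iter m p) (iter n p) < \<epsilon>" by (simp add: dist_real_def abs_minus_commute)
    qed
  qed
  then show ?thesis
    unfolding sol_def by (simp add: Cauchy_convergent_iff convergent_LIMSEQ_iff)
qed

lemma sol_close:
  assumes p: "p \<in> TS"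
  shows "\<bar>sol p - iter n p\<bar> \<le> rate * (1/2) ^ n"
proof (rule LIMSEQ_le_const2)
  show "(\<lambda>m. \<bar>iter m p - iter n p\<bar>) \<longlonglongrightarrow> \<bar>sol p - iter n p\<bar>"
    by (intro tendsto_intros iter_LIMSEQ p)
  show "\<exists>N. \<forall>m\<ge>N. \<bar>iter m p - iter n p\<bar> \<le> rate * (1/2) ^ n"
    using iter_close'[OF p] by blast
qed

text \<open>\<open>D\<close> need not be closed, so membership of the limit in \<open>D\<close>
  cannot be read off the iterates. The non-strict bounds \<open>lb\<close> and \<open>ub\<close> do
  pass to the limit, and they take values in the interval \<open>D\<close>.\<close>

lemma sol_between: "sol \<in> between"
proof -
  have "lb p \<le> sol p" "sol p \<le> ub p" if p: "p \<in> TS" for p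
  proof -
    have "lb p \<le> iter n p \<and> iter n p \<le> ub p" for n
      using iter_between[of n] p unfolding between_def by blast
    then show "lb p \<le> sol p" "sol p \<le> ub p"
      by (auto intro: LIMSEQ_le_const[OF iter_LIMSEQ[OF p]] LIMSEQ_le_const2[OF iter_LIMSEQ[OF p]])
  qed
  moreover have "sol \<in> borel_measurable BTS"
  proof (rule borel_measurable_LIMSEQ_real)
    show "\<And>p. p \<in> space BTS \<Longrightarrow> (\<lambda>n. iter n p) \<longlonglongrightarrow> sol p" using iter_LIMSEQ by simp
    show "\<And>n. iter n \<in> borel_measurable BTS" using iter_between by (simp add: between_def)
  qed
  ultimately show ?thesis by (simp add: between_def)
qed

lemma sol_picard:
  assumes p: "p \<in> TS"
  shows "picard sol p = sol p"
proof -
  have "\<bar>picard sol p - sol p\<bar> \<le> rate * (1/2) ^ n * (weight (fst p) + 1)" for n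
  proof -
    have nn: "0 \<le> rate * (1/2) ^ n" using rate_nonneg by simp
    have "\<bar>picard sol p - picard (iter n) p\<bar> \<le> (rate * (1/2) ^ n) / 2 * weight (fst p)"
    proof (rule picard_contraction[OF sol_between iter_between nn _ p])
      fix q assume q: "q \<in> TS"
      have "\<bar>sol q - iter n q\<bar> \<le> rate * (1/2) ^ n * 1" using sol_close[OF q] by simp
      also have "\<dots> \<le> rate * (1/2) ^ n * weight (fst q)"
        using nn q by (intro mult_left_mono weight_ge_1) auto
      finally show "\<bar>sol q - iter n q\<bar> \<le> rate * (1/2) ^ n * weight (fst q)" .
    qed
    also have "\<dots> \<le> rate * (1/2) ^ n * weight (fst p)"
      using nn by (intro mult_right_mono) (auto simp: weight_def)
    moreover have "\<bar>sol p - iter (Suc n) p\<bar> \<le> rate * (1/2) ^ n"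
      using sol_close[OF p, of "Suc n"] nn by simp
    ultimately show ?thesis unfolding iter_Suc distrib_left by linarith
  qed
  moreover have "(\<lambda>n. rate * (1/2) ^ n * (weight (fst p) + 1)) \<longlonglongrightarrow> 0 * (weight (fst p) + 1)"
    by (intro tendsto_intros rate_LIMSEQ)
  ultimately have "\<bar>picard sol p - sol p\<bar> \<le> 0 * (weight (fst p) + 1)"
    by (intro LIMSEQ_le_const) auto
  then show ?thesis by simp
qed

lemma sol_consistent: "pm_consistent TS d sol"
  unfolding pm_consistent_def
proof (intro ballI impI)
  fix p q assume pq: "p \<in> TS" "q \<in> TS" and "d p q = 0"
  then have "picard sol p = picard sol q"
    using lin_consistent[OF g_slices picard_source_bounded[OF sol_between]]
    unfolding pm_consistent_def picard_def by blast
  then show "sol p = sol q" by (simp add: sol_picard pq)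
qed

text \<open>In the linear equation for the fixed point, the source contributes the integral of
  \<open>sol\<close> and the linear term subtracts it again; what remains is the equation with the
  driver alone.\<close>

lemma sol_equation:
  assumes r: "r \<in> {0..T}"
  shows "sol (r, x) = mean g' T (r, x) - (LINT s:{r<..T}|\<nu>. fmean (hc sol) (r, x) s)"
proof -
  have p: "(r, x) \<in> TS" and J: "{r<..T} \<in> sets \<nu>" using r by auto
  note bs = driver_domain_bounded[OF between_driver[OF sol_between]]
  note bh = hc_bounded_measurable[OF between_driver[OF sol_between]]
  note b = picard_source_bounded[OF sol_between]
  have "fmean (picard sol) (r, x) s = fmean sol (r, x) s" if "s \<in> {0..T}" for s
    using that sol_picard by (simp add: fmean_def mean_def)
  then have 1: "(LINT s:{r<..T}|\<nu>. fmean (picard sol) (r, x) s) = (LINT s:{r<..T}|\<nu>. fmean sol (r, x) s)"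
    using r by (intro set_lebesgue_integral_cong[OF J]) auto
  have "(LINT s:{r<..T}|\<nu>. fmean (\<lambda>p. sol p - hc sol p) (r, x) s)
      = (LINT s:{r<..T}|\<nu>. fmean sol (r, x) s - fmean (hc sol) (r, x) s)"
    using r by (intro set_lebesgue_integral_cong[OF J]) (auto intro!: fmean_diff[OF bs bh p])
  also have "\<dots> = (LINT s:{r<..T}|\<nu>. fmean sol (r, x) s) - (LINT s:{r<..T}|\<nu>. fmean (hc sol) (r, x) s)"
    by (rule set_integral_diff(2)[OF set_integrable_fmean1[OF bs p J] set_integrable_fmean1[OF bh p J]])
  finally show ?thesis
    using lin_eq[OF g_slices b r, of x] 1 sol_picard[OF p] unfolding picard_def by simp
qed

text \<open>A ball of \<open>d\<close> is open in the product because the topology of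
  \<open>d\<close> is coarser, so its slice at time \<open>s\<close> is a neighbourhood in the state
  space. Reflexivity of \<open>Q\<close> lets points at the same time be compared. Such slices are
  the test functions required by the Feller property.\<close>

lemma continuous_along_slice:
  assumes u: "continuous_along Q {0..T} u" and Q: "\<And>s. Q s s" and s: "s \<in> {0..T}"
  shows "continuous_on UNIV (\<lambda>y. u (s, y))"
  unfolding continuous_on_iff
proof (intro ballI allI impI)
  fix y and \<epsilon> :: real assume "\<epsilon> > 0"
  with u s obtain \<delta> where \<delta>: "\<delta> > 0" "\<And>z. d (s, z) (s, y) < \<delta> \<Longrightarrow> \<bar>u (s, z) - u (s, y)\<bar> < \<epsilon>"
    unfolding continuous_along_def using Q by metis
  have p: "(s, y) \<in> TS" using s by auto
  have "openin (top_of_set TS) {q \<in> TS. d (s, y) q < \<delta>}"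
    using pseudometric pm_topology_ball[OF pm p] by (simp add: time_space_pseudometric_def)
  then obtain V where V: "open V" "{q \<in> TS. d (s, y) q < \<delta>} = TS \<inter> V" by (auto simp: openin_open)
  have "open ((\<lambda>z. (s, z)) -` V)"
    by (intro open_vimage V(1) continuous_intros)
  moreover have "(s, y) \<in> {q \<in> TS. d (s, y) q < \<delta>}"
    using p \<delta>(1) pseudometric_onD(3)[OF pm p p] by simp
  then have "y \<in> (\<lambda>z. (s, z)) -` V" unfolding V(2) by simp
  ultimately obtain e where e: "e > 0" "ball y e \<subseteq> (\<lambda>z. (s, z)) -` V"
    by (rule openE)
  have "\<bar>u (s, z) - u (s, y)\<bar> < \<epsilon>" if "dist z y < e" for z
  proof (rule \<delta>(2))
    have "z \<in> ball y e" using that by (simp add: dist_commute)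
    then have "(s, z) \<in> TS \<inter> V" using e(2) s by auto
    then have "(s, z) \<in> TS" "d (s, y) (s, z) < \<delta>" unfolding V(2)[symmetric] by simp_all
    then show "d (s, z) (s, y) < \<delta>" using pseudometric_onD(2)[OF pm p] by simp
  qed
  then show "\<exists>e>0. \<forall>z\<in>UNIV. dist z y < e \<longrightarrow> dist (u (s, z)) (u (s, y)) < \<epsilon>"
    using e(1) by (auto simp: dist_real_def)
qed

lemma sol_continuous_along:
  assumes Q: "\<And>s. Q s s" and F: "feller_along Q" and g: "continuous_on UNIV g"
    and h: "\<And>s. s \<in> {0..T} \<Longrightarrow> continuous_on (UNIV \<times> D) (\<lambda>(x, w). h s x w)"
  shows "continuous_along Q {0..T} sol"
proof -
  have iter: "continuous_along Q {0..T} (iter n)" for n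
  proof (induction n)
    case 0
    have "continuous_along Q {0..T} lb"
      using g by (intro lin_continuous_along[OF F g_slices lo_bounded]) auto
    then show ?case by (simp add: iter_def)
  next
    case (Suc n)
    show ?case
      unfolding iter_Suc picard_def
    proof (rule lin_continuous_along[OF F g_slices picard_source_bounded[OF iter_between]])
      fix s assume s: "s \<in> {0..T}"
      have c: "continuous_on UNIV (\<lambda>y. iter n (s, y))"
        by (rule continuous_along_slice[OF Suc Q s])
      have "continuous_on UNIV (\<lambda>y. (\<lambda>(x, w). h s x w) (y, iter n (s, y)))"
        by (rule continuous_on_compose2[OF h[OF s]])
           (use c s betweenD(1)[OF iter_between] in \<open>auto intro!: continuous_intros\<close>)
      then show "continuous_on UNIV (\<lambda>y. iter n (s, y) - hc (iter n) (s, y))"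
        using c by (auto simp: hc_def intro!: continuous_intros)
    qed (use g in simp)
  qed
  show ?thesis
    unfolding continuous_along_def
  proof (intro ballI allI impI)
    fix r x and \<epsilon> :: real assume r: "r \<in> {0..T}" and \<epsilon>: "\<epsilon> > 0"
    have "\<forall>\<^sub>F n in sequentially. rate * (1/2) ^ n < \<epsilon> / 3"
      using \<epsilon> by (intro order_tendstoD(2)[OF rate_LIMSEQ]) simp
    then obtain n where n: "rate * (1/2) ^ n < \<epsilon> / 3"
      by (auto simp: eventually_sequentially)
    have "\<epsilon> / 3 > 0" using \<epsilon> by simp
    then obtain \<delta> where \<delta>: "\<delta> > 0"
      "\<And>s y. s \<in> {0..T} \<Longrightarrow> Q r s \<and> d (s, y) (r, x) < \<delta> \<Longrightarrow> \<bar>iter n (s, y) - iter n (r, x)\<bar> < \<epsilon> / 3"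
      using iter[of n] r unfolding continuous_along_def by blast
    have "\<bar>sol (s, y) - sol (r, x)\<bar> < \<epsilon>" if s: "s \<in> {0..T}" "Q r s \<and> d (s, y) (r, x) < \<delta>" for s y
    proof -
      have "(s, y) \<in> TS" "(r, x) \<in> TS" using s r by auto
      from sol_close[OF this(1), of n] sol_close[OF this(2), of n] \<delta>(2)[OF s] n show ?thesis
        by linarith
    qed
    then show "\<exists>\<delta>>0. \<forall>s\<in>{0..T}. \<forall>y. Q r s \<and> d (s, y) (r, x) < \<delta> \<longrightarrow> \<bar>sol (s, y) - sol (r, x)\<bar> < \<epsilon>"
      using \<delta>(1) by blast
  qed
qed

end

section \<open>Reduction to a Lipschitz driver\<close>

text \<open>A point has only trivial subsets, so with positive mass it would be an atom.\<close>

lemma atomless_singleton_null: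
  assumes "atomless \<mu>" "{t} \<in> sets \<mu>"
  shows "emeasure \<mu> {t} = 0"
proof (rule ccontr)
  assume ne: "emeasure \<mu> {t} \<noteq> 0"
  have "B = {} \<or> B = {t}" if "B \<subseteq> {t}" for B using that by auto
  then have "\<forall>B\<in>sets \<mu>. B \<subseteq> {t} \<longrightarrow> emeasure \<mu> B = 0 \<or> emeasure \<mu> ({t} - B) = 0"
    by (metis Diff_cancel emeasure_empty)
  moreover have "emeasure \<mu> {t} > 0" using ne by (simp add: zero_less_iff_neq_zero)
  ultimately show False using assms unfolding atomless_def by blast
qed

lemma lower_end_le: "w \<in> D \<Longrightarrow> lower_end D \<le> ereal w"
  unfolding lower_end_def by (rule INF_lower)

lemma upper_end_ge: "w \<in> D \<Longrightarrow> ereal w \<le> upper_end D"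
  unfolding upper_end_def by (rule SUP_upper)

lemma lower_end_less: "lower_end D < ereal v \<longleftrightarrow> (\<exists>w\<in>D. w < v)"
  unfolding lower_end_def by (simp add: INF_less_iff)

lemma upper_end_greater: "ereal v < upper_end D \<longleftrightarrow> (\<exists>w\<in>D. v < w)"
  unfolding upper_end_def by (simp add: less_SUP_iff)

locale semilinear_problem = markov_time_space T d M F X P
  for T :: real and d :: "('s::{metric_space, second_countable_topology}) pm"
    and M :: "'o measure" and F :: "real \<Rightarrow> 'o measure"
    and X :: "real \<Rightarrow> 'o \<Rightarrow> 's" and P :: "real \<Rightarrow> 's \<Rightarrow> 'o measure" +
  fixes \<mu> :: "real measure" and D :: "real set" and f :: "real \<Rightarrow> 's \<Rightarrow> real \<Rightarrow> real" and g :: "'s \<Rightarrow> real"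
  assumes mu_borel: "sets \<mu> = sets (restrict_space borel {0..T})"
    and mu_atomless: "atomless \<mu>"
    and D_interval: "is_interval D"
    and D_nondegenerate: "\<exists>a\<in>D. \<exists>b\<in>D. a < b"
    and g_borel: "g \<in> borel_measurable borel"
    and g_D: "range g \<subseteq> D"
    and g_bounded: "bounded (range g)"
    and g_consistent: "\<forall>x y. d (T, x) (T, y) = 0 \<longrightarrow> g x = g y"
    and f_BC: "f \<in> BC_mu T \<mu> d D"
    and lower_finite: "lower_end D > -\<infinity> \<Longrightarrow>
          locally_mu_bounded_at T \<mu> d D f (real_of_ereal (lower_end D)) \<and>
          locally_lipschitz_mu_at T \<mu> d D f (real_of_ereal (lower_end D)) \<and>
          (AE s in \<mu>. \<forall>x. \<exists>l\<le>0. (f s x \<longlongrightarrow> l) (at_right (real_of_ereal (lower_end D))))"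
    and upper_finite: "upper_end D < \<infinity> \<Longrightarrow>
          locally_mu_bounded_at T \<mu> d D f (real_of_ereal (upper_end D)) \<and>
          locally_lipschitz_mu_at T \<mu> d D f (real_of_ereal (upper_end D)) \<and>
          (AE s in \<mu>. \<forall>x. \<exists>l\<ge>0. (f s x \<longlongrightarrow> l) (at_left (real_of_ereal (upper_end D))))"
    and lower_infinite: "lower_end D = -\<infinity> \<Longrightarrow> affine_mu_bounded_above T \<mu> d D f"
    and upper_infinite: "upper_end D = \<infinity> \<Longrightarrow> affine_mu_bounded_below T \<mu> d D f"
begin

section \<open>The time measure and the ends of D\<close>

lemma space_mu: "space \<mu> = {0..T}"
  using sets_eq_imp_space_eq[OF mu_borel] by simp

lemma measurable_mu: "measurable \<mu> N = measurable BT N"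
  by (rule measurable_cong_sets[OF mu_borel refl])

lemma mu_singleton: "t \<in> {0..T} \<Longrightarrow> {t} \<in> sets \<mu> \<and> emeasure \<mu> {t} = 0"
  using atomless_singleton_null[OF mu_atomless] by (auto simp: mu_borel sets_restrict_space_iff)

lemma D_mem: "v \<in> D \<Longrightarrow> w \<in> D \<Longrightarrow> v \<le> z \<Longrightarrow> z \<le> w \<Longrightarrow> z \<in> D"
  using D_interval by (meson mem_is_interval_1_I)

lemma lower_end_less_infinity: "lower_end D < \<infinity>"
proof -
  obtain w where "w \<in> D" using D_nondegenerate by auto
  then show ?thesis using lower_end_le[of w D] by (cases "lower_end D") auto
qed

lemma upper_end_greater_minus_infinity: "- \<infinity> < upper_end D"
proof -
  obtain w where "w \<in> D" using D_nondegenerate by auto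
  then show ?thesis using upper_end_ge[of w D] by (cases "upper_end D") auto
qed

lemma lower_end_real:
  assumes "lower_end D > - \<infinity>"
  obtains a where "lower_end D = ereal a" "real_of_ereal (lower_end D) = a"
    "\<And>w. w \<in> D \<Longrightarrow> a \<le> w" "\<And>v. a < v \<Longrightarrow> \<exists>w\<in>D. w < v"
proof -
  obtain a where a: "lower_end D = ereal a"
    using assms lower_end_less_infinity by (cases "lower_end D") auto
  show ?thesis
  proof (rule that[OF a])
    show "a \<le> w" if "w \<in> D" for w using lower_end_le[OF that] a by simp
    show "\<exists>w\<in>D. w < v" if "a < v" for v using lower_end_less[of D v] that a by simp
  qed (simp add: a)
qed

lemma upper_end_real:
  assumes "upper_end D < \<infinity>"
  obtains b where "upper_end D = ereal b" "real_of_ereal (upper_end D) = b"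
    "\<And>w. w \<in> D \<Longrightarrow> w \<le> b" "\<And>v. v < b \<Longrightarrow> \<exists>w\<in>D. v < w"
proof -
  obtain b where b: "upper_end D = ereal b"
    using assms upper_end_greater_minus_infinity by (cases "upper_end D") auto
  show ?thesis
  proof (rule that[OF b])
    show "w \<le> b" if "w \<in> D" for w using upper_end_ge[OF that] b by simp
    show "\<exists>w\<in>D. v < w" if "v < b" for v using upper_end_greater[of v D] that b by simp
  qed (simp add: b)
qed

text \<open>A limit point of an interval that is missing from it can only be a finite end, and there
  the boundary hypothesis supplies the regularity. Compact ranges can then be treated although
  \<open>D\<close> itself may not be closed.\<close>

lemma locally_regular_closure:
  assumes z: "z \<in> closure D"
  shows "locally_mu_bounded_at T \<mu> d D f z \<and> locally_lipschitz_mu_at T \<mu> d D f z"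
proof (cases "z \<in> D")
  case True
  then show ?thesis using f_BC by (simp add: BC_mu_def)
next
  case False
  have near: "\<exists>w\<in>D. \<bar>w - z\<bar> < e" if "e > 0" for e
    using z that by (auto simp: closure_approachable dist_real_def)
  obtain w0 where w0: "w0 \<in> D" using D_nondegenerate by auto
  consider "w0 < z" | "z < w0" using False w0 by (metis linorder_neqE)
  then show ?thesis
  proof cases
    case 1
    then have le: "w < z" if "w \<in> D" for w using D_mem[OF w0 that, of z] False that by force
    have "upper_end D = ereal z"
    proof (rule antisym)
      show "upper_end D \<le> ereal z"
        unfolding upper_end_def using le by (intro SUP_least) (auto intro: less_imp_le)
      show "ereal z \<le> upper_end D"
      proof (rule ccontr)
        assume "\<not> ereal z \<le> upper_end D"
        then obtain v where v: "upper_end D < ereal v" "v < z"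
          using ereal_dense2 by (metis less_ereal.simps(1) not_le)
        obtain w where "w \<in> D" "\<bar>w - z\<bar> < z - v" using near[of "z - v"] v by auto
        with v(1) show False using upper_end_ge[of w D] by (auto dest: order_le_less_trans)
      qed
    qed
    then show ?thesis using upper_finite by simp
  next
    case 2
    then have le: "z < w" if "w \<in> D" for w using D_mem[OF that w0, of z] False that by force
    have "lower_end D = ereal z"
    proof (rule antisym)
      show "ereal z \<le> lower_end D"
        unfolding lower_end_def using le by (intro INF_greatest) (auto intro: less_imp_le)
      show "lower_end D \<le> ereal z"
      proof (rule ccontr)
        assume "\<not> lower_end D \<le> ereal z"
        then obtain v where v: "ereal v < lower_end D" "z < v"
          using ereal_dense2 by (metis less_ereal.simps(1) not_le)
        obtain w where "w \<in> D" "\<bar>w - z\<bar> < v - z" using near[of "v - z"] v by auto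
        with v(1) show False using lower_end_le[of w D] by (auto dest: order_less_le_trans)
      qed
    qed
    then show ?thesis using lower_finite by simp
  qed
qed

section \<open>Dominating functions on compact ranges\<close>

definition dominating :: "(real \<Rightarrow> real) \<Rightarrow> bool" where
  "dominating l \<longleftrightarrow> l \<in> borel_measurable BT \<and> (\<forall>t\<in>{0..T}. 0 \<le> l t) \<and> integrable \<mu> l"

lemma dominating_add: "dominating k \<Longrightarrow> dominating l \<Longrightarrow> dominating (\<lambda>t. k t + l t)"
  by (auto simp: dominating_def intro: borel_measurable_add)

lemma mu_dominated_dominating:
  assumes "mu_dominated T \<mu> d a"
  obtains l where "dominating l" "AE s in \<mu>. \<forall>y. 0 \<le> a (s, y) \<and> a (s, y) \<le> l s"
proof -
  from assms obtain l where l: "dominating l" and le: "AE s in \<mu>. \<forall>y. a (s, y) \<le> l s"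
    and nn: "\<forall>t\<in>{0..T}. \<forall>x. 0 \<le> a (t, x)"
    unfolding mu_dominated_def dominating_def by blast
  have "AE s in \<mu>. \<forall>y. 0 \<le> a (s, y) \<and> a (s, y) \<le> l s"
    using le AE_space by eventually_elim (use nn in \<open>auto simp: space_mu\<close>)
  with l show ?thesis by (rule that)
qed

definition regular_on :: "real \<Rightarrow> real \<Rightarrow> (real \<Rightarrow> real) \<Rightarrow> real \<Rightarrow> bool" where
  "regular_on a b l s \<longleftrightarrow> (\<forall>x. \<forall>w\<in>D \<inter> {a..b}. \<bar>f s x w\<bar> \<le> l s \<and>
      (\<forall>w'\<in>D \<inter> {a..b}. \<bar>f s x w - f s x w'\<bar> \<le> l s * \<bar>w - w'\<bar>))"

lemma regular_onD:
  assumes "regular_on a b l s" "w \<in> D" "a \<le> w" "w \<le> b"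
  shows "\<bar>f s x w\<bar> \<le> l s"
    and "w' \<in> D \<Longrightarrow> a \<le> w' \<Longrightarrow> w' \<le> b \<Longrightarrow> \<bar>f s x w - f s x w'\<bar> \<le> l s * \<bar>w - w'\<bar>"
  using assms unfolding regular_on_def by auto

lemma regular_onI:
  assumes "\<And>x w. w \<in> D \<Longrightarrow> a \<le> w \<Longrightarrow> w \<le> b \<Longrightarrow> \<bar>f s x w\<bar> \<le> l s"
    and lip: "\<And>x w w'. w \<in> D \<Longrightarrow> w' \<in> D \<Longrightarrow> a \<le> w \<Longrightarrow> w \<le> w' \<Longrightarrow> w' \<le> b \<Longrightarrow> \<bar>f s x w - f s x w'\<bar> \<le> l s * (w' - w)"
  shows "regular_on a b l s"
  unfolding regular_on_def
proof (intro allI ballI conjI)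
  fix x w w' assume w: "w \<in> D \<inter> {a..b}" and w': "w' \<in> D \<inter> {a..b}"
  show "\<bar>f s x w - f s x w'\<bar> \<le> l s * \<bar>w - w'\<bar>"
  proof (cases "w \<le> w'")
    case True
    then show ?thesis using lip[of w w' x] w w' by simp
  next
    case False
    then show ?thesis using lip[of w' w x] w w' by (simp add: abs_minus_commute)
  qed
qed (use assms(1) in auto)

lemma regular_on_join:
  assumes 1: "regular_on a b l1 s" and 2: "regular_on b c l2 s" and nn: "0 \<le> l1 s" "0 \<le> l2 s"
  shows "regular_on a c (\<lambda>s. l1 s + l2 s) s"
proof (rule regular_onI)
  fix x w assume w: "w \<in> D" "a \<le> w" "w \<le> c"
  show "\<bar>f s x w\<bar> \<le> l1 s + l2 s"
  proof (cases "w \<le> b")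
    case True
    then show ?thesis using regular_onD(1)[OF 1 w(1,2), of x] nn by simp
  next
    case False
    then show ?thesis using regular_onD(1)[OF 2 w(1) _ w(3), of x] nn by simp
  qed
next
  fix x w w' assume w: "w \<in> D" "w' \<in> D" "a \<le> w" "w \<le> w'" "w' \<le> c"
  have nn': "0 \<le> l1 s * (w' - w)" "0 \<le> l2 s * (w' - w)" using nn w by auto
  consider "w' \<le> b" | "b \<le> w" | "w \<le> b" "b \<le> w'" by linarith
  then show "\<bar>f s x w - f s x w'\<bar> \<le> (l1 s + l2 s) * (w' - w)"
  proof cases
    case c: 1
    have "\<bar>f s x w - f s x w'\<bar> \<le> l1 s * \<bar>w - w'\<bar>"
      using w c by (intro regular_onD(2)[OF 1]) auto
    also have "\<bar>w - w'\<bar> = w' - w" using w by simp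
    finally show ?thesis using nn' by (simp add: distrib_right)
  next
    case c: 2
    have "\<bar>f s x w - f s x w'\<bar> \<le> l2 s * \<bar>w - w'\<bar>"
      using w c by (intro regular_onD(2)[OF 2]) auto
    also have "\<bar>w - w'\<bar> = w' - w" using w by simp
    finally show ?thesis using nn' by (simp add: distrib_right)
  next
    case c: 3
    \<comment> \<open>Since \<open>D\<close> is an interval, the junction lies in \<open>D\<close>,
      so a Lipschitz estimate across it can be split there.\<close>
    have b: "b \<in> D" using D_mem w c by blast
    have "\<bar>f s x w - f s x b\<bar> \<le> l1 s * \<bar>w - b\<bar>"
      using w c b by (intro regular_onD(2)[OF 1]) auto
    also have "\<dots> \<le> l1 s * (w' - w)" using nn c by (intro mult_left_mono) auto
    finally have A: "\<bar>f s x w - f s x b\<bar> \<le> l1 s * (w' - w)" .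
    have "\<bar>f s x b - f s x w'\<bar> \<le> l2 s * \<bar>b - w'\<bar>"
      using w c b by (intro regular_onD(2)[OF 2]) auto
    also have "\<dots> \<le> l2 s * (w' - w)" using nn c by (intro mult_left_mono) auto
    finally have "\<bar>f s x b - f s x w'\<bar> \<le> l2 s * (w' - w)" .
    with A show ?thesis unfolding distrib_right by linarith
  qed
qed

lemma regular_on_local:
  assumes z: "z \<in> closure D"
  obtains e l where "e > 0" "dominating l"
    "\<And>a b. a \<le> z \<Longrightarrow> z \<le> b \<Longrightarrow> b - a < e \<Longrightarrow> AE s in \<mu>. regular_on a b l s"
proof -
  note reg = locally_regular_closure[OF z]
  obtain W1 a1 where W1: "openin (top_of_set (closure D)) W1" "z \<in> W1" "mu_dominated T \<mu> d a1"
    "\<forall>t\<in>{0..T}. \<forall>x. \<forall>w\<in>W1 \<inter> D. \<bar>f t x w\<bar> \<le> a1 (t, x)"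
    using conjunct1[OF reg] unfolding locally_mu_bounded_at_def by blast
  obtain W2 a2 where W2: "openin (top_of_set (closure D)) W2" "z \<in> W2" "mu_dominated T \<mu> d a2"
    "\<forall>t\<in>{0..T}. \<forall>x. \<forall>w\<in>W2 \<inter> D. \<forall>w'\<in>W2 \<inter> D. \<bar>f t x w - f t x w'\<bar> \<le> a2 (t, x) * \<bar>w - w'\<bar>"
    using conjunct2[OF reg] unfolding locally_lipschitz_mu_at_def by blast
  obtain l1 where l1: "dominating l1" "AE s in \<mu>. \<forall>y. 0 \<le> a1 (s, y) \<and> a1 (s, y) \<le> l1 s"
    using mu_dominated_dominating[OF W1(3)] .
  obtain l2 where l2: "dominating l2" "AE s in \<mu>. \<forall>y. 0 \<le> a2 (s, y) \<and> a2 (s, y) \<le> l2 s"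
    using mu_dominated_dominating[OF W2(3)] .
  have "openin (top_of_set (closure D)) (W1 \<inter> W2)" using W1(1) W2(1) by (rule openin_Int)
  then obtain V where V: "open V" "W1 \<inter> W2 = closure D \<inter> V" by (auto simp: openin_open)
  then have "z \<in> V" using W1(2) W2(2) by auto
  with V(1) obtain e where e: "e > 0" "ball z e \<subseteq> V" by (rule openE)
  have "AE s in \<mu>. regular_on a b (\<lambda>s. l1 s + l2 s) s" if ab: "a \<le> z" "z \<le> b" "b - a < e" for a b
    using l1(2) l2(2) AE_space
  proof eventually_elim
    case (elim s)
    then have s: "s \<in> {0..T}" by (simp add: space_mu)
    have nn: "0 \<le> l1 s" "0 \<le> l2 s" using l1(1) l2(1) s by (auto simp: dominating_def)
    have sub: "w \<in> W1 \<inter> D" "w \<in> W2 \<inter> D" if "w \<in> D" "a \<le> w" "w \<le> b" for w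
    proof -
      have "w \<in> ball z e" using ab that by (auto simp: dist_real_def)
      then have "w \<in> closure D \<inter> V" using e(2) closure_subset that(1) by auto
      then have "w \<in> W1 \<inter> W2" using V(2) by simp
      with that show "w \<in> W1 \<inter> D" "w \<in> W2 \<inter> D" by auto
    qed
    show ?case
    proof (rule regular_onI)
      fix x w assume w: "w \<in> D" "a \<le> w" "w \<le> b"
      have "\<bar>f s x w\<bar> \<le> a1 (s, x)" using W1(4) s sub(1)[OF w] by blast
      also have "\<dots> \<le> l1 s + l2 s" using elim(1) nn by (simp add: add_increasing2)
      finally show "\<bar>f s x w\<bar> \<le> l1 s + l2 s" .
    next
      fix x w w' assume w: "w \<in> D" "w' \<in> D" "a \<le> w" "w \<le> w'" "w' \<le> b"
      have "\<bar>f s x w - f s x w'\<bar> \<le> a2 (s, x) * \<bar>w - w'\<bar>"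
      proof -
        have "w \<in> W2 \<inter> D" "w' \<in> W2 \<inter> D" using sub(2)[of w] sub(2)[of w'] w by auto
        with W2(4) s show ?thesis by blast
      qed
      also have "\<dots> \<le> (l1 s + l2 s) * \<bar>w - w'\<bar>"
        using elim(2) nn by (intro mult_right_mono) (auto intro: add_increasing)
      finally show "\<bar>f s x w - f s x w'\<bar> \<le> (l1 s + l2 s) * (w' - w)" using w by simp
    qed
  qed
  with e(1) dominating_add[OF l1(1) l2(1)] show ?thesis by (rule that)
qed

text \<open>Compactness is used in the form of bisection: the property holds on short intervals
  about every point and passes to adjacent unions by adding the dominating functions. Short
  intervals off the closure of \<open>D\<close> carry no condition.\<close>

lemma compact_dominator:
  assumes "a \<le> b"
  shows "\<exists>l. dominating l \<and> (AE s in \<mu>. regular_on a b l s)"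
  using assms
proof (induction rule: Bolzano)
  case (trans a b c)
  then obtain l1 l2 where l: "dominating l1" "AE s in \<mu>. regular_on a b l1 s"
    "dominating l2" "AE s in \<mu>. regular_on b c l2 s" by blast
  have "AE s in \<mu>. regular_on a c (\<lambda>s. l1 s + l2 s) s"
    using l(2,4) AE_space
    by eventually_elim (use l(1,3) in \<open>auto simp: dominating_def space_mu intro: regular_on_join\<close>)
  with dominating_add[OF l(1,3)] show ?case by blast
next
  case (local z)
  show ?case
  proof (cases "z \<in> closure D")
    case True
    then obtain e l where "e > 0" "dominating l"
      "\<And>a b. a \<le> z \<Longrightarrow> z \<le> b \<Longrightarrow> b - a < e \<Longrightarrow> AE s in \<mu>. regular_on a b l s"
      using regular_on_local by blast
    then show ?thesis by blast
  next
    case False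
    then have "open (- closure D)" "z \<in> - closure D" by auto
    then obtain e where e: "e > 0" "ball z e \<subseteq> - closure D" by (rule openE)
    have "regular_on a b (\<lambda>_. 0) s" if ab: "a \<le> z" "z \<le> b" "b - a < e" for a b s
    proof -
      have "w \<notin> D" if "w \<in> {a..b}" for w
      proof -
        have "w \<in> ball z e" using ab that by (auto simp: dist_real_def)
        then have "w \<notin> closure D" using e(2) by blast
        then show ?thesis using closure_subset by blast
      qed
      then show ?thesis by (auto simp: regular_on_def)
    qed
    moreover have "dominating (\<lambda>_. 0)" by (simp add: dominating_def)
    ultimately show ?thesis using e(1) by (intro exI[of _ e]) auto
  qed
qed

section \<open>Change to a finite time measure\<close>

lemma set_mu_nu: "J \<in> sets borel \<Longrightarrow> J \<subseteq> {0..T} \<Longrightarrow> J \<in> sets \<mu>"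
  by (simp add: mu_borel sets_restrict_space_iff)

context
  fixes l assumes l: "dominating l"
begin

abbreviation "nu \<equiv> density \<mu> (\<lambda>s. ennreal (l s))"

lemma l_measurable_mu: "l \<in> borel_measurable \<mu>"
  using l by (simp add: dominating_def measurable_mu)

lemma l_nonneg: "AE s in \<mu>. 0 \<le> l s"
  using l by (intro AE_I2) (simp add: dominating_def space_mu)

text \<open>Integrability of \<open>l\<close> makes the total mass finite, and points that are null
  for \<open>\<mu>\<close> stay null under any density.\<close>

lemma density_time_measure: "time_measure T nu"
proof (rule time_measure.intro)
  note [measurable] = l_measurable_mu
  show "0 \<le> T" using T_pos by simp
  show "sets nu = sets BT" by (simp add: mu_borel)
  have "integrable \<mu> l" using l by (simp add: dominating_def)
  then have "(\<integral>\<^sup>+s. ennreal (l s) \<partial>\<mu>) = ennreal (integral\<^sup>L \<mu> l)"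
    by (rule nn_integral_eq_integral[OF _ l_nonneg])
  then have "emeasure nu (space nu) \<noteq> \<infinity>"
    by (simp add: emeasure_density cong: nn_integral_cong)
  then show "finite_measure nu" by (rule finite_measureI)
  show "emeasure nu {t} = 0" if "t \<in> {0..T}" for t
  proof -
    have "{t} \<in> null_sets \<mu>" using mu_singleton[OF that] by auto
    from AE_not_in[OF this] have "AE s in \<mu>. s \<in> {t} \<longrightarrow> ennreal (l s) = 0"
      by (rule eventually_mono) simp
    then have "{t} \<in> null_sets nu" using mu_singleton[OF that] by (subst null_sets_density_iff) auto
    then show ?thesis by auto
  qed
qed

lemma density_integral:
  assumes [measurable]: "k \<in> borel_measurable \<mu>" "J \<in> sets \<mu>"
  shows "(LINT s:J|nu. k s) = (LINT s:J|\<mu>. l s * k s)"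
    and "set_integrable nu J k \<longleftrightarrow> set_integrable \<mu> J (\<lambda>s. l s * k s)"
proof -
  note [measurable] = l_measurable_mu
  have "(LINT s:J|nu. k s) = (LINT s|\<mu>. l s *\<^sub>R (indicator J s *\<^sub>R k s))"
    unfolding set_lebesgue_integral_def by (rule integral_density) (use l_nonneg in auto)
  then show "(LINT s:J|nu. k s) = (LINT s:J|\<mu>. l s * k s)"
    by (simp add: set_lebesgue_integral_def mult.left_commute)
  have "set_integrable nu J k \<longleftrightarrow> integrable \<mu> (\<lambda>s. l s *\<^sub>R (indicator J s *\<^sub>R k s))"
    unfolding set_integrable_def by (rule integrable_density) (use l_nonneg in auto)
  then show "set_integrable nu J k \<longleftrightarrow> set_integrable \<mu> J (\<lambda>s. l s * k s)"
    by (simp add: set_integrable_def mult.left_commute)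
qed

end

lemma path_section_measurable:
  assumes G: "G \<in> borel_measurable BTS" and \<omega>: "\<omega> \<in> space M"
  shows "(\<lambda>s. G (s, X s \<omega>)) \<in> borel_measurable \<mu>"
proof -
  have "(\<lambda>s. (s, \<omega>)) \<in> BT \<rightarrow>\<^sub>M BT \<Otimes>\<^sub>M M" using \<omega> by measurable
  from measurable_compose[OF measurable_compose[OF this path_measurable] G] show ?thesis
    by (simp add: measurable_mu)
qed

lemma AE_mu_neq: "r \<in> {0..T} \<Longrightarrow> AE s in \<mu>. s \<noteq> r"
proof -
  assume "r \<in> {0..T}"
  then have "{r} \<in> null_sets \<mu>" using mu_singleton[of r] by auto
  from AE_not_in[OF this] show ?thesis by (rule eventually_mono) simp
qed

text \<open>\<open>\<mu>\<close> need not even be \<open>\<sigma>\<close>-finite; all integrals are therefore rewritten over the finite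
  measure with density \<open>l\<close>.\<close>

lemma path_integral_density:
  assumes l: "dominating l" and G: "G \<in> borel_measurable BTS" and H: "bounded_measurable K H"
    and eq: "AE s in \<mu>. \<forall>x. G (s, x) = l s * H (s, x)"
    and r: "0 \<le> r" "r \<le> t" "t \<le> T" and \<omega>: "\<omega> \<in> space M"
  shows "set_integrable \<mu> {r..t} (\<lambda>s. G (s, X s \<omega>))"
    and "(LINT s:{r..t}|\<mu>. G (s, X s \<omega>)) = (LINT s:{r<..t}|nu l. H (s, X s \<omega>))"
proof -
  interpret N: time_measure T "nu l" by (rule density_time_measure[OF l])
  have J [measurable]: "{r..t} \<in> sets \<mu>" "{r<..t} \<in> sets \<mu>" using r by (auto intro!: set_mu_nu)
  have mG [measurable]: "(\<lambda>s. G (s, X s \<omega>)) \<in> borel_measurable \<mu>"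
    by (rule path_section_measurable[OF G \<omega>])
  have mH [measurable]: "(\<lambda>s. H (s, X s \<omega>)) \<in> borel_measurable \<mu>"
    using H by (intro path_section_measurable[OF _ \<omega>]) (simp add: bounded_measurable_def)
  note [measurable] = l_measurable_mu[OF l]
  have rT: "r \<in> {0..T}" using r by auto
  \<comment> \<open>Problem (M) integrates over a closed interval, the clock calculus over a
    half-open one; the left end is null.\<close>
  have ae: "AE s in \<mu>. indicator {r..t} s *\<^sub>R G (s, X s \<omega>) = indicator {r<..t} s *\<^sub>R (l s * H (s, X s \<omega>))"
    using eq AE_mu_neq[OF rT] by eventually_elim (auto split: split_indicator)
  have "set_integrable (nu l) {r<..t} (\<lambda>s. H (s, X s \<omega>))"
    by (rule N.set_integrable_bounded[where K=K])
       (use mH J bounded_slicesD(1)[OF bounded_measurable_slices[OF H]] in auto)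
  then have i: "set_integrable \<mu> {r<..t} (\<lambda>s. l s * H (s, X s \<omega>))"
    using density_integral(2)[OF l mH J(2)] by simp
  show "set_integrable \<mu> {r..t} (\<lambda>s. G (s, X s \<omega>))"
    unfolding set_integrable_def
    by (rule integrable_cong_AE_imp[OF i[unfolded set_integrable_def]]) (use ae in \<open>auto elim: eventually_mono\<close>)
  have "(LINT s:{r..t}|\<mu>. G (s, X s \<omega>)) = (LINT s:{r<..t}|\<mu>. l s * H (s, X s \<omega>))"
    unfolding set_lebesgue_integral_def by (rule integral_cong_AE) (use ae in auto)
  also have "\<dots> = (LINT s:{r<..t}|nu l. H (s, X s \<omega>))"
    by (rule density_integral(1)[OF l mH J(2), symmetric])
  finally show "(LINT s:{r..t}|\<mu>. G (s, X s \<omega>)) = (LINT s:{r<..t}|nu l. H (s, X s \<omega>))" .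
qed

end

context markov_time_measure begin

text \<open>A solution of (M) must satisfy the equation between any two times, while the fixed point
  only gives it up to \<open>T\<close>. Taking the mean at time \<open>t\<close> of the equation
  started there, and collapsing by the Markov property, gives the integral over
  \<open>{t<..T}\<close> seen from \<open>(r, x)\<close>; subtracting leaves
  \<open>{r<..t}\<close>.\<close>

lemma mean_backward_equation:
  assumes bg: "bounded_slices C g" and bH: "bounded_measurable K H"
    and eq: "\<And>r x. r \<in> {0..T} \<Longrightarrow> v (r, x) = mean g T (r, x) - (LINT s:{r<..T}|\<nu>. fmean H (r, x) s)"
    and r: "r \<in> {0..T}" and t: "t \<in> {r..T}"
  shows "mean v t (r, x) = v (r, x) + (LINT s:{r<..t}|\<nu>. fmean H (r, x) s)"
proof -
  interpret Q: prob_space "P r x" by (rule P_prob) fact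
  have tT: "t \<in> {0..T}" and TT: "T \<in> {t..T}" and p: "(r, x) \<in> TS" using r t by auto
  have i1: "integrable (P r x) (\<lambda>\<omega>. mean g T (t, X t \<omega>))"
  proof (rule Q.integrable_const_bound[where B=C])
    show "AE \<omega> in P r x. norm (mean g T (t, X t \<omega>)) \<le> C"
      using mean_bound[OF bg T_mem(1)] tT by auto
    show "(\<lambda>\<omega>. mean g T (t, X t \<omega>)) \<in> borel_measurable (P r x)"
      using tT by (intro measurable_compose[OF X_measurable_P[OF tT r] mean_measurable_state[OF bg T_mem(1)]]) auto
  qed
  have F: "(\<integral>\<omega>. (LINT q:{t<..T}|\<nu>. 1 * fmean H (t, X t \<omega>) q) \<partial>P r x) = (LINT q:{t<..T}|\<nu>. 1 * fmean H (r, x) q)"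
    "integrable (P r x) (\<lambda>\<omega>. LINT q:{t<..T}|\<nu>. 1 * fmean H (t, X t \<omega>) q)"
    by (rule mean_fmean_integral[OF bH r t, of "\<lambda>_. 1" 1], simp, simp)+
  have "mean v t (r, x) = (\<integral>\<omega>. mean g T (t, X t \<omega>) \<partial>P r x) - (\<integral>\<omega>. (LINT q:{t<..T}|\<nu>. fmean H (t, X t \<omega>) q) \<partial>P r x)"
    unfolding mean_def[of v] fst_conv snd_conv eq[OF tT] using i1 F(2) by simp
  also have "\<dots> = mean g T (r, x) - (LINT q:{t<..T}|\<nu>. fmean H (r, x) q)"
    using F(1) mean_markov[OF bg r t TT] by simp
  also have "(LINT q:{r<..T}|\<nu>. fmean H (r, x) q)
      = (LINT q:{r<..t}|\<nu>. fmean H (r, x) q) + (LINT q:{t<..T}|\<nu>. fmean H (r, x) q)"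
  proof -
    have U: "{r<..T} = {r<..t} \<union> {t<..T}" using t by auto
    have "{r<..t} \<in> sets \<nu>" "{t<..T} \<in> sets \<nu>" using r t tT by auto
    then show ?thesis
      unfolding U using set_integrable_fmean1[OF bH p] by (intro set_integral_Un) auto
  qed
  then have "mean g T (r, x) - (LINT q:{t<..T}|\<nu>. fmean H (r, x) q) = v (r, x) + (LINT s:{r<..t}|\<nu>. fmean H (r, x) s)"
    using eq[OF r, of x] by simp
  finally show ?thesis .
qed

end

context semilinear_problem begin

section \<open>The normalised driver\<close>

definition fc :: "(real \<times> 's \<Rightarrow> real) \<Rightarrow> real \<times> 's \<Rightarrow> real" where
  "fc u p = f (fst p) (snd p) (u p)"

text \<open>Setting the quotient to zero on the exceptional set \<open>N\<close> makes its bounds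
  hold at every time. Where \<open>l\<close> vanishes outside \<open>N\<close> nothing is lost,
  because there \<open>f\<close> vanishes on the whole range by \<open>regular_on\<close>.\<close>

definition drv :: "real set \<Rightarrow> (real \<Rightarrow> real) \<Rightarrow> real \<Rightarrow> 's \<Rightarrow> real \<Rightarrow> real" where
  "drv N l s x w = (if s \<in> N \<or> l s = 0 then 0 else f s x w / l s)"

lemma regular_on_mono:
  assumes "regular_on a b k s" "k s \<le> l s"
  shows "regular_on a b l s"
  unfolding regular_on_def
proof (intro allI ballI conjI)
  fix x w assume w: "w \<in> D \<inter> {a..b}"
  have "\<bar>f s x w\<bar> \<le> k s" using regular_onD(1)[OF assms(1), of w x] w by auto
  with assms(2) show "\<bar>f s x w\<bar> \<le> l s" by linarith
  fix w' assume w': "w' \<in> D \<inter> {a..b}"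
  have "\<bar>f s x w - f s x w'\<bar> \<le> k s * \<bar>w - w'\<bar>"
    using regular_onD(2)[OF assms(1), of w w' x] w w' by auto
  also have "\<dots> \<le> l s * \<bar>w - w'\<bar>" using assms(2) by (intro mult_right_mono) auto
  finally show "\<bar>f s x w - f s x w'\<bar> \<le> l s * \<bar>w - w'\<bar>" .
qed

lemma f_measurable: "(\<lambda>((t, x), w). f t x w) \<in> borel_measurable (BTS \<Otimes>\<^sub>M restrict_space borel D)"
  using f_BC by (simp add: BC_mu_def)

lemma fc_measurable:
  assumes "u \<in> borel_measurable BTS" "\<And>p. p \<in> TS \<Longrightarrow> u p \<in> D"
  shows "fc u \<in> borel_measurable BTS"
proof -
  have "u \<in> BTS \<rightarrow>\<^sub>M restrict_space borel D"
    using assms by (intro measurable_restrict_space2) auto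
  then have "(\<lambda>p. (p, u p)) \<in> BTS \<rightarrow>\<^sub>M BTS \<Otimes>\<^sub>M restrict_space borel D"
    by (intro measurable_Pair) auto
  from measurable_compose[OF this f_measurable] show ?thesis
    by (simp add: case_prod_beta fc_def[abs_def])
qed

lemma g_slices: "(\<And>x. \<bar>g x\<bar> \<le> C) \<Longrightarrow> bounded_slices C (\<lambda>p. g (snd p))"
  using g_borel by (auto simp: bounded_slices_def)

text \<open>The process started at \<open>(T, x)\<close> sits at distance zero from
  \<open>x\<close>, not necessarily at \<open>x\<close>; consistency of \<open>g\<close> closes the
  gap.\<close>

lemma mean_g_end: "mean (\<lambda>p. g (snd p)) T (T, x) = g x"
proof -
  have TT: "T \<in> {0..T}" using T_pos by auto
  interpret Q: prob_space "P T x" by (rule P_prob) fact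
  have "mean (\<lambda>p. g (snd p)) T (T, x) = (\<integral>\<omega>. g x \<partial>P T x)"
    unfolding mean_def fst_conv snd_conv
  proof (rule integral_cong_AE)
    show "AE \<omega> in P T x. g (X T \<omega>) = g x"
      using P_start[OF TT, of x] by eventually_elim (use g_consistent in auto)
    show "(\<lambda>\<omega>. g (X T \<omega>)) \<in> borel_measurable (P T x)"
      using measurable_compose[OF X_measurable_P[OF TT TT] g_borel] .
  qed simp
  then show ?thesis by (simp add: Q.prob_space)
qed

text \<open>A mean outside the interval would lie strictly beyond all its points on one side, and
  strict inequalities survive expectation. This covers intervals without their end points.\<close>

lemma mean_in_D:
  assumes p: "fst p \<in> {0..T}"
  shows "mean (\<lambda>p. g (snd p)) T p \<in> D"
proof (rule ccontr)
  let ?m = "mean (\<lambda>p. g (snd p)) T p"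
  assume no: "?m \<notin> D"
  interpret Q: prob_space "P (fst p) (snd p)" by (rule P_prob) fact
  obtain C where C: "\<And>x. \<bar>g x\<bar> \<le> C" using g_bounded by (auto simp: bounded_iff)
  have i: "integrable (P (fst p) (snd p)) (\<lambda>\<omega>. g (X T \<omega>))"
    using mean_integrable[OF g_slices[OF C], of T] p T_pos by auto
  have gD: "g y \<in> D" for y using g_D by auto
  have "(\<forall>w\<in>D. ?m < w) \<or> (\<forall>w\<in>D. w < ?m)"
  proof (rule ccontr)
    assume "\<not> ?thesis"
    then obtain v w where "v \<in> D" "\<not> ?m < v" "w \<in> D" "\<not> w < ?m" by blast
    then have "?m \<in> D" using D_mem[of v w ?m] by simp
    with no show False ..
  qed
  then consider "\<forall>w\<in>D. ?m < w" | "\<forall>w\<in>D. w < ?m" by blast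
  then show False
  proof cases
    case 1
    then have "AE \<omega> in P (fst p) (snd p). ?m < g (X T \<omega>)" using gD by auto
    from Q.expectation_greater[OF i this] show False by (simp add: mean_def)
  next
    case 2
    then have "AE \<omega> in P (fst p) (snd p). g (X T \<omega>) < ?m" using gD by auto
    from Q.expectation_less[OF i this] show False by (simp add: mean_def)
  qed
qed

context
  fixes l N R
  assumes l: "dominating l" and N: "N \<in> null_sets \<mu>"
    and reg: "\<And>s. s \<in> {0..T} \<Longrightarrow> s \<notin> N \<Longrightarrow> regular_on (- R) R l s"
begin

lemma l_pos:
  assumes "s \<in> {0..T}" "l s \<noteq> 0"
  shows "0 < l s"
proof -
  have "0 \<le> l s" using l assms(1) unfolding dominating_def by blast
  with assms(2) show ?thesis by linarith
qed

lemma markov_time_measure_nu: "markov_time_measure T d M F X P (nu l)"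
  by (rule markov_time_measure.intro[OF markov_time_space_axioms density_time_measure[OF l]])

lemma lipschitz_driver_drv: "lipschitz_driver T d M F X P (nu l) D (drv N l) R"
proof (rule lipschitz_driver.intro[OF markov_time_measure_nu], unfold_locales)
  have N': "N \<in> sets BT" using N by (auto simp: mu_borel)
  have l': "l \<in> borel_measurable BT" using l by (simp add: dominating_def)
  let ?Q = "BTS \<Otimes>\<^sub>M restrict_space borel D"
  have fst2: "(\<lambda>z. fst (fst z)) \<in> ?Q \<rightarrow>\<^sub>M BT"
    by (rule measurable_compose[OF measurable_fst fst_measurable])
  have [measurable]: "(\<lambda>z. l (fst (fst z))) \<in> borel_measurable ?Q"
    by (rule measurable_compose[OF fst2 l'])
  have [measurable]: "(\<lambda>z. f (fst (fst z)) (snd (fst z)) (snd z)) \<in> borel_measurable ?Q"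
    using f_measurable by (simp add: case_prod_beta')
  have [measurable]: "Measurable.pred ?Q (\<lambda>z. fst (fst z) \<in> N)"
    using measurable_sets[OF fst2 N'] by (simp add: pred_def vimage_def Int_def conj_commute)
  show "(\<lambda>((t, x), w). drv N l t x w) \<in> borel_measurable ?Q"
    unfolding drv_def case_prod_beta' by measurable
next
  fix t w x assume t: "t \<in> {0..T}" and w: "w \<in> D" "\<bar>w\<bar> \<le> R"
  show "\<bar>drv N l t x w\<bar> \<le> 1"
  proof (cases "t \<in> N \<or> l t = 0")
    case False
    then have "\<bar>f t x w\<bar> \<le> l t" "0 < l t"
      using regular_onD(1)[OF reg[OF t] w(1), of x] w l_pos[OF t] by auto
    then show ?thesis using False by (simp add: drv_def abs_divide)
  qed (auto simp: drv_def)
next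
  fix t w w' x assume t: "t \<in> {0..T}" and w: "w \<in> D" "\<bar>w\<bar> \<le> R" "w' \<in> D" "\<bar>w'\<bar> \<le> R"
  show "\<bar>drv N l t x w - drv N l t x w'\<bar> \<le> \<bar>w - w'\<bar>"
  proof (cases "t \<in> N \<or> l t = 0")
    case False
    then have "\<bar>f t x w - f t x w'\<bar> \<le> l t * \<bar>w - w'\<bar>" and "0 < l t"
      using regular_onD(2)[OF reg[OF t] w(1), of w' x] w l_pos[OF t] by auto
    then have "\<bar>(f t x w - f t x w') / l t\<bar> \<le> \<bar>w - w'\<bar>"
      by (simp add: abs_divide pos_divide_le_eq mult.commute)
    then show ?thesis using False by (simp add: drv_def diff_divide_distrib)
  qed (auto simp: drv_def)
qed

interpretation V: lipschitz_driver T d M F X P "nu l" D "drv N l" R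
  by (rule lipschitz_driver_drv)

section \<open>Solutions of (M) and solutions of the backward equation\<close>

lemma fc_eq_hc:
  assumes u: "u \<in> V.driver_domain"
  shows "AE s in \<mu>. \<forall>x. fc u (s, x) = l s * V.hc u (s, x)"
  using AE_not_in[OF N] AE_space
proof eventually_elim
  case (elim s)
  then have s: "s \<in> {0..T}" by (simp add: space_mu)
  show ?case
  proof
    fix x
    have w: "u (s, x) \<in> D" "\<bar>u (s, x)\<bar> \<le> R" using u s by (auto simp: V.driver_domain_def)
    then have "\<bar>f s x (u (s, x))\<bar> \<le> l s"
      using regular_onD(1)[OF reg[OF s elim(1)] w(1), of x] by auto
    then show "fc u (s, x) = l s * V.hc u (s, x)"
      using elim(1) by (auto simp: fc_def V.hc_def drv_def)
  qed
qed

lemma fc_driver_measurable: "u \<in> V.driver_domain \<Longrightarrow> fc u \<in> borel_measurable BTS"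
  by (intro fc_measurable) (auto simp: V.driver_domain_def)

lemma fc_path_integral:
  assumes u: "u \<in> V.driver_domain" and r: "0 \<le> r" "r \<le> t" "t \<le> T" and \<omega>: "\<omega> \<in> space M"
  shows "set_integrable \<mu> {r..t} (\<lambda>s. \<bar>fc u (s, X s \<omega>)\<bar>)"
    and "(LINT s:{r..t}|\<mu>. \<bar>fc u (s, X s \<omega>)\<bar>) = (LINT s:{r<..t}|nu l. \<bar>V.hc u (s, X s \<omega>)\<bar>)"
    and "(LINT s:{r..t}|\<mu>. fc u (s, X s \<omega>)) = (LINT s:{r<..t}|nu l. V.hc u (s, X s \<omega>))"
proof -
  note b = V.hc_bounded_measurable[OF u]
  have b': "bounded_measurable 1 (\<lambda>p. \<bar>V.hc u p\<bar>)"
    using b by (auto simp: bounded_measurable_def)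
  have m': "(\<lambda>p. \<bar>fc u p\<bar>) \<in> borel_measurable BTS"
    using fc_driver_measurable[OF u] by measurable
  have ae: "AE s in \<mu>. \<forall>x. \<bar>fc u (s, x)\<bar> = l s * \<bar>V.hc u (s, x)\<bar>"
    using fc_eq_hc[OF u] AE_space
    by eventually_elim (use l in \<open>auto simp: abs_mult dominating_def space_mu\<close>)
  show "set_integrable \<mu> {r..t} (\<lambda>s. \<bar>fc u (s, X s \<omega>)\<bar>)"
    "(LINT s:{r..t}|\<mu>. \<bar>fc u (s, X s \<omega>)\<bar>) = (LINT s:{r<..t}|nu l. \<bar>V.hc u (s, X s \<omega>)\<bar>)"
    using path_integral_density[OF l m' b' ae r \<omega>] by auto
  show "(LINT s:{r..t}|\<mu>. fc u (s, X s \<omega>)) = (LINT s:{r<..t}|nu l. V.hc u (s, X s \<omega>))"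
    by (rule path_integral_density(2)[OF l fc_driver_measurable[OF u] b fc_eq_hc[OF u] r \<omega>])
qed

lemma fc_expectation:
  assumes u: "u \<in> V.driver_domain" and r: "0 \<le> r" "r \<le> t" "t \<le> T"
  shows "(\<integral>\<omega>. (LINT s:{r..t}|\<mu>. fc u (s, X s \<omega>)) \<partial>P r x) = (LINT s:{r<..t}|nu l. V.fmean (V.hc u) (r, x) s)"
    and "integrable (P r x) (\<lambda>\<omega>. LINT s:{r..t}|\<mu>. \<bar>fc u (s, X s \<omega>)\<bar>)"
proof -
  have rT: "r \<in> {0..T}" using r by auto
  note b = V.hc_bounded_measurable[OF u]
  have b': "bounded_measurable 1 (\<lambda>p. \<bar>V.hc u p\<bar>)"
    using b by (auto simp: bounded_measurable_def)
  have "(\<integral>\<omega>. (LINT s:{r..t}|\<mu>. fc u (s, X s \<omega>)) \<partial>P r x) = (\<integral>\<omega>. (LINT s:{r<..t}|nu l. V.hc u (s, X s \<omega>)) \<partial>P r x)"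
    by (intro Bochner_Integration.integral_cong refl fc_path_integral(3)[OF u r]) (simp add: space_P[OF rT])
  then show "(\<integral>\<omega>. (LINT s:{r..t}|\<mu>. fc u (s, X s \<omega>)) \<partial>P r x) = (LINT s:{r<..t}|nu l. V.fmean (V.hc u) (r, x) s)"
    using V.path_integral(1)[OF b r] by simp
  show "integrable (P r x) (\<lambda>\<omega>. LINT s:{r..t}|\<mu>. \<bar>fc u (s, X s \<omega>)\<bar>)"
    by (rule Bochner_Integration.integrable_cong[THEN iffD2, OF refl _ V.path_integral(2)[OF b' r]])
       (simp add: space_P[OF rT] fc_path_integral(2)[OF u r])
qed

lemma solution_of_backward_equation:
  assumes u: "u \<in> V.driver_domain" and cons: "pm_consistent TS d u" and C: "\<And>x. \<bar>g x\<bar> \<le> C"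
    and eq: "\<And>r x. r \<in> {0..T} \<Longrightarrow> u (r, x) = mean (\<lambda>p. g (snd p)) T (r, x) - (LINT s:{r<..T}|nu l. V.fmean (V.hc u) (r, x) s)"
  shows "solution_M T \<mu> d M X P D f g {0..T} u"
  unfolding solution_M_def
proof (intro conjI ballI impI allI)
  show "admissible_interval T {0..T}"
    unfolding admissible_interval_def using T_pos by (intro exI[of _ 0]) auto
  show "u \<in> borel_measurable BTS" "u ` TS \<subseteq> D" using u by (auto simp: V.driver_domain_def)
  show "pm_consistent TS d u" by (rule cons)
  show "u (T, x) = g x" for x
    using eq[of T x] mean_g_end[of x] T_pos by (simp add: set_lebesgue_integral_def)
next
  fix r t and x :: 's assume r: "r \<in> {0..T}" and t: "t \<in> {0..T}" and rt: "r \<le> t"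
  have r': "0 \<le> r" "r \<le> t" "t \<le> T" using r t rt by auto
  note bu = V.driver_domain_bounded[OF u]
  show "integrable (P r x) (\<lambda>\<omega>. \<bar>u (t, X t \<omega>)\<bar>)"
    by (intro integrable_abs mean_integrable[OF bounded_measurable_slices[OF bu] t r])
  show "set_integrable \<mu> {r..t} (\<lambda>s. \<bar>f s (X s \<omega>) (u (s, X s \<omega>))\<bar>)" if "\<omega> \<in> space M" for \<omega>
    using fc_path_integral(1)[OF u r' that] by (simp add: fc_def)
  show "integrable (P r x) (\<lambda>\<omega>. LINT s:{r..t}|\<mu>. \<bar>f s (X s \<omega>) (u (s, X s \<omega>))\<bar>)"
    using fc_expectation(2)[OF u r'] by (simp add: fc_def)
  have "mean u t (r, x) = u (r, x) + (LINT s:{r<..t}|nu l. V.fmean (V.hc u) (r, x) s)"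
    by (rule V.mean_backward_equation[OF g_slices[OF C] V.hc_bounded_measurable[OF u] eq r]) (use r' in auto)
  then show "(\<integral>\<omega>. u (t, X t \<omega>) \<partial>P r x)
      = u (r, x) + (\<integral>\<omega>. (LINT s:{r..t}|\<mu>. f s (X s \<omega>) (u (s, X s \<omega>))) \<partial>P r x)"
    using fc_expectation(1)[OF u r', of x] by (simp add: fc_def mean_def)
qed

text \<open>A local solution is continued to earlier times by one of its own values, which keeps it
  in \<open>D\<close> and below \<open>R\<close>. The equation at a time from \<open>r0\<close> on
  involves only later times and is not affected, so the results for functions on all of time-space
  apply.\<close>

lemma backward_equation_of_solution:
  assumes sol: "solution_M T \<mu> d M X P D f g I u" and r0: "r0 \<in> I"
    and bd: "\<And>r x. r \<in> {r0..T} \<Longrightarrow> \<bar>u (r, x)\<bar> \<le> R"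
  defines "u' \<equiv> (\<lambda>p. if p \<in> {r0..T} \<times> UNIV then u p else u (r0, undefined))"
  shows "u' \<in> V.driver_domain"
    and "r \<in> {r0..T} \<Longrightarrow> u' (r, x) = mean (\<lambda>p. g (snd p)) T (r, x) - (LINT s:{r<..T}|nu l. V.fmean (V.hc u') (r, x) s)"
proof -
  obtain t0 where "0 \<le> t0" "t0 < T" "I = {t0<..T} \<or> I = {t0..T}"
    using sol unfolding solution_M_def admissible_interval_def by blast
  then have I: "I \<subseteq> {0..T}" "{r0..T} \<subseteq> I" "T \<in> I" using r0 by auto
  have r0T: "0 \<le> r0" "r0 \<le> T" using r0 I(1) by auto
  have uD: "u (r, x) \<in> D" if "r \<in> {r0..T}" for r x
  proof -
    have "u ` (I \<times> UNIV) \<subseteq> D" using sol by (simp add: solution_M_def)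
    moreover have "(r, x) \<in> I \<times> UNIV" using that I(2) by auto
    ultimately show ?thesis by blast
  qed
  have meas: "u' \<in> borel_measurable BTS"
  proof -
    have pmI: "pseudometric_on (I \<times> UNIV) d" by (rule pseudometric_on_subset[OF pm]) (use I in auto)
    have "u \<in> borel_measurable (pm_borel (I \<times> UNIV) d)" using sol by (simp add: solution_M_def)
    from measurable_compose[OF pm_borel_inclusion_measurable[OF pmI, of "{r0..T} \<times> UNIV"] this]
    have "u \<in> borel_measurable (pm_borel ({r0..T} \<times> UNIV) d)" using I by auto
    moreover have "sets (pm_borel ({r0..T} \<times> UNIV) d) = sets (restrict_space BTS ({r0..T} \<times> UNIV))"
      using r0T by (intro sets_pm_borel_slab) auto
    ultimately have m: "u \<in> borel_measurable (restrict_space BTS ({r0..T} \<times> UNIV))"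
      using measurable_cong_sets[OF _ refl] by blast
    have S: "{r0..T} \<times> UNIV \<in> sets BTS" using r0T by (intro slab_measurable) auto
    have "{p \<in> space BTS. p \<in> {r0..T} \<times> UNIV} = {r0..T} \<times> UNIV" using r0T by auto
    then show ?thesis
      unfolding u'_def using m S by (subst measurable_If_restrict_space_iff) auto
  qed
  show dom: "u' \<in> V.driver_domain"
    unfolding V.driver_domain_def using meas uD bd r0T by (auto simp: u'_def)
  show "u' (r, x) = mean (\<lambda>p. g (snd p)) T (r, x) - (LINT s:{r<..T}|nu l. V.fmean (V.hc u') (r, x) s)"
    if r: "r \<in> {r0..T}"
  proof -
    have r': "0 \<le> r" "r \<le> T" "r \<in> {0..T}" "r \<in> I" using r r0T I by auto
    have "(\<integral>\<omega>. u (T, X T \<omega>) \<partial>P r x)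
        = u (r, x) + (\<integral>\<omega>. (LINT s:{r..T}|\<mu>. f s (X s \<omega>) (u (s, X s \<omega>))) \<partial>P r x)"
      using sol r'(2,4) I(3) unfolding solution_M_def by blast
    moreover have "(\<integral>\<omega>. u (T, X T \<omega>) \<partial>P r x) = mean (\<lambda>p. g (snd p)) T (r, x)"
      using sol unfolding solution_M_def by (simp add: mean_def)
    moreover have "(LINT s:{r..T}|\<mu>. f s (X s \<omega>) (u (s, X s \<omega>))) = (LINT s:{r..T}|\<mu>. fc u' (s, X s \<omega>))" for \<omega>
      using r r' by (intro set_lebesgue_integral_cong) (auto simp: fc_def u'_def intro!: set_mu_nu)
    ultimately show ?thesis
      using fc_expectation(1)[OF dom r'(1,2) order_refl, of x] r by (simp add: u'_def)
  qed
qed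

end

text \<open>The range \<open>R\<close>, and with it the density \<open>l\<close>, is fitted to the
  two given solutions. Uniqueness thus holds among all bounded solutions, with no a priori bound and
  on any common interval.\<close>

lemma bounded_solutions_agree:
  assumes solu: "solution_M T \<mu> d M X P D f g I u" and solv: "solution_M T \<mu> d M X P D f g J v"
    and r0: "r0 \<in> I" "r0 \<in> J"
    and bu: "bounded (u ` ({r0..T} \<times> UNIV))" and bv: "bounded (v ` ({r0..T} \<times> UNIV))"
    and r: "r \<in> {r0..T}"
  shows "u (r, x) = v (r, x)"
proof -
  obtain Ru where Ru: "\<forall>y\<in>u ` ({r0..T} \<times> UNIV). norm y \<le> Ru" using bu unfolding bounded_iff by blast
  obtain Rv where Rv: "\<forall>y\<in>v ` ({r0..T} \<times> UNIV). norm y \<le> Rv" using bv unfolding bounded_iff by blast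
  define R where "R = max Ru Rv"
  have R: "\<bar>u (r, x)\<bar> \<le> R" "\<bar>v (r, x)\<bar> \<le> R" if "r \<in> {r0..T}" for r x
  proof -
    have "(r, x) \<in> {r0..T} \<times> UNIV" using that by simp
    then have "norm (u (r, x)) \<le> Ru" "norm (v (r, x)) \<le> Rv" using Ru Rv by blast+
    then show "\<bar>u (r, x)\<bar> \<le> R" "\<bar>v (r, x)\<bar> \<le> R" by (simp_all add: R_def)
  qed
  have "0 \<le> R" using R(1)[OF r, of undefined] by linarith
  then obtain l where l: "dominating l" and "AE s in \<mu>. regular_on (- R) R l s"
    using compact_dominator[of "- R" R] by auto
  then obtain N where N: "N \<in> null_sets \<mu>" "{s\<in>space \<mu>. \<not> regular_on (- R) R l s} \<subseteq> N"
    unfolding eventually_ae_filter by blast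
  then have reg: "regular_on (- R) R l s" if "s \<in> {0..T}" "s \<notin> N" for s
    using that by (auto simp: space_mu)
  interpret V: lipschitz_driver T d M F X P "nu l" D "drv N l" R
    by (rule lipschitz_driver_drv[OF l N(1) reg])
  note eu = backward_equation_of_solution[OF l N(1) reg solu r0(1) R(1)]
    and ev = backward_equation_of_solution[OF l N(1) reg solv r0(2) R(2)]
  have "0 \<le> r0" using solu r0(1) unfolding solution_M_def admissible_interval_def by auto
  from V.backward_equation_unique[OF eu(1) ev(1) this eu(2) ev(2) r, of x]
  show ?thesis using r by simp
qed

end

section \<open>Invariant bands\<close>

text \<open>An end of \<open>D\<close> may lie outside \<open>D\<close>, where \<open>f\<close> has
  no meaningful value. The one-sided limit takes its place, and the Lipschitz estimate passes to the
  limit.\<close>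

lemma lipschitz_tendsto_bound:
  fixes \<phi> :: "real \<Rightarrow> real"
  assumes "(\<phi> \<longlongrightarrow> L) F" "((\<lambda>w. w) \<longlongrightarrow> b) F" "F \<noteq> bot"
    and "\<forall>\<^sub>F w' in F. \<bar>\<phi> w - \<phi> w'\<bar> \<le> l * \<bar>w - w'\<bar>"
  shows "\<bar>\<phi> w - L\<bar> \<le> l * \<bar>w - b\<bar>"
proof (rule tendsto_le[OF assms(3)])
  show "((\<lambda>w'. l * \<bar>w - w'\<bar>) \<longlongrightarrow> l * \<bar>w - b\<bar>) F"
    by (intro tendsto_intros assms(2))
  show "((\<lambda>w'. \<bar>\<phi> w - \<phi> w'\<bar>) \<longlongrightarrow> \<bar>\<phi> w - L\<bar>) F"
    by (intro tendsto_intros assms(1))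
qed (rule assms(4))

context markov_time_measure begin

lemma lin_uminus: "lin (\<lambda>p. - g p) (\<lambda>p. - H p) p = - lin g H p"
proof -
  have "mean (\<lambda>p. - g p) T p = - mean g T p" by (simp add: mean_def)
  moreover have "fmean (\<lambda>p. - H p) p s = - fmean H p s" for s
    by (simp add: fmean_def mean_def)
  ultimately show ?thesis
    by (simp add: lin_alt set_lebesgue_integral_def)
qed

lemma fmean_deterministic: "p \<in> TS \<Longrightarrow> s > fst p \<Longrightarrow> fmean (\<lambda>p. k (fst p)) p s = k s"
  using mean_deterministic[of p "\<lambda>p. k (fst p)" s "k s"] by (auto simp: fmean_def)

lemma discount_factor:
  assumes "r \<in> {0..T}"
  shows "0 < exp (clock r - clock T)" "exp (clock r - clock T) \<le> 1" "exp (- clock T) \<le> exp (clock r - clock T)"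
  using clock_mono[of r T] clock_nonneg[of r] assms by auto

end

text \<open>The constants are to be chosen in the order \<open>\<kappa>\<close>, \<open>C\<close>,
  \<open>R\<close>, \<open>l\<close>: the value of \<open>R\<close> is one more than the largest
  value of the growth band, computed with the clock of \<open>\<kappa>\<close> only. All almost sure
  conditions are collected in one null set \<open>N\<close>. Continuity of \<open>f\<close> enters
  as an implication, so that the same \<open>N\<close> serves existence as well as
  regularity.\<close>

locale dominated_problem = semilinear_problem T d M F X P \<mu> D f g
  for T :: real and d :: "('s::{metric_space, second_countable_topology}) pm"
    and M :: "'o measure" and F :: "real \<Rightarrow> 'o measure"
    and X :: "real \<Rightarrow> 'o \<Rightarrow> 's" and P :: "real \<Rightarrow> 's \<Rightarrow> 'o measure"
    and \<mu> D f g +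
  fixes \<kappa> l :: "real \<Rightarrow> real" and N :: "real set" and C R :: real
  assumes kappa: "dominating \<kappa>" and l: "dominating l"
    and kappa_le: "s \<in> {0..T} \<Longrightarrow> \<kappa> s \<le> l s"
    and g_le: "\<bar>g x\<bar> \<le> C"
    and lower_le: "lower_end D > - \<infinity> \<Longrightarrow> \<bar>real_of_ereal (lower_end D)\<bar> \<le> C"
    and upper_le: "upper_end D < \<infinity> \<Longrightarrow> \<bar>real_of_ereal (upper_end D)\<bar> \<le> C"
    and R_eq: "R = (C + 1) * exp (time_measure.clock T (nu \<kappa>) T)"
    and N: "N \<in> null_sets \<mu>"
    and regular: "s \<in> {0..T} \<Longrightarrow> s \<notin> N \<Longrightarrow> regular_on (- R) R l s"
    and affine_lower: "upper_end D = \<infinity> \<Longrightarrow> s \<in> {0..T} \<Longrightarrow> s \<notin> N \<Longrightarrow> w \<in> D \<Longrightarrow> - (\<kappa> s * (1 + \<bar>w\<bar>)) \<le> f s x w"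
    and affine_upper: "lower_end D = -\<infinity> \<Longrightarrow> s \<in> {0..T} \<Longrightarrow> s \<notin> N \<Longrightarrow> w \<in> D \<Longrightarrow> f s x w \<le> \<kappa> s * (1 + \<bar>w\<bar>)"
    and limit_lower: "lower_end D > -\<infinity> \<Longrightarrow> s \<in> {0..T} \<Longrightarrow> s \<notin> N \<Longrightarrow>
      \<exists>L\<le>0. (f s x \<longlongrightarrow> L) (at_right (real_of_ereal (lower_end D)))"
    and limit_upper: "upper_end D < \<infinity> \<Longrightarrow> s \<in> {0..T} \<Longrightarrow> s \<notin> N \<Longrightarrow>
      \<exists>L\<ge>0. (f s x \<longlongrightarrow> L) (at_left (real_of_ereal (upper_end D)))"
    and continuous_outside: "(AE s in \<mu>. continuous_on (UNIV \<times> D) (\<lambda>(x, w). f s x w)) \<Longrightarrow> s \<in> {0..T} \<Longrightarrow> s \<notin> N \<Longrightarrow>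
      continuous_on (UNIV \<times> D) (\<lambda>(x, w). f s x w)"
begin

sublocale K: time_measure T "nu \<kappa>" by (rule density_time_measure[OF kappa])

sublocale V: lipschitz_driver T d M F X P "nu l" D "drv N l" R
  by (rule lipschitz_driver_drv[OF l N regular])

abbreviation a where "a \<equiv> real_of_ereal (lower_end D)"
abbreviation b where "b \<equiv> real_of_ereal (upper_end D)"
abbreviation g' where "g' \<equiv> \<lambda>p :: real \<times> 's. g (snd p)"

lemma C_nonneg: "0 \<le> C" using g_le[of undefined] by linarith

lemma kappa_nonneg: "s \<in> {0..T} \<Longrightarrow> 0 \<le> \<kappa> s" and l_nonneg': "s \<in> {0..T} \<Longrightarrow> 0 \<le> l s"
  using kappa l unfolding dominating_def by blast+

text \<open>\<open>grow\<close> solves \<open>- grow' = \<kappa> (1 + grow)\<close>, \<open>grow T = C\<close>, with respect to \<open>\<mu>\<close>.\<close>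

definition grow :: "real \<Rightarrow> real" where
  "grow s = (C + 1) * exp (K.clock T - K.clock s) - 1"

text \<open>\<open>grow\<close> plus its rate of decrease in the clock of \<open>nu l\<close>, so
  that \<open>lin\<close> with terminal value \<open>C\<close> returns \<open>grow\<close>. The
  quotient \<open>\<kappa> / l\<close> converts one clock into the other; where \<open>l\<close>
  vanishes so does \<open>\<kappa>\<close>, and the convention for division by zero is
  harmless.\<close>

definition grow_source :: "real \<Rightarrow> real" where
  "grow_source s = grow s + \<kappa> s / l s * (1 + grow s)"

lemma grow_bounds:
  assumes "s \<in> {0..T}"
  shows "C \<le> grow s" "grow s \<le> R - 1"
proof -
  have "(C + 1) * 1 \<le> (C + 1) * exp (K.clock T - K.clock s)"
    using assms K.clock_mono[of s T] C_nonneg by (intro mult_left_mono) auto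
  then show "C \<le> grow s" by (simp add: grow_def)
  show "grow s \<le> R - 1"
    using K.clock_nonneg[of s] C_nonneg by (simp add: grow_def R_eq)
qed

lemma C_less_R: "C < R"
  using grow_bounds[of T] T_pos by auto

lemma quotient_bounds:
  assumes "s \<in> {0..T}" shows "0 \<le> \<kappa> s / l s" "\<kappa> s / l s \<le> 1"
  using kappa_nonneg[OF assms] kappa_le[OF assms] by (auto simp: divide_le_eq_1 order_less_le)

lemma grow_source_bounds:
  assumes s: "s \<in> {0..T}"
  shows "grow s \<le> grow_source s" "grow_source s \<le> 2 * R"
proof -
  have "0 \<le> 1 + grow s" "1 + grow s \<le> R" using grow_bounds[OF s] C_nonneg by linarith+
  then have "0 \<le> \<kappa> s / l s * (1 + grow s)" "\<kappa> s / l s * (1 + grow s) \<le> 1 * R"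
    using quotient_bounds[OF s] by (intro mult_nonneg_nonneg mult_mono; simp)+
  then show "grow s \<le> grow_source s" "grow_source s \<le> 2 * R"
    using grow_bounds[OF s] by (auto simp: grow_source_def)
qed

lemma grow_measurable: "grow \<in> borel_measurable BT" "grow_source \<in> borel_measurable BT"
proof -
  have [measurable]: "(\<lambda>s. s) \<in> borel_measurable BT" by (simp add: measurable_restrict_space1)
  have [measurable]: "K.clock \<in> borel_measurable BT"
    using measurable_compose[OF _ K.clock_borel] by simp
  have [measurable]: "\<kappa> \<in> borel_measurable BT" "l \<in> borel_measurable BT"
    using kappa l by (auto simp: dominating_def)
  show [measurable]: "grow \<in> borel_measurable BT" unfolding grow_def by measurable
  show "grow_source \<in> borel_measurable BT" unfolding grow_source_def by measurable
qed

lemma time_function_bounded_measurable: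
  assumes "k \<in> borel_measurable BT" "\<And>s. s \<in> {0..T} \<Longrightarrow> \<bar>k s\<bar> \<le> L"
  shows "bounded_measurable L (\<lambda>p. k (fst p))"
  unfolding bounded_measurable_def using measurable_compose[OF fst_measurable assms(1)] assms(2) by auto

lemma grow_bounded_measurable: "bounded_measurable (2 * R) (\<lambda>p. grow (fst p))"
  "bounded_measurable (2 * R) (\<lambda>p. grow_source (fst p))"
proof -
  have "\<bar>grow s\<bar> \<le> 2 * R" "\<bar>grow_source s\<bar> \<le> 2 * R" if "s \<in> {0..T}" for s
    using grow_bounds[OF that] grow_source_bounds[OF that] C_nonneg by auto
  then show "bounded_measurable (2 * R) (\<lambda>p. grow (fst p))" "bounded_measurable (2 * R) (\<lambda>p. grow_source (fst p))"
    by (intro time_function_bounded_measurable grow_measurable; blast)+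
qed

lemma constant_slices: "bounded_slices C (\<lambda>_. C)"
  using C_nonneg by (simp add: bounded_slices_def)

text \<open>The quotient turns \<open>nu l\<close> into \<open>nu \<kappa>\<close> by way of
  \<open>\<mu>\<close>, and in the clock of \<open>\<kappa>\<close> the function
  \<open>1 + grow\<close> is a plain exponential.\<close>

lemma grow_equation:
  assumes r: "r \<in> {0..T}"
  shows "(LINT s:{r<..T}|nu l. \<kappa> s / l s * (1 + grow s)) = grow r - C"
proof -
  have J: "{r<..T} \<in> sets \<mu>" using r by (intro set_mu_nu) auto
  have m: "(\<lambda>s. \<kappa> s / l s * (1 + grow s)) \<in> borel_measurable \<mu>" "(\<lambda>s. 1 + grow s) \<in> borel_measurable \<mu>"
    using kappa l grow_measurable(1) unfolding measurable_mu dominating_def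
    by (auto intro!: borel_measurable_times borel_measurable_divide borel_measurable_add)
  have "(LINT s:{r<..T}|nu l. \<kappa> s / l s * (1 + grow s)) = (LINT s:{r<..T}|\<mu>. l s * (\<kappa> s / l s * (1 + grow s)))"
    by (rule density_integral(1)[OF l m(1) J])
  also have "\<dots> = (LINT s:{r<..T}|\<mu>. \<kappa> s * (1 + grow s))"
  proof (rule set_lebesgue_integral_cong[OF J], intro allI impI)
    fix s assume "s \<in> {r<..T}"
    then have s: "s \<in> {0..T}" using r by auto
    show "l s * (\<kappa> s / l s * (1 + grow s)) = \<kappa> s * (1 + grow s)"
      using kappa_nonneg[OF s] kappa_le[OF s] by (cases "l s = 0") auto
  qed
  also have "\<dots> = (LINT s:{r<..T}|nu \<kappa>. 1 + grow s)"
    by (rule density_integral(1)[OF kappa m(2) J, symmetric])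
  also have "\<dots> = (LINT s:{r<..T}|nu \<kappa>. ((C + 1) * exp (K.clock T)) * exp (-1 * K.clock s))"
    by (rule arg_cong[where f="\<lambda>h. set_lebesgue_integral _ _ h"]) (simp add: grow_def exp_diff exp_minus field_simps)
  also have "\<dots> = ((C + 1) * exp (K.clock T)) * ((exp (-1 * K.clock T) - exp (-1 * K.clock r)) / (-1))"
    unfolding set_integral_mult_right by (subst K.integral_exp_clock) (use r in auto)
  also have "\<dots> = grow r - C"
    by (simp add: grow_def exp_diff exp_minus field_simps)
  finally show ?thesis .
qed

lemma grow_lin:
  assumes p: "p \<in> TS"
  shows "V.lin (\<lambda>_. C) (\<lambda>p. grow_source (fst p)) p = grow (fst p)"
proof -
  obtain r x where rx: "p = (r, x)" by (cases p)
  have "grow (fst (r, x)) = V.lin (\<lambda>_. C) (\<lambda>p. grow_source (fst p)) (r, x)"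
  proof (rule V.lin_unique[OF constant_slices grow_bounded_measurable(2,1)])
    fix r and x :: 's assume r: "r \<in> {0..T}"
    then have q: "(r, x) \<in> TS" and J: "{r<..T} \<in> sets (nu l)" by (auto intro: set_mu_nu)
    note i = V.set_integrable_fmean1[OF grow_bounded_measurable(1) q J] V.set_integrable_fmean1[OF grow_bounded_measurable(2) q J]
    have "(LINT s:{r<..T}|nu l. V.fmean (\<lambda>p. grow_source (fst p)) (r, x) s)
        - (LINT s:{r<..T}|nu l. V.fmean (\<lambda>p. grow (fst p)) (r, x) s)
        = (LINT s:{r<..T}|nu l. V.fmean (\<lambda>p. grow_source (fst p)) (r, x) s - V.fmean (\<lambda>p. grow (fst p)) (r, x) s)"
      by (rule set_integral_diff(2)[OF i(2,1), symmetric])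
    also have "\<dots> = (LINT s:{r<..T}|nu l. \<kappa> s / l s * (1 + grow s))"
    proof (rule set_lebesgue_integral_cong[OF J], intro allI impI)
      fix s assume "s \<in> {r<..T}"
      then have "fst (r, x) < s" by simp
      from V.fmean_deterministic[OF q this, of grow] V.fmean_deterministic[OF q this, of grow_source]
      show "V.fmean (\<lambda>p. grow_source (fst p)) (r, x) s - V.fmean (\<lambda>p. grow (fst p)) (r, x) s = \<kappa> s / l s * (1 + grow s)"
        by (simp only: grow_source_def[of s])
    qed
    also have "\<dots> = grow r - C" by (rule grow_equation[OF r])
    finally show "grow (fst (r, x)) = mean (\<lambda>_. C) T (r, x)
        + (LINT s:{r<..T}|nu l. V.fmean (\<lambda>p. grow_source (fst p)) (r, x) s)
        - (LINT s:{r<..T}|nu l. V.fmean (\<lambda>p. grow (fst p)) (r, x) s)"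
      using r V.mean_deterministic[of "(r, x)" "\<lambda>_. C" T C] by simp
  qed (use p rx in auto)
  then show ?thesis by (simp add: rx)
qed

section \<open>Linear solutions that stay inside D\<close>

lemma g'_slices: "bounded_slices C g'"
  by (rule g_slices[OF g_le])

lemma constant_bounded_measurable: "\<bar>c\<bar> \<le> 2 * R \<Longrightarrow> bounded_measurable (2 * R) (\<lambda>_. c)"
  by (simp add: bounded_measurable_def)

lemma lin_g'_constant:
  "p \<in> TS \<Longrightarrow> V.lin g' (\<lambda>_. c) p
     = exp (V.clock (fst p) - V.clock T) * mean g' T p + (1 - exp (V.clock (fst p) - V.clock T)) * c"
  by (rule V.lin_constant[OF refl])

lemma lin_constant_le:
  assumes p: "p \<in> TS"
  shows "mean g' T p \<le> c \<Longrightarrow> mean g' T p \<le> V.lin g' (\<lambda>_. c) p \<and> V.lin g' (\<lambda>_. c) p \<le> c"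
    and "c \<le> mean g' T p \<Longrightarrow> c \<le> V.lin g' (\<lambda>_. c) p \<and> V.lin g' (\<lambda>_. c) p \<le> mean g' T p"
proof -
  define e where "e = exp (V.clock (fst p) - V.clock T)"
  have e: "0 < e" "e \<le> 1" using V.discount_factor[of "fst p"] p by (auto simp: e_def)
  have eq: "V.lin g' (\<lambda>_. c) p = e * mean g' T p + (1 - e) * c"
    unfolding e_def by (rule lin_g'_constant[OF p])
  show "mean g' T p \<le> c \<Longrightarrow> mean g' T p \<le> V.lin g' (\<lambda>_. c) p \<and> V.lin g' (\<lambda>_. c) p \<le> c"
    using mult_left_mono[of "mean g' T p" c e] mult_left_mono[of "mean g' T p" c "1 - e"] e
    unfolding eq by (simp add: algebra_simps)
  show "c \<le> mean g' T p \<Longrightarrow> c \<le> V.lin g' (\<lambda>_. c) p \<and> V.lin g' (\<lambda>_. c) p \<le> mean g' T p"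
    using mult_left_mono[of c "mean g' T p" e] mult_left_mono[of c "mean g' T p" "1 - e"] e
    unfolding eq by (simp add: algebra_simps)
qed

lemma mean_g'_bound: "p \<in> TS \<Longrightarrow> \<bar>mean g' T p\<bar> \<le> C"
  using mean_bound[OF g'_slices, of T p] T_pos by auto

lemma mean_g'_D: "p \<in> TS \<Longrightarrow> mean g' T p \<in> D"
  by (rule mean_in_D) auto

text \<open>The value lies between the mean of \<open>g\<close>, which is in \<open>D\<close>, and
  \<open>b\<close>. Strictly below \<open>b\<close> it is therefore in \<open>D\<close>. If it
  equals \<open>b\<close>, the positive share of the mean in the convex combination forces the mean
  to equal \<open>b\<close>, and then \<open>b\<close> itself belongs to \<open>D\<close>.\<close>

lemma upper_finite_band:
  assumes fin: "upper_end D < \<infinity>" and p: "p \<in> TS"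
  shows "V.lin g' (\<lambda>_. b) p \<le> b" "V.lin g' (\<lambda>_. b) p \<in> D"
proof -
  obtain b' where b': "b = b'" "\<And>w. w \<in> D \<Longrightarrow> w \<le> b'" "\<And>v. v < b' \<Longrightarrow> \<exists>w\<in>D. v < w"
    using upper_end_real[OF fin] by metis
  have m: "mean g' T p \<le> b" using b'(2)[OF mean_g'_D[OF p]] b'(1) by simp
  note le = lin_constant_le(1)[OF p m]
  show "V.lin g' (\<lambda>_. b) p \<le> b" using le by simp
  show "V.lin g' (\<lambda>_. b) p \<in> D"
  proof (cases "V.lin g' (\<lambda>_. b) p < b")
    case True
    then obtain w where "w \<in> D" "V.lin g' (\<lambda>_. b) p < w" using b'(1,3) by blast
    then show ?thesis using D_mem[OF mean_g'_D[OF p], of w] le by simp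
  next
    case False
    then have "exp (V.clock (fst p) - V.clock T) * (mean g' T p - b) = 0"
      using le lin_g'_constant[OF p, of b] by (simp add: algebra_simps)
    then have "mean g' T p = b" by simp
    then have "V.lin g' (\<lambda>_. b) p = mean g' T p" using le by linarith
    then show ?thesis using mean_g'_D[OF p] by simp
  qed
qed

lemma lower_finite_band:
  assumes fin: "lower_end D > -\<infinity>" and p: "p \<in> TS"
  shows "a \<le> V.lin g' (\<lambda>_. a) p" "V.lin g' (\<lambda>_. a) p \<in> D"
proof -
  obtain a' where a': "a = a'" "\<And>w. w \<in> D \<Longrightarrow> a' \<le> w" "\<And>v. a' < v \<Longrightarrow> \<exists>w\<in>D. w < v"
    using lower_end_real[OF fin] by metis
  have m: "a \<le> mean g' T p" using a'(2)[OF mean_g'_D[OF p]] a'(1) by simp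
  note le = lin_constant_le(2)[OF p m]
  show "a \<le> V.lin g' (\<lambda>_. a) p" using le by simp
  show "V.lin g' (\<lambda>_. a) p \<in> D"
  proof (cases "a < V.lin g' (\<lambda>_. a) p")
    case True
    then obtain w where "w \<in> D" "w < V.lin g' (\<lambda>_. a) p" using a'(1,3) by blast
    then show ?thesis using D_mem[OF _ mean_g'_D[OF p], of w] le by simp
  next
    case False
    then have "exp (V.clock (fst p) - V.clock T) * (mean g' T p - a) = 0"
      using le lin_g'_constant[OF p, of a] by (simp add: algebra_simps)
    then have "mean g' T p = a" by simp
    then have "V.lin g' (\<lambda>_. a) p = mean g' T p" using le by linarith
    then show ?thesis using mean_g'_D[OF p] by simp
  qed
qed

lemma upper_infinite_mem: "upper_end D = \<infinity> \<Longrightarrow> v \<in> D \<Longrightarrow> v \<le> z \<Longrightarrow> z \<in> D"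
  using upper_end_greater[of z D] D_mem[of v _ z] by (auto intro: less_imp_le)

lemma lower_infinite_mem: "lower_end D = -\<infinity> \<Longrightarrow> v \<in> D \<Longrightarrow> z \<le> v \<Longrightarrow> z \<in> D"
  using lower_end_less[of D z] D_mem[of _ v z] by (auto intro: less_imp_le)

text \<open>Enlarging the terminal value to \<open>C\<close> turns the linear solution into
  \<open>grow\<close>. For membership in \<open>D\<close>, which is unbounded above, a lower bound
  in \<open>D\<close> is enough: \<open>grow_source\<close> is at least \<open>C\<close>, so the
  solution dominates the mean of \<open>g\<close>.\<close>

lemma upper_infinite_band:
  assumes inf: "upper_end D = \<infinity>" and p: "p \<in> TS"
  shows "V.lin g' (\<lambda>p. grow_source (fst p)) p \<le> grow (fst p)" "V.lin g' (\<lambda>p. grow_source (fst p)) p \<in> D"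
proof -
  have "V.lin g' (\<lambda>p. grow_source (fst p)) p \<le> V.lin (\<lambda>_. C) (\<lambda>p. grow_source (fst p)) p"
    using g_le by (intro V.lin_mono[OF g'_slices constant_slices grow_bounded_measurable(2) grow_bounded_measurable(2) _ _ p])
      (auto intro: abs_le_D1)
  then show "V.lin g' (\<lambda>p. grow_source (fst p)) p \<le> grow (fst p)" by (simp add: grow_lin[OF p])
  have "mean g' T p \<le> V.lin g' (\<lambda>_. C) p"
    using lin_constant_le(1)[OF p, of C] mean_g'_bound[OF p] by auto
  also have "\<dots> \<le> V.lin g' (\<lambda>p. grow_source (fst p)) p"
  proof (rule V.lin_mono[OF g'_slices g'_slices constant_bounded_measurable grow_bounded_measurable(2) _ _ p])
    show "\<bar>C\<bar> \<le> 2 * R" using C_nonneg C_less_R by simp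
    show "C \<le> grow_source (fst (s, y))" if "s \<in> {0..T}" for s and y :: 's
      using grow_bounds(1)[OF that] grow_source_bounds(1)[OF that] by simp
  qed simp
  finally show "V.lin g' (\<lambda>p. grow_source (fst p)) p \<in> D"
    by (rule upper_infinite_mem[OF inf mean_g'_D[OF p]])
qed

lemma uminus_bounded_measurable: "bounded_measurable L H \<Longrightarrow> bounded_measurable L (\<lambda>p. - H p)"
  by (simp add: bounded_measurable_def)

lemma lower_infinite_band:
  assumes inf: "lower_end D = -\<infinity>" and p: "p \<in> TS"
  shows "- grow (fst p) \<le> V.lin g' (\<lambda>p. - grow_source (fst p)) p" "V.lin g' (\<lambda>p. - grow_source (fst p)) p \<in> D"
proof -
  note bm = uminus_bounded_measurable[OF grow_bounded_measurable(2)]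
  have "bounded_slices C (\<lambda>_. - C)" using C_nonneg by (simp add: bounded_slices_def)
  then have "V.lin (\<lambda>_. - C) (\<lambda>p. - grow_source (fst p)) p \<le> V.lin g' (\<lambda>p. - grow_source (fst p)) p"
    using g_le by (intro V.lin_mono[OF _ g'_slices bm bm _ _ p]) (auto simp: abs_le_iff minus_le_iff)
  then show "- grow (fst p) \<le> V.lin g' (\<lambda>p. - grow_source (fst p)) p"
    by (simp add: V.lin_uminus grow_lin[OF p])
  have "V.lin g' (\<lambda>p. - grow_source (fst p)) p \<le> V.lin g' (\<lambda>_. - C) p"
  proof (rule V.lin_mono[OF g'_slices g'_slices bm constant_bounded_measurable _ _ p])
    show "\<bar>- C\<bar> \<le> 2 * R" using C_nonneg C_less_R by simp
    show "- grow_source (fst (s, y)) \<le> - C" if "s \<in> {0..T}" for s and y :: 's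
      using grow_bounds(1)[OF that] grow_source_bounds(1)[OF that] by simp
  qed simp
  also have "\<dots> \<le> mean g' T p"
    using lin_constant_le(2)[OF p, of "- C"] mean_g'_bound[OF p] by (auto simp: abs_le_iff)
  finally show "V.lin g' (\<lambda>p. - grow_source (fst p)) p \<in> D"
    by (rule lower_infinite_mem[OF inf mean_g'_D[OF p]])
qed

text \<open>The boundary condition makes \<open>f\<close> nonnegative in the limit at
  \<open>b\<close>, so the Lipschitz bound gives \<open>f s x w \<ge> - l s * (b - w)\<close>.
  Division by \<open>l s\<close> produces exactly the distance to \<open>b\<close>: the
  normalisation to Lipschitz constant 1 is what makes \<open>b\<close> a valid bound.\<close>

lemma upper_finite_step:
  assumes fin: "upper_end D < \<infinity>" and s: "s \<in> {0..T}" and w: "w \<in> D" "\<bar>w\<bar> \<le> R"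
  shows "w - drv N l s x w \<le> b"
proof -
  obtain b' where b': "b = b'" "\<And>w. w \<in> D \<Longrightarrow> w \<le> b'" "\<And>v. v < b' \<Longrightarrow> \<exists>w\<in>D. v < w"
    using upper_end_real[OF fin] by metis
  have wb: "w \<le> b" using b'(1) b'(2)[OF w(1)] by simp
  show ?thesis
  proof (cases "s \<in> N \<or> l s = 0")
    case False
    then have lp: "0 < l s" using l_nonneg'[OF s] by simp
    obtain L where L: "0 \<le> L" "(f s x \<longlongrightarrow> L) (at_left b)" using limit_upper[OF fin s] False by blast
    obtain c c' where cc: "c \<in> D" "c' \<in> D" "c < c'" using D_nondegenerate by auto
    have cb: "c < b" using cc(3) b'(1) b'(2)[OF cc(2)] by simp
    have Rb: "- R < b" "b \<le> R" using upper_le[OF fin] C_less_R by linarith+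
    \<comment> \<open>Points just below \<open>b\<close> lie in \<open>D\<close>, since they exceed
      its element \<open>c\<close>, and in the range where \<open>regular\<close> applies.\<close>
    have "\<forall>\<^sub>F w' in at_left b. max c (- R) < w' \<and> w' < b"
      using eventually_at_left_real[of "max c (- R)" b] cb Rb by (simp add: greaterThanLessThan_iff)
    then have "\<forall>\<^sub>F w' in at_left b. \<bar>f s x w - f s x w'\<bar> \<le> l s * \<bar>w - w'\<bar>"
    proof eventually_elim
      case (elim w')
      then obtain v where "v \<in> D" "w' < v" using b'(1,3) by blast
      then have "w' \<in> D" using elim D_mem[OF cc(1), of v w'] by simp
      then show ?case using False elim w Rb by (intro regular_onD(2)[OF regular[OF s]]) auto
    qed
    then have "\<bar>f s x w - L\<bar> \<le> l s * \<bar>w - b\<bar>"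
      by (intro lipschitz_tendsto_bound[OF L(2)]) auto
    then have "- (l s * (b - w)) \<le> f s x w" using L(1) wb by (simp add: abs_le_iff)
    then have "- (b - w) * l s \<le> f s x w" by (simp add: algebra_simps)
    then have "- (b - w) \<le> f s x w / l s" using lp by (simp only: pos_le_divide_eq)
    then show ?thesis using False by (simp add: drv_def)
  qed (use wb in \<open>auto simp: drv_def\<close>)
qed

lemma lower_finite_step:
  assumes fin: "lower_end D > -\<infinity>" and s: "s \<in> {0..T}" and w: "w \<in> D" "\<bar>w\<bar> \<le> R"
  shows "a \<le> w - drv N l s x w"
proof -
  obtain a' where a': "a = a'" "\<And>w. w \<in> D \<Longrightarrow> a' \<le> w" "\<And>v. a' < v \<Longrightarrow> \<exists>w\<in>D. w < v"
    using lower_end_real[OF fin] by metis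
  have wa: "a \<le> w" using a'(1) a'(2)[OF w(1)] by simp
  show ?thesis
  proof (cases "s \<in> N \<or> l s = 0")
    case False
    then have lp: "0 < l s" using l_nonneg'[OF s] by simp
    obtain L where L: "L \<le> 0" "(f s x \<longlongrightarrow> L) (at_right a)" using limit_lower[OF fin s] False by blast
    obtain c c' where cc: "c \<in> D" "c' \<in> D" "c < c'" using D_nondegenerate by auto
    have ca: "a < c'" using cc(3) a'(1) a'(2)[OF cc(1)] by simp
    have Ra: "- R \<le> a" "a < R" using lower_le[OF fin] C_less_R by linarith+
    have "\<forall>\<^sub>F w' in at_right a. a < w' \<and> w' < min c' R"
      using eventually_at_right_real[of a "min c' R"] ca Ra by (simp add: greaterThanLessThan_iff)
    then have "\<forall>\<^sub>F w' in at_right a. \<bar>f s x w - f s x w'\<bar> \<le> l s * \<bar>w - w'\<bar>"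
    proof eventually_elim
      case (elim w')
      then obtain v where "v \<in> D" "v < w'" using a'(1,3) by blast
      then have "w' \<in> D" using elim D_mem[OF _ cc(2), of v w'] by simp
      then show ?case using False elim w Ra by (intro regular_onD(2)[OF regular[OF s]]) auto
    qed
    then have "\<bar>f s x w - L\<bar> \<le> l s * \<bar>w - a\<bar>"
      by (intro lipschitz_tendsto_bound[OF L(2)]) auto
    then have "f s x w \<le> l s * (w - a)" using L(1) wa by (simp add: abs_le_iff)
    then have "f s x w / l s \<le> w - a" using lp by (simp add: pos_divide_le_eq mult.commute)
    then show ?thesis using False by (simp add: drv_def)
  qed (use wa in \<open>auto simp: drv_def\<close>)
qed

text \<open>Monotonicity of \<open>w - h(w)\<close> replaces \<open>w\<close> by the top of the
  band, where the affine bound on \<open>f\<close> is evaluated. As \<open>grow\<close> is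
  nonnegative, \<open>1 + \<bar>w\<bar>\<close> becomes \<open>1 + grow\<close> and the result is
  \<open>grow_source\<close>.\<close>

lemma upper_infinite_step:
  assumes inf: "upper_end D = \<infinity>" and s: "s \<in> {0..T}" and w: "w \<in> D" "\<bar>w\<bar> \<le> R" "w \<le> grow s"
  shows "w - drv N l s x w \<le> grow_source s"
proof (cases "s \<in> N \<or> l s = 0")
  case True
  then show ?thesis using w(3) grow_source_bounds(1)[OF s] by (auto simp: drv_def)
next
  case False
  then have lp: "0 < l s" using l_nonneg'[OF s] by simp
  have gD: "grow s \<in> D" by (rule upper_infinite_mem[OF inf w(1,3)])
  have g0: "0 \<le> grow s" "\<bar>grow s\<bar> \<le> R" using grow_bounds[OF s] C_nonneg by auto
  have "\<bar>drv N l s x w - drv N l s x (grow s)\<bar> \<le> \<bar>w - grow s\<bar>"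
    by (rule V.h_lipschitz[OF s w(1,2) gD g0(2)])
  then have "w - drv N l s x w \<le> grow s - drv N l s x (grow s)" using w(3) by linarith
  moreover have "- (\<kappa> s * (1 + grow s)) / l s \<le> f s x (grow s) / l s"
    using affine_lower[OF inf s _ gD, of x] False lp g0 by (intro divide_right_mono) auto
  ultimately show ?thesis using False by (simp add: drv_def grow_source_def)
qed

lemma lower_infinite_step:
  assumes inf: "lower_end D = -\<infinity>" and s: "s \<in> {0..T}" and w: "w \<in> D" "\<bar>w\<bar> \<le> R" "- grow s \<le> w"
  shows "- grow_source s \<le> w - drv N l s x w"
proof (cases "s \<in> N \<or> l s = 0")
  case True
  then show ?thesis using w(3) grow_source_bounds(1)[OF s] by (auto simp: drv_def)
next
  case False
  then have lp: "0 < l s" using l_nonneg'[OF s] by simp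
  have gD: "- grow s \<in> D" by (rule lower_infinite_mem[OF inf w(1,3)])
  have g0: "0 \<le> grow s" "\<bar>- grow s\<bar> \<le> R" using grow_bounds[OF s] C_nonneg by auto
  have "\<bar>drv N l s x w - drv N l s x (- grow s)\<bar> \<le> \<bar>w - (- grow s)\<bar>"
    by (rule V.h_lipschitz[OF s w(1,2) gD g0(2)])
  then have "- grow s - drv N l s x (- grow s) \<le> w - drv N l s x w" using w(3) by linarith
  moreover have "f s x (- grow s) / l s \<le> \<kappa> s * (1 + grow s) / l s"
    using affine_upper[OF inf s _ gD, of x] False lp g0 by (intro divide_right_mono) auto
  ultimately show ?thesis using False by (simp add: drv_def grow_source_def)
qed

section \<open>The band for finite and infinite ends\<close>

definition \<alpha> where "\<alpha> = (if lower_end D = -\<infinity> then (\<lambda>s. - grow s) else (\<lambda>_. a))"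
definition lo where "lo = (if lower_end D = -\<infinity> then (\<lambda>s. - grow_source s) else (\<lambda>_. a))"
definition \<beta> where "\<beta> = (if upper_end D = \<infinity> then grow else (\<lambda>_. b))"
definition hi where "hi = (if upper_end D = \<infinity> then grow_source else (\<lambda>_. b))"

lemma lower_end_cases: "lower_end D = -\<infinity> \<or> lower_end D > -\<infinity>"
  and upper_end_cases: "upper_end D = \<infinity> \<or> upper_end D < \<infinity>"
  by auto

sublocale B: driver_band T d M F X P "nu l" D "drv N l" R g \<alpha> \<beta> lo hi C "2 * R"
proof unfold_locales
  show "is_interval D" by (rule D_interval)
  show "bounded_slices C g'" by (rule g'_slices)
  have aR: "\<bar>a\<bar> \<le> R" "- R \<le> a" if "lower_end D > -\<infinity>"
    using lower_le[OF that] C_less_R by linarith+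
  have bR: "\<bar>b\<bar> \<le> R" "b \<le> R" if "upper_end D < \<infinity>"
    using upper_le[OF that] C_less_R by linarith+
  have R0: "0 \<le> R" using C_nonneg C_less_R by simp
  have band: "- R \<le> \<alpha> s" "\<beta> s \<le> R" if "s \<in> {0..T}" for s
    using grow_bounds[OF that] aR bR lower_end_cases upper_end_cases by (auto simp: \<alpha>_def \<beta>_def abs_le_iff)
  then show "- R \<le> \<alpha> s" "\<beta> s \<le> R" if "s \<in> {0..T}" for s using that by auto
  show "bounded_measurable (2 * R) (\<lambda>p. lo (fst p))"
    using lower_end_cases aR R0
    by (auto simp: lo_def intro!: uminus_bounded_measurable grow_bounded_measurable constant_bounded_measurable)
  show "bounded_measurable (2 * R) (\<lambda>p. hi (fst p))"
    using upper_end_cases bR R0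
    by (auto simp: hi_def intro!: grow_bounded_measurable constant_bounded_measurable)
  \<comment> \<open>Two finite ends are compared through a point of \<open>D\<close>, a finite with
    an infinite one through \<open>C\<close>, which bounds the finite ends and lies below
    \<open>grow_source\<close>.\<close>
  show "lo s \<le> hi s" if s: "s \<in> {0..T}" for s
  proof -
    have m: "mean g' T (T, undefined) \<in> D" using T_pos by (intro mean_g'_D) auto
    have "a \<le> C" if "lower_end D > -\<infinity>" using lower_le[OF that] by linarith
    moreover have "- C \<le> b" if "upper_end D < \<infinity>" using upper_le[OF that] by linarith
    moreover
    have "lower_end D > -\<infinity> \<Longrightarrow> a \<le> mean g' T (T, undefined)"
      using lower_end_real m by metis
    moreover have "upper_end D < \<infinity> \<Longrightarrow> mean g' T (T, undefined) \<le> b"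
      using upper_end_real m by metis
    ultimately show ?thesis
      using lower_end_cases upper_end_cases grow_bounds[OF s] grow_source_bounds[OF s] C_nonneg
      by (auto simp: lo_def hi_def abs_le_iff)
  qed
  fix s w and x :: 's assume s: "s \<in> {0..T}" and w: "w \<in> D" "\<alpha> s \<le> w" "w \<le> \<beta> s"
  then have wR: "\<bar>w\<bar> \<le> R" using band[OF s] by (simp add: abs_le_iff)
  show "lo s \<le> w - drv N l s x w"
    using lower_end_cases lower_infinite_step[OF _ s w(1) wR] lower_finite_step[OF _ s w(1) wR] w(2)
    by (auto simp: lo_def \<alpha>_def)
  show "w - drv N l s x w \<le> hi s"
    using upper_end_cases upper_infinite_step[OF _ s w(1) wR] upper_finite_step[OF _ s w(1) wR] w(3)
    by (auto simp: hi_def \<beta>_def)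
next
  fix p :: "real \<times> 's" assume p: "p \<in> TS"
  show "\<alpha> (fst p) \<le> V.lin g' (\<lambda>p. lo (fst p)) p \<and> V.lin g' (\<lambda>p. lo (fst p)) p \<in> D"
    using lower_end_cases lower_infinite_band[OF _ p] lower_finite_band[OF _ p] by (auto simp: lo_def \<alpha>_def)
  show "V.lin g' (\<lambda>p. hi (fst p)) p \<le> \<beta> (fst p) \<and> V.lin g' (\<lambda>p. hi (fst p)) p \<in> D"
    using upper_end_cases upper_infinite_band[OF _ p] upper_finite_band[OF _ p] by (auto simp: hi_def \<beta>_def)
qed

end

section \<open>Existence, uniqueness and regularity\<close>

context semilinear_problem begin

text \<open>One function replaces both coefficients at the price of the factor
  \<open>1 + \<bar>w\<bar>\<close>, which is the form of the equation solved by
  \<open>grow\<close>.\<close>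

lemma affine_dominator:
  assumes "affine_mu_bounded_below T \<mu> d D k"
  shows "\<exists>\<kappa>. dominating \<kappa> \<and> (AE s in \<mu>. \<forall>x. \<forall>w\<in>D. - (\<kappa> s * (1 + \<bar>w\<bar>)) \<le> k s x w)"
proof -
  obtain a b where a: "mu_dominated T \<mu> d a" and b: "mu_dominated T \<mu> d b"
    and le: "\<forall>t\<in>{0..T}. \<forall>x. \<forall>w\<in>D. k t x w \<ge> - a (t, x) - b (t, x) * \<bar>w\<bar>"
    using assms unfolding affine_mu_bounded_below_def by blast
  obtain la where la: "dominating la" "AE s in \<mu>. \<forall>y. 0 \<le> a (s, y) \<and> a (s, y) \<le> la s"
    using mu_dominated_dominating[OF a] .
  obtain lb where lb: "dominating lb" "AE s in \<mu>. \<forall>y. 0 \<le> b (s, y) \<and> b (s, y) \<le> lb s"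
    using mu_dominated_dominating[OF b] .
  have "AE s in \<mu>. \<forall>x. \<forall>w\<in>D. - ((la s + lb s) * (1 + \<bar>w\<bar>)) \<le> k s x w"
    using la(2) lb(2) AE_space
  proof eventually_elim
    case (elim s)
    show ?case
    proof (intro allI ballI)
      fix x w assume w: "w \<in> D"
      have "- a (s, x) - b (s, x) * \<bar>w\<bar> \<le> k s x w" using le w elim(3) by (simp add: space_mu)
      moreover have "a (s, x) \<le> la s" "b (s, x) * \<bar>w\<bar> \<le> lb s * \<bar>w\<bar>" "0 \<le> la s" "0 \<le> lb s"
        using elim(1)[rule_format, of x] elim(2)[rule_format, of x] by (auto intro: mult_right_mono)
      moreover have "0 \<le> la s * \<bar>w\<bar>" using calculation(4) by simp
      ultimately show "- ((la s + lb s) * (1 + \<bar>w\<bar>)) \<le> k s x w"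
        unfolding distrib_left distrib_right mult_1_right by linarith
    qed
  qed
  then show ?thesis using dominating_add[OF la(1) lb(1)] by blast
qed

lemma dominated_problem_exists: "\<exists>\<kappa> l N C R. dominated_problem T d M F X P \<mu> D f g \<kappa> l N C R"
proof -
  have zero: "dominating (\<lambda>_. 0)" by (simp add: dominating_def)
  have "\<exists>\<kappa>. dominating \<kappa> \<and> (AE s in \<mu>. upper_end D = \<infinity> \<longrightarrow> (\<forall>x. \<forall>w\<in>D. - (\<kappa> s * (1 + \<bar>w\<bar>)) \<le> f s x w))"
    using affine_dominator[OF upper_infinite] zero by (cases "upper_end D = \<infinity>") auto
  then obtain k1 where k1: "dominating k1"
    "AE s in \<mu>. upper_end D = \<infinity> \<longrightarrow> (\<forall>x. \<forall>w\<in>D. - (k1 s * (1 + \<bar>w\<bar>)) \<le> f s x w)" by blast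
  have "\<exists>\<kappa>. dominating \<kappa> \<and> (AE s in \<mu>. lower_end D = -\<infinity> \<longrightarrow> (\<forall>x. \<forall>w\<in>D. - (\<kappa> s * (1 + \<bar>w\<bar>)) \<le> - f s x w))"
    using affine_dominator[OF lower_infinite[unfolded affine_mu_bounded_above_def]] zero
    by (cases "lower_end D = -\<infinity>") auto
  then obtain k2 where k2: "dominating k2"
    "AE s in \<mu>. lower_end D = -\<infinity> \<longrightarrow> (\<forall>x. \<forall>w\<in>D. - (k2 s * (1 + \<bar>w\<bar>)) \<le> - f s x w)" by blast
  define \<kappa> where "\<kappa> = (\<lambda>s. k1 s + k2 s)"
  have kappa: "dominating \<kappa>" unfolding \<kappa>_def by (rule dominating_add[OF k1(1) k2(1)])
  obtain C0 where C0: "\<And>x. \<bar>g x\<bar> \<le> C0" using g_bounded by (auto simp: bounded_iff)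
  have "0 \<le> C0" using C0[of undefined] by linarith
  \<comment> \<open>An infinite end contributes zero here, so the same formula covers all four
    cases.\<close>
  define C where "C = C0 + \<bar>real_of_ereal (lower_end D)\<bar> + \<bar>real_of_ereal (upper_end D)\<bar>"
  have gC: "\<bar>g x\<bar> \<le> C" for x using C0[of x] unfolding C_def by linarith
  have aC: "\<bar>real_of_ereal (lower_end D)\<bar> \<le> C" and bC: "\<bar>real_of_ereal (upper_end D)\<bar> \<le> C"
    using \<open>0 \<le> C0\<close> unfolding C_def by linarith+
  define R where "R = (C + 1) * exp (time_measure.clock T (nu \<kappa>) T)"
  have "0 \<le> C" using gC[of undefined] by linarith
  then have "0 \<le> R" by (simp add: R_def)
  then obtain l0 where l0: "dominating l0" "AE s in \<mu>. regular_on (- R) R l0 s"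
    using compact_dominator[of "- R" R] by auto
  \<comment> \<open>Adding \<open>\<kappa>\<close> to the dominating function for the range
    \<open>[-R, R]\<close> keeps \<open>\<kappa> / l\<close> at most 1.\<close>
  define l where "l = (\<lambda>s. \<kappa> s + l0 s)"
  let ?lim1 = "\<lambda>s. lower_end D > -\<infinity> \<longrightarrow> (\<forall>x. \<exists>L\<le>0. (f s x \<longlongrightarrow> L) (at_right (real_of_ereal (lower_end D))))"
  let ?lim2 = "\<lambda>s. upper_end D < \<infinity> \<longrightarrow> (\<forall>x. \<exists>L\<ge>0. (f s x \<longlongrightarrow> L) (at_left (real_of_ereal (upper_end D))))"
  let ?cont = "\<lambda>s. continuous_on (UNIV \<times> D) (\<lambda>(x, w). f s x w)"
  let ?A1 = "\<lambda>s. upper_end D = \<infinity> \<longrightarrow> (\<forall>x. \<forall>w\<in>D. - (k1 s * (1 + \<bar>w\<bar>)) \<le> f s x w)"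
  let ?A2 = "\<lambda>s. lower_end D = -\<infinity> \<longrightarrow> (\<forall>x. \<forall>w\<in>D. - (k2 s * (1 + \<bar>w\<bar>)) \<le> - f s x w)"
  have lim: "AE s in \<mu>. ?lim1 s" "AE s in \<mu>. ?lim2 s"
    using lower_finite upper_finite by (cases "lower_end D > -\<infinity>"; cases "upper_end D < \<infinity>"; simp)+
  \<comment> \<open>If continuity fails on a non-null set, the implication is vacuous; either way
    one null set suffices.\<close>
  have cont: "AE s in \<mu>. (AE s in \<mu>. ?cont s) \<longrightarrow> ?cont s"
    by (cases "AE s in \<mu>. ?cont s") simp_all
  define Good where "Good s \<longleftrightarrow> regular_on (- R) R l0 s \<and> ?A1 s \<and> ?A2 s \<and> ?lim1 s \<and> ?lim2 s \<and>
      ((AE s in \<mu>. ?cont s) \<longrightarrow> ?cont s)" for s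
  have "AE s in \<mu>. Good s"
    unfolding Good_def using l0(2) k1(2) k2(2) lim cont by eventually_elim (intro conjI; assumption)
  then obtain N where N: "{s\<in>space \<mu>. \<not> Good s} \<subseteq> N" "emeasure \<mu> N = 0" "N \<in> sets \<mu>"
    by (rule AE_E)
  then have null: "N \<in> null_sets \<mu>" by auto
  have good: "Good s" if "s \<in> {0..T}" "s \<notin> N" for s
    using N(1) that by (auto simp: space_mu)
  note off = good[unfolded Good_def]
  have nn: "0 \<le> k1 s" "0 \<le> k2 s" "0 \<le> l0 s" "0 \<le> \<kappa> s" if "s \<in> {0..T}" for s
    using k1(1) k2(1) l0(1) kappa that unfolding dominating_def by blast+
  have "dominated_problem T d M F X P \<mu> D f g \<kappa> l N C R"
  proof (rule dominated_problem.intro[OF semilinear_problem_axioms], rule dominated_problem_axioms.intro)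
    show "dominating \<kappa>" by (rule kappa)
    show "dominating l" unfolding l_def by (rule dominating_add[OF kappa l0(1)])
    show "\<kappa> s \<le> l s" if "s \<in> {0..T}" for s using nn[OF that] by (simp add: l_def)
    show "\<bar>g x\<bar> \<le> C" for x by (rule gC)
    show "\<bar>real_of_ereal (lower_end D)\<bar> \<le> C" "\<bar>real_of_ereal (upper_end D)\<bar> \<le> C" by (rule aC bC)+
    show "R = (C + 1) * exp (time_measure.clock T (nu \<kappa>) T)" by (rule R_def)
    show "N \<in> null_sets \<mu>" by (rule null)
  next
    fix s assume s: "s \<in> {0..T}" "s \<notin> N"
    note reg = off[OF s, THEN conjunct1] and rest1 = off[OF s, THEN conjunct2]
    note A1 = rest1[THEN conjunct1] and rest2 = rest1[THEN conjunct2]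
    note A2 = rest2[THEN conjunct1] and rest3 = rest2[THEN conjunct2]
    note l1 = rest3[THEN conjunct1] and rest4 = rest3[THEN conjunct2]
    note l2 = rest4[THEN conjunct1] and co = rest4[THEN conjunct2]
    show "regular_on (- R) R l s"
      by (rule regular_on_mono[OF reg]) (use nn[OF s(1)] in \<open>simp add: l_def\<close>)
    show "\<exists>L\<le>0. (f s x \<longlongrightarrow> L) (at_right (real_of_ereal (lower_end D)))" if "lower_end D > -\<infinity>" for x
      using l1 that by simp
    show "\<exists>L\<ge>0. (f s x \<longlongrightarrow> L) (at_left (real_of_ereal (upper_end D)))" if "upper_end D < \<infinity>" for x
      using l2 that by simp
    show "?cont s" if "AE s in \<mu>. ?cont s"
      using co that by (rule mp)
    fix w x assume w: "w \<in> D"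
    show "- (\<kappa> s * (1 + \<bar>w\<bar>)) \<le> f s x w" if "upper_end D = \<infinity>"
    proof -
      have "- (k1 s * (1 + \<bar>w\<bar>)) \<le> f s x w" using A1 that w by simp
      moreover have "0 \<le> k2 s * (1 + \<bar>w\<bar>)" using nn[OF s(1)] by simp
      ultimately show ?thesis unfolding \<kappa>_def distrib_right by linarith
    qed
    show "f s x w \<le> \<kappa> s * (1 + \<bar>w\<bar>)" if "lower_end D = -\<infinity>"
    proof -
      have "- (k2 s * (1 + \<bar>w\<bar>)) \<le> - f s x w" using A2 that w by simp
      moreover have "0 \<le> k1 s * (1 + \<bar>w\<bar>)" using nn[OF s(1)] by simp
      ultimately show ?thesis unfolding \<kappa>_def distrib_right by linarith
    qed
  qed
  then show ?thesis by blast
qed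

lemma mem_interior: "lower_end D < ereal z \<Longrightarrow> ereal z < upper_end D \<Longrightarrow> z \<in> interior D"
proof -
  assume "lower_end D < ereal z" "ereal z < upper_end D"
  then obtain v w where vw: "v \<in> D" "v < z" "w \<in> D" "z < w"
    by (auto simp: lower_end_less upper_end_greater)
  then have "{v<..<w} \<subseteq> D" using D_mem[OF vw(1,3)] by auto
  then show ?thesis using vw by (intro interiorI[of "{v<..<w}"]) auto
qed

end

context dominated_problem begin

section \<open>The bounded global solution and its uniqueness\<close>

abbreviation "u \<equiv> B.sol"

lemma sol_bound: "p \<in> TS \<Longrightarrow> \<bar>u p\<bar> \<le> R"
  by (rule B.betweenD(4)[OF B.sol_between])

lemma sol_bounded: "bounded (u ` ({r..T} \<times> UNIV))" if "0 \<le> r"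
  unfolding bounded_iff using sol_bound that by (intro exI[of _ R]) auto

lemma sol_solution: "solution_M T \<mu> d M X P D f g {0..T} u"
  by (rule solution_of_backward_equation[OF l N regular B.between_driver[OF B.sol_between] B.sol_consistent g_le B.sol_equation])

lemma sol_bounded_global: "bounded_global_solution_M T \<mu> d M X P D f g u"
  unfolding bounded_global_solution_M_def using sol_solution sol_bounded[of 0] by simp

lemma sol_unique_bounded:
  assumes v: "bounded_global_solution_M T \<mu> d M X P D f g v" and p: "p \<in> TS"
  shows "v p = u p"
proof -
  have v': "solution_M T \<mu> d M X P D f g {0..T} v" "bounded (v ` TS)"
    using v by (auto simp: bounded_global_solution_M_def)
  have "0 \<in> {0..T}" using T_pos by auto
  from bounded_solutions_agree[OF v'(1) sol_solution this this v'(2) sol_bounded[OF order_refl], of "fst p" "snd p"]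
  show ?thesis using p by auto
qed

lemma admissible_interval_subset: "admissible_interval T I \<Longrightarrow> I \<subseteq> {0..T}"
  by (auto simp: admissible_interval_def)

text \<open>Relative compactness of the values on \<open>[r, T]\<close> provides the boundedness
  under which two solutions agree.\<close>

lemma admissible_agrees:
  assumes v: "admissible_solution_M T \<mu> d M X P D f g I v" and r: "r \<in> I"
  shows "v (r, x) = u (r, x)"
proof -
  have sv: "solution_M T \<mu> d M X P D f g I v"
    and cv: "compact (closure (v ` ({r..T} \<times> UNIV)))"
    using v r unfolding admissible_solution_M_def by blast+
  have bv: "bounded (v ` ({r..T} \<times> UNIV))"
    using compact_imp_bounded[OF cv] by (rule bounded_subset) (rule closure_subset)
  have rT: "r \<in> {0..T}"
    using sv r admissible_interval_subset unfolding solution_M_def by blast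
  show ?thesis
    by (rule bounded_solutions_agree[OF sv sol_solution r rT bv sol_bounded]) (use rT in auto)
qed

text \<open>With the end as constant source, the distance of the linear solution to the end is the
  distance of the mean of \<open>g\<close>, multiplied by the discount factor. That factor is at
  least \<open>exp (- V.clock T)\<close>, so a gap of \<open>\<epsilon>\<close> at time
  \<open>T\<close> shrinks at most to \<open>\<delta>\<close>. The solution lies between the two
  linear solutions.\<close>

lemma sol_away_lower:
  assumes away: "bounded_away g {z. ereal z \<in> {lower_end D, upper_end D}}"
  obtains \<epsilon> where "\<epsilon> > 0" "\<And>p. p \<in> TS \<Longrightarrow> lower_end D > -\<infinity> \<Longrightarrow> a + \<epsilon> \<le> u p"
    "\<And>p. p \<in> TS \<Longrightarrow> upper_end D < \<infinity> \<Longrightarrow> u p \<le> b - \<epsilon>"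
proof -
  obtain \<epsilon> where \<epsilon>: "\<epsilon> > 0" "\<And>x z. ereal z \<in> {lower_end D, upper_end D} \<Longrightarrow> \<bar>g x - z\<bar> \<ge> \<epsilon>"
    using away unfolding bounded_away_def by blast
  define \<delta> where "\<delta> = exp (- V.clock T) * \<epsilon>"
  have gD: "g x \<in> D" for x using g_D by auto
  have TT: "T \<in> {0..T}" using T_pos by auto
  show ?thesis
  proof (rule that[of \<delta>])
    show "\<delta> > 0" using \<epsilon>(1) by (simp add: \<delta>_def)
  next
    fix p assume p: "p \<in> TS" and fin: "lower_end D > -\<infinity>"
    obtain a' where a': "lower_end D = ereal a'" "a = a'" "\<And>w. w \<in> D \<Longrightarrow> a' \<le> w"
      using lower_end_real[OF fin] by metis
    have ge: "a + \<epsilon> \<le> g x" for x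
      using \<epsilon>(2)[of a' x] a'(1,2) a'(3)[OF gD[of x]] by (auto simp: abs_if split: if_splits)
    have pT: "fst p \<in> {0..T}" using p by auto
    have "mean (\<lambda>_. a + \<epsilon>) T p \<le> mean g' T p"
      by (rule V.mean_mono[OF _ g'_slices TT pT, of "\<bar>a + \<epsilon>\<bar>"]) (auto simp: bounded_slices_def ge)
    then have m: "\<epsilon> \<le> mean g' T p - a" using V.mean_deterministic[OF pT, of "\<lambda>_. a + \<epsilon>" T "a + \<epsilon>"] by simp
    have "\<delta> \<le> exp (V.clock (fst p) - V.clock T) * (mean g' T p - a)"
      unfolding \<delta>_def using m \<epsilon>(1) V.discount_factor[OF pT] by (intro mult_mono) auto
    then have "a + \<delta> \<le> V.lin g' (\<lambda>_. a) p" unfolding lin_g'_constant[OF p] by (simp add: algebra_simps)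
    moreover have "V.lin g' (\<lambda>p. lo (fst p)) p \<le> u p" using B.sol_between p by (auto simp: B.between_def)
    moreover have "lo = (\<lambda>_. a)" using fin by (auto simp: lo_def)
    ultimately show "a + \<delta> \<le> u p" by simp
  next
    fix p assume p: "p \<in> TS" and fin: "upper_end D < \<infinity>"
    obtain b' where b': "upper_end D = ereal b'" "b = b'" "\<And>w. w \<in> D \<Longrightarrow> w \<le> b'"
      using upper_end_real[OF fin] by metis
    have le: "g x \<le> b - \<epsilon>" for x
      using \<epsilon>(2)[of b' x] b'(1,2) b'(3)[OF gD[of x]] by (auto simp: abs_if split: if_splits)
    have pT: "fst p \<in> {0..T}" using p by auto
    have "mean g' T p \<le> b - \<epsilon>"
      using V.mean_le[OF g'_slices TT pT, of "b - \<epsilon>"] le by simp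
    then have m: "\<epsilon> \<le> b - mean g' T p" by simp
    have "\<delta> \<le> exp (V.clock (fst p) - V.clock T) * (b - mean g' T p)"
      unfolding \<delta>_def using m \<epsilon>(1) V.discount_factor[OF pT] by (intro mult_mono) auto
    then have "V.lin g' (\<lambda>_. b) p \<le> b - \<delta>" unfolding lin_g'_constant[OF p] by (simp add: algebra_simps)
    moreover have "u p \<le> V.lin g' (\<lambda>p. hi (fst p)) p" using B.sol_between p by (auto simp: B.between_def)
    moreover have "hi = (\<lambda>_. b)" using fin by (auto simp: hi_def)
    ultimately show "u p \<le> b - \<delta>" by simp
  qed
qed

lemma sol_admissible:
  assumes away: "bounded_away g {z. ereal z \<in> {lower_end D, upper_end D}}"
  shows "admissible_solution_M T \<mu> d M X P D f g {0..T} u"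
  unfolding admissible_solution_M_def
proof (intro conjI ballI)
  fix r assume r: "r \<in> {0..T}"
  obtain \<epsilon> where \<epsilon>: "\<epsilon> > 0" "\<And>p. p \<in> TS \<Longrightarrow> lower_end D > -\<infinity> \<Longrightarrow> a + \<epsilon> \<le> u p"
    "\<And>p. p \<in> TS \<Longrightarrow> upper_end D < \<infinity> \<Longrightarrow> u p \<le> b - \<epsilon>"
    using sol_away_lower[OF away] by blast
  \<comment> \<open>The set is closed, so it contains the closure of the values, and an infinite end
    imposes no condition on it.\<close>
  define Z where "Z = {z. (lower_end D > -\<infinity> \<longrightarrow> a + \<epsilon> \<le> z) \<and> (upper_end D < \<infinity> \<longrightarrow> z \<le> b - \<epsilon>)}"
  have "closed Z"
    unfolding Z_def
    by (intro closed_Collect_conj closed_Collect_imp closed_Collect_le continuous_intros open_Collect_const)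
  moreover have "u ` ({r..T} \<times> UNIV) \<subseteq> Z" using \<epsilon>(2,3) r by (auto simp: Z_def)
  ultimately have sub: "closure (u ` ({r..T} \<times> UNIV)) \<subseteq> Z" by (rule closure_minimal[rotated])
  show "compact (closure (u ` ({r..T} \<times> UNIV)))"
    using sol_bounded[of r] r by simp
  have "Z \<subseteq> interior D"
  proof
    fix z assume z: "z \<in> Z"
    show "z \<in> interior D"
    proof (rule mem_interior)
      show "lower_end D < ereal z"
      proof (cases "lower_end D > -\<infinity>")
        case True
        obtain a' where "lower_end D = ereal a'" "a = a'" using lower_end_real[OF True] by metis
        then show ?thesis using z True \<epsilon>(1) by (auto simp: Z_def)
      qed auto
      show "ereal z < upper_end D"
      proof (cases "upper_end D < \<infinity>")
        case True
        obtain b' where "upper_end D = ereal b'" "b = b'" using upper_end_real[OF True] by metis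
        then show ?thesis using z True \<epsilon>(1) by (auto simp: Z_def)
      qed auto
    qed
  qed
  with sub show "closure (u ` ({r..T} \<times> UNIV)) \<subseteq> interior D" by (rule order_trans)
qed (rule sol_solution)

lemma sol_non_extendible:
  assumes away: "bounded_away g {z. ereal z \<in> {lower_end D, upper_end D}}"
  shows "non_extendible_solution_M T \<mu> d M X P D f g {0..T} u"
  unfolding non_extendible_solution_M_def extendible_M_def
proof (intro conjI sol_admissible[OF away] notI)
  assume "\<exists>J v. {0..T} \<subset> J \<and> admissible_solution_M T \<mu> d M X P D f g J v \<and> (\<forall>p\<in>TS. u p = v p)"
  then obtain J v where J: "{0..T} \<subset> J" "admissible_solution_M T \<mu> d M X P D f g J v" by blast
  then have "J \<subseteq> {0..T}"
    unfolding admissible_solution_M_def solution_M_def by (intro admissible_interval_subset) blast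
  with J(1) show False by blast
qed

text \<open>Every admissible solution coincides with \<open>u\<close> on its interval, and
  \<open>u\<close> is admissible on all of \<open>[0, T]\<close>; on a smaller interval it would be
  extended by \<open>u\<close>.\<close>

lemma non_extendible_unique:
  assumes away: "bounded_away g {z. ereal z \<in> {lower_end D, upper_end D}}"
    and v: "non_extendible_solution_M T \<mu> d M X P D f g I v"
  shows "I = {0..T}" and "p \<in> TS \<Longrightarrow> v p = u p"
proof -
  have av: "admissible_solution_M T \<mu> d M X P D f g I v" and ne: "\<not> extendible_M T \<mu> d M X P D f g I v"
    using v by (auto simp: non_extendible_solution_M_def)
  have sub: "I \<subseteq> {0..T}"
    using av unfolding admissible_solution_M_def solution_M_def by (intro admissible_interval_subset) blast
  have agree: "\<forall>p\<in>I \<times> UNIV. v p = u p" using admissible_agrees[OF av] by auto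
  show I: "I = {0..T}"
  proof (rule ccontr)
    assume "I \<noteq> {0..T}"
    with sub have "I \<subset> {0..T}" by blast
    then have "extendible_M T \<mu> d M X P D f g I v"
      unfolding extendible_M_def using sol_admissible[OF away] agree by blast
    with ne show False ..
  qed
  show "v p = u p" if "p \<in> TS" using agree that I by blast
qed

section \<open>Continuity of the solution\<close>

lemma drv_continuous:
  assumes cont: "AE s in \<mu>. continuous_on (UNIV \<times> D) (\<lambda>(x, w). f s x w)" and s: "s \<in> {0..T}"
  shows "continuous_on (UNIV \<times> D) (\<lambda>(x, w). drv N l s x w)"
proof (cases "s \<in> N \<or> l s = 0")
  case True
  then have "(\<lambda>(x, w). drv N l s x w) = (\<lambda>_. 0)" by (auto simp: drv_def)
  then show ?thesis by simp
next
  case False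
  then have "(\<lambda>(x, w). drv N l s x w) = (\<lambda>z. (case z of (x, w) \<Rightarrow> f s x w) / l s)" by (auto simp: drv_def)
  moreover have "continuous_on (UNIV \<times> D) (\<lambda>z. (case z of (x, w) \<Rightarrow> f s x w) / l s)"
    using False by (intro continuous_on_divide continuous_outside[OF cont s] continuous_on_const) auto
  ultimately show ?thesis by simp
qed

lemma sol_continuous:
  assumes "feller T d X P" "AE s in \<mu>. continuous_on (UNIV \<times> D) (\<lambda>(x, w). f s x w)" "continuous_on UNIV g"
  shows "pm_continuous TS d u"
proof -
  have *: "pm_continuous ({0..t} \<times> UNIV) d v \<longleftrightarrow> V.continuous_along (\<lambda>_ _. True) {0..t} v" if "t \<in> {0..T}" for t v
    unfolding pm_continuous_iff[OF pm_slab[OF that]] V.continuous_along_def by auto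
  have "V.feller_along (\<lambda>_ _. True)"
    using assms(1) * unfolding feller_def V.feller_along_def by blast
  from B.sol_continuous_along[OF _ this assms(3) drv_continuous[OF assms(2)]]
  have "V.continuous_along (\<lambda>_ _. True) {0..T} u" by simp
  then show ?thesis using *[of T] T_pos by simp
qed

lemma sol_right_continuous:
  assumes "right_hand_feller T d X P" "AE s in \<mu>. continuous_on (UNIV \<times> D) (\<lambda>(x, w). f s x w)" "continuous_on UNIV g"
  shows "pm_right_continuous {0..T} d u"
proof -
  have *: "pm_right_continuous J d v \<longleftrightarrow> V.continuous_along (\<le>) J v" for J v
    unfolding pm_right_continuous_def V.continuous_along_def ..
  have "V.feller_along (\<le>)"
    using assms(1) unfolding right_hand_feller_def V.feller_along_def * .
  from B.sol_continuous_along[OF _ this assms(3) drv_continuous[OF assms(2)]]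
  show ?thesis by (simp add: *)
qed

end

theorem theorem2p13:
  fixes T :: real and \<mu> :: "real measure"
    and d :: "('s::{metric_space, second_countable_topology}) pm"
    and M :: "'o measure" and F :: "real \<Rightarrow> 'o measure"
    and X :: "real \<Rightarrow> 'o \<Rightarrow> 's" and P :: "real \<Rightarrow> 's \<Rightarrow> 'o measure"
    and D :: "real set" and f :: "real \<Rightarrow> 's \<Rightarrow> real \<Rightarrow> real" and g :: "'s \<Rightarrow> real"
  assumes T: "T > 0"
    and mu_borel: "sets \<mu> = sets (restrict_space borel {0..T})"
    and mu_atomless: "atomless \<mu>"
    and pseudometric: "time_space_pseudometric T d"
    and time_continuous: "pm_continuous ({0..T} \<times> UNIV) d fst"
    and markov: "consistent_progressive_markov T d M F X P"
    and D_interval: "is_interval D"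
    and D_nondegenerate: "\<exists>a\<in>D. \<exists>b\<in>D. a < b"
    and g_borel: "g \<in> borel_measurable borel"
    and g_D: "range g \<subseteq> D"
    and g_bounded: "bounded (range g)"
    and g_consistent: "\<forall>x y. d (T, x) (T, y) = 0 \<longrightarrow> g x = g y"
    and f_BC: "f \<in> BC_mu T \<mu> d D"
    and lower_finite: "lower_end D > -\<infinity> \<Longrightarrow>
          locally_mu_bounded_at T \<mu> d D f (real_of_ereal (lower_end D)) \<and>
          locally_lipschitz_mu_at T \<mu> d D f (real_of_ereal (lower_end D)) \<and>
          (AE s in \<mu>. \<forall>x. \<exists>l\<le>0. (f s x \<longlongrightarrow> l) (at_right (real_of_ereal (lower_end D))))"
    and upper_finite: "upper_end D < \<infinity> \<Longrightarrow>
          locally_mu_bounded_at T \<mu> d D f (real_of_ereal (upper_end D)) \<and>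
          locally_lipschitz_mu_at T \<mu> d D f (real_of_ereal (upper_end D)) \<and>
          (AE s in \<mu>. \<forall>x. \<exists>l\<ge>0. (f s x \<longlongrightarrow> l) (at_left (real_of_ereal (upper_end D))))"
    and lower_infinite: "lower_end D = -\<infinity> \<Longrightarrow> affine_mu_bounded_above T \<mu> d D f"
    and upper_infinite: "upper_end D = \<infinity> \<Longrightarrow> affine_mu_bounded_below T \<mu> d D f"
  shows "\<exists>u.
     bounded_global_solution_M T \<mu> d M X P D f g u \<and>
     (\<forall>v. bounded_global_solution_M T \<mu> d M X P D f g v \<longrightarrow>
        (\<forall>p\<in>{0..T} \<times> UNIV. v p = u p)) \<and>
     (bounded_away g {z. ereal z \<in> {lower_end D, upper_end D}} \<longrightarrow>
        non_extendible_solution_M T \<mu> d M X P D f g {0..T} u \<and>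
        (\<forall>I v. non_extendible_solution_M T \<mu> d M X P D f g I v \<longrightarrow>
           I = {0..T} \<and> (\<forall>p\<in>{0..T} \<times> UNIV. v p = u p))) \<and>
     (feller T d X P \<and>
      (AE s in \<mu>. continuous_on (UNIV \<times> D) (\<lambda>(x, w). f s x w)) \<and>
      continuous_on UNIV g \<longrightarrow>
        pm_continuous ({0..T} \<times> UNIV) d u) \<and>
     (right_hand_feller T d X P \<and>
      (AE s in \<mu>. continuous_on (UNIV \<times> D) (\<lambda>(x, w). f s x w)) \<and>
      continuous_on UNIV g \<longrightarrow>
        pm_right_continuous {0..T} d u)"
proof -
  interpret semilinear_problem T d M F X P \<mu> D f g
    using assms by unfold_locales
  obtain \<kappa> l N C R where "dominated_problem T d M F X P \<mu> D f g \<kappa> l N C R"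
    using dominated_problem_exists by blast
  then interpret S: dominated_problem T d M F X P \<mu> D f g \<kappa> l N C R .
  show ?thesis
    using S.sol_bounded_global S.sol_unique_bounded S.sol_non_extendible S.non_extendible_unique
      S.sol_continuous S.sol_right_continuous
    by (intro exI[of _ S.B.sol] conjI allI impI ballI) blast+
qed

end
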